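(* Let $G$ be the affine group of either $\mathbb{R}$ or $\mathbb{C}$. Then $L^1(G)$ is not directly finite, and for every $1<p<\infty$ the algebra $\mathrm{PF}_p(G)$ is not directly finite.
   Context: For $\mathbb{F}=\mathbb{R}$ or $\mathbb{C}$, the affine group of $\mathbb{F}$ is the group of matrices $\begin{pmatrix} a & b\\ 0& 1\end{pmatrix}$ with $a\in\mathbb{F}\setminus\{0\}$, $b\in\mathbb{F}$, with its natural (locally compact) topology. Algebras need not be commutative nor have an identity. For $a,b$ in an algebra (or ring) $R$ put $a\bullet b := a+b-ab$. $R$ is called directly finite if for all $a,b\in R$, $a\bullet b=0$ implies $b\bullet a=0$. Fix a left Haar measure on $G$. $L^1(G)$ is an algebra under convolution. $C_c(G)$ is the space of continuous compactly supported functions $G\to\mathbb{C}$, also an algebra under convolution. For $p\in(1,\infty)$, $\lambda_p: C_c(G)\to\mathcal{B}(L^p(G))$ is the homomorphism $\lambda_p(f)(h)=f*h$. The algebra of $p$-pseudofunctions $\mathrm{PF}_p(G)$ is the operator-norm closure of $\lambda_p(C_c(G))$ in $\mathcal{B}(L^p(G))$. *)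

theory Defs
  imports "HOL-Analysis.Analysis" "HOL-Algebra.Ring"
begin

section \<open>Direct finiteness of (not necessarily unital) rings\<close>

text \<open>
  Rings and algebras are not assumed to have an identity, so direct finiteness is phrased through
  the circle operation. Only the fields \<open>carrier\<close>, \<open>mult\<close>, \<open>zero\<close> and \<open>add\<close> of the record play a
  role; for the non-unital algebras below the field \<open>one\<close> is left unspecified.
\<close>

definition circ :: "('r, 'm) ring_scheme \<Rightarrow> 'r \<Rightarrow> 'r \<Rightarrow> 'r" where
  "circ R a b = (a \<oplus>\<^bsub>R\<^esub> b) \<ominus>\<^bsub>R\<^esub> (a \<otimes>\<^bsub>R\<^esub> b)"

definition directly_finite :: "('r, 'm) ring_scheme \<Rightarrow> bool" where
  "directly_finite R \<longleftrightarrow>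
     (\<forall>a\<in>carrier R. \<forall>b\<in>carrier R. circ R a b = \<zero>\<^bsub>R\<^esub> \<longrightarrow> circ R b a = \<zero>\<^bsub>R\<^esub>)"


section \<open>The affine group\<close>

text \<open>
  A topological group is given by a group whose elements live in a topological type; its topology
  is the subspace topology on the carrier. For \<open>affine_group\<close> this is the topology
  inherited from the space of all \<open>2 \<times> 2\<close> matrices.
\<close>

definition affine_group :: "('a::field ^ 2 ^ 2) monoid" where
  "affine_group =
     \<lparr>carrier = {A. A $ 1 $ 1 \<noteq> 0 \<and> A $ 2 $ 1 = 0 \<and> A $ 2 $ 2 = 1}, mult = (**), one = mat 1\<rparr>"

lemma group_affine_group: "group (affine_group :: ('a::field ^ 2 ^ 2) monoid)"
proof (rule groupI)
  fix x y :: "'a ^ 2 ^ 2"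
  assume "x \<in> carrier affine_group" "y \<in> carrier affine_group"
  then show "x \<otimes>\<^bsub>affine_group\<^esub> y \<in> carrier affine_group"
    by (simp add: affine_group_def matrix_matrix_mult_def sum_2)
next
  show "\<one>\<^bsub>affine_group\<^esub> \<in> carrier (affine_group :: ('a ^ 2 ^ 2) monoid)"
    by (simp add: affine_group_def mat_def)
next
  fix x y z :: "'a ^ 2 ^ 2"
  show "x \<otimes>\<^bsub>affine_group\<^esub> y \<otimes>\<^bsub>affine_group\<^esub> z =
        x \<otimes>\<^bsub>affine_group\<^esub> (y \<otimes>\<^bsub>affine_group\<^esub> z)"
    by (simp add: affine_group_def matrix_mul_assoc)
next
  fix x :: "'a ^ 2 ^ 2"
  show "\<one>\<^bsub>affine_group\<^esub> \<otimes>\<^bsub>affine_group\<^esub> x = x"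
    by (simp add: affine_group_def)
next
  fix x :: "'a ^ 2 ^ 2"
  assume x: "x \<in> carrier affine_group"
  define y :: "'a ^ 2 ^ 2" where
    "y = vector [vector [inverse (x $ 1 $ 1), - (inverse (x $ 1 $ 1) * x $ 1 $ 2)], vector [0, 1]]"
  have "y \<in> carrier affine_group" "y ** x = mat 1"
    using x by (simp_all add: y_def affine_group_def vec_eq_iff forall_2 matrix_matrix_mult_def
        sum_2 mat_def)
  then show "\<exists>y\<in>carrier affine_group. y \<otimes>\<^bsub>affine_group\<^esub> x = \<one>\<^bsub>affine_group\<^esub>"
    by (auto simp: affine_group_def)
qed


section \<open>Left Haar measures and convolution\<close>

text \<open>A left Haar measure is a nonzero left-invariant Radon measure on the Borel sets of the group.\<close>

definition left_haar_measure :: "('g::topological_space) monoid \<Rightarrow> 'g measure \<Rightarrow> bool" where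
  "left_haar_measure G \<mu> \<longleftrightarrow>
     space \<mu> = carrier G \<and>
     sets \<mu> = sets (restrict_space borel (carrier G)) \<and>
     emeasure \<mu> (carrier G) \<noteq> 0 \<and>
     (\<forall>K. compact K \<and> K \<subseteq> carrier G \<longrightarrow> emeasure \<mu> K < \<infinity>) \<and>
     (\<forall>A\<in>sets \<mu>. emeasure \<mu> A =
        (INF U\<in>{U. openin (top_of_set (carrier G)) U \<and> A \<subseteq> U}. emeasure \<mu> U)) \<and>
     (\<forall>U. openin (top_of_set (carrier G)) U \<longrightarrow>
        emeasure \<mu> U = (SUP K\<in>{K. compact K \<and> K \<subseteq> U}. emeasure \<mu> K)) \<and>
     (\<forall>g\<in>carrier G. \<forall>A\<in>sets \<mu>. emeasure \<mu> ((\<lambda>x. g \<otimes>\<^bsub>G\<^esub> x) ` A) = emeasure \<mu> A)"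

definition convolution ::
    "'g monoid \<Rightarrow> 'g measure \<Rightarrow> ('g \<Rightarrow> complex) \<Rightarrow> ('g \<Rightarrow> complex) \<Rightarrow> 'g \<Rightarrow> complex" where
  "convolution G \<mu> f h = (\<lambda>x. \<integral>y. f y * h (inv\<^bsub>G\<^esub> y \<otimes>\<^bsub>G\<^esub> x) \<partial>\<mu>)"

text \<open>Functions in \<open>C\<^sub>c(G)\<close> are extended by zero outside the carrier.\<close>

definition Cc :: "('g::topological_space) monoid \<Rightarrow> ('g \<Rightarrow> complex) set" where
  "Cc G = {f. continuous_on (carrier G) f \<and>
              (\<exists>K. compact K \<and> K \<subseteq> carrier G \<and> (\<forall>x. x \<notin> K \<longrightarrow> f x = 0))}"


section \<open>The spaces \<open>L\<^sup>p\<close>\<close>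

text \<open>
  Elements of \<open>L\<^sup>p\<close> are genuine classes of measurable functions modulo equality almost everywhere.
  Operations on classes are computed on a chosen representative; up to null sets the choice does
  not matter. Values of functions outside \<open>space M\<close> are irrelevant.
\<close>

definition ae_class :: "'x measure \<Rightarrow> ('x \<Rightarrow> complex) \<Rightarrow> ('x \<Rightarrow> complex) set" where
  "ae_class M f = {g \<in> borel_measurable M. AE x in M. g x = f x}"

definition rep :: "('x \<Rightarrow> complex) set \<Rightarrow> 'x \<Rightarrow> complex" where
  "rep F = (SOME f. f \<in> F)"

definition Lp :: "real \<Rightarrow> 'x measure \<Rightarrow> ('x \<Rightarrow> complex) set set" where
  "Lp p M = ae_class M ` {f \<in> borel_measurable M. integrable M (\<lambda>x. norm (f x) powr p)}"

definition Lp_norm :: "real \<Rightarrow> 'x measure \<Rightarrow> ('x \<Rightarrow> complex) set \<Rightarrow> real" where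
  "Lp_norm p M F = (\<integral>x. norm (rep F x) powr p \<partial>M) powr (1 / p)"

definition class_zero :: "'x measure \<Rightarrow> ('x \<Rightarrow> complex) set" where
  "class_zero M = ae_class M (\<lambda>x. 0)"

definition class_add ::
    "'x measure \<Rightarrow> ('x \<Rightarrow> complex) set \<Rightarrow> ('x \<Rightarrow> complex) set \<Rightarrow> ('x \<Rightarrow> complex) set" where
  "class_add M F H = ae_class M (\<lambda>x. rep F x + rep H x)"

definition class_diff ::
    "'x measure \<Rightarrow> ('x \<Rightarrow> complex) set \<Rightarrow> ('x \<Rightarrow> complex) set \<Rightarrow> ('x \<Rightarrow> complex) set" where
  "class_diff M F H = ae_class M (\<lambda>x. rep F x - rep H x)"

definition class_scale ::
    "'x measure \<Rightarrow> complex \<Rightarrow> ('x \<Rightarrow> complex) set \<Rightarrow> ('x \<Rightarrow> complex) set" where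
  "class_scale M c F = ae_class M (\<lambda>x. c * rep F x)"


section \<open>The convolution algebra \<open>L\<^sup>1(G)\<close>\<close>

definition L1_algebra :: "'g monoid \<Rightarrow> 'g measure \<Rightarrow> ('g \<Rightarrow> complex) set ring" where
  "L1_algebra G \<mu> =
     \<lparr>carrier = Lp 1 \<mu>,
      mult = (\<lambda>F H. ae_class \<mu> (convolution G \<mu> (rep F) (rep H))),
      one = undefined,
      zero = class_zero \<mu>,
      add = class_add \<mu>\<rparr>"


section \<open>Bounded operators on \<open>L\<^sup>p\<close> and \<open>p\<close>-pseudofunctions\<close>

type_synonym 'x class_op = "('x \<Rightarrow> complex) set \<Rightarrow> ('x \<Rightarrow> complex) set"

definition Lp_bounded_ops :: "real \<Rightarrow> 'x measure \<Rightarrow> 'x class_op set" where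
  "Lp_bounded_ops p M =
     {T \<in> Lp p M \<rightarrow>\<^sub>E Lp p M.
        (\<forall>F\<in>Lp p M. \<forall>H\<in>Lp p M. T (class_add M F H) = class_add M (T F) (T H)) \<and>
        (\<forall>c. \<forall>F\<in>Lp p M. T (class_scale M c F) = class_scale M c (T F)) \<and>
        (\<exists>C. \<forall>F\<in>Lp p M. Lp_norm p M (T F) \<le> C * Lp_norm p M F)}"

definition Lp_opnorm :: "real \<Rightarrow> 'x measure \<Rightarrow> 'x class_op \<Rightarrow> real" where
  "Lp_opnorm p M T = (SUP F\<in>{F \<in> Lp p M. Lp_norm p M F \<le> 1}. Lp_norm p M (T F))"

definition Lp_op_diff :: "real \<Rightarrow> 'x measure \<Rightarrow> 'x class_op \<Rightarrow> 'x class_op \<Rightarrow> 'x class_op" where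
  "Lp_op_diff p M S T = (\<lambda>F\<in>Lp p M. class_diff M (S F) (T F))"

definition conv_op :: "real \<Rightarrow> 'g monoid \<Rightarrow> 'g measure \<Rightarrow> ('g \<Rightarrow> complex) \<Rightarrow> 'g class_op" where
  "conv_op p G \<mu> f = (\<lambda>H\<in>Lp p \<mu>. ae_class \<mu> (convolution G \<mu> f (rep H)))"

text \<open>\<open>PF\<close> is the closure of \<open>conv_op p G \<mu> ` Cc G\<close> in the operator norm.\<close>

definition PF :: "real \<Rightarrow> ('g::topological_space) monoid \<Rightarrow> 'g measure \<Rightarrow> 'g class_op set" where
  "PF p G \<mu> =
     {T \<in> Lp_bounded_ops p \<mu>.
        \<forall>\<epsilon>>0. \<exists>f\<in>Cc G. Lp_opnorm p \<mu> (Lp_op_diff p \<mu> T (conv_op p G \<mu> f)) < \<epsilon>}"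

definition PF_algebra ::
    "real \<Rightarrow> ('g::topological_space) monoid \<Rightarrow> 'g measure \<Rightarrow> 'g class_op ring" where
  "PF_algebra p G \<mu> =
     \<lparr>carrier = PF p G \<mu>,
      mult = compose (Lp p \<mu>),
      one = undefined,
      zero = (\<lambda>F\<in>Lp p \<mu>. class_zero \<mu>),
      add = (\<lambda>S T. \<lambda>F\<in>Lp p \<mu>. class_add \<mu> (S F) (T F))\<rparr>"

end

theory Submission imports Defs
begin

text \<open>
  Consider functions on the group, with coordinates \<open>(b, a)\<close>, that depend only on \<open>\<bar>b\<bar>\<close> and \<open>\<bar>a\<bar>\<close>. A Fourier transform in \<open>b\<close>, with dual variable \<open>t\<close> and \<open>s = \<bar>t\<bar>\<^sup>2\<close>, turns their
  convolution operators into integral operators on \<open>(0, \<infinity>)\<close> with respect to \<open>ds / s\<close>. Let \<open>A\<close> have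
  the kernel \<open>(s / r)\<^bsup>1/2\<^esup> / (1 + s)\<close> for \<open>s < r\<close> and \<open>0\<close> otherwise, and let \<open>B\<close> be its transpose.
  An elementary integration gives \<open>B A = A + B\<close>, so that \<open>1 - A\<close> is an isometry, whereas \<open>A + B - A B\<close>
  is the projection to the line spanned by \<open>s\<^bsup>1/2\<^esup> / (1 + s)\<close>.

  Both kernels come from integrable functions \<open>f\<close> and \<open>h\<close> on the group. Since \<open>1 / (1 + \<bar>t\<bar>\<^sup>2)\<close> is an
  exponential mixture of the Gaussians \<open>exp (- v \<bar>t\<bar>\<^sup>2)\<close>, they are mixtures of Gaussian densities in
  \<open>b\<close>, and the identity \<open>h * f = f + h\<close> can be checked on the group, using only the semigroup
  property of Gaussians and their behaviour under dilations. Convolution operators of integrable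
  functions are \<open>p\<close>-pseudofunctions because \<open>C\<^sub>c\<close> is dense in \<open>L\<^sup>1\<close>; hence it remains to see that
  \<open>f + h - f * h\<close> does not annihilate some test function, which follows from the fact that the
  Gaussian densities decrease near the origin when the variance grows.
\<close>

section \<open>Classes of functions\<close>

text \<open>Up to a null set \<open>h\<close> is the involution of \<open>f\<close>, so on
  \<open>L^2\<close> the relation \<open>h * f = f + h\<close> says that \<open>1 - f\<close> acts
  isometrically. It is a relation in the convolution algebra, however, and therefore reaches every
  exponent p, where adjoints are not at hand.

  The Fourier transform only serves to find \<open>f\<close> and \<open>h\<close>. Both are
  nonnegative, and so is the test function; their products are computed in \<open>ennreal\<close>,
  where integrals may be exchanged freely.

  Two circumstances shape the rest. The Haar measure is arbitrary and known only through its axioms,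
  so before any computation it has to be identified with a multiple of an explicit integral. And the
  real and the complex case share one proof: the field is any normed field that is also a Euclidean
  space, of dimension d. Of its multiplication, mainly \<open>norm (x * y) = norm x * norm y\<close>
  enters the integrals, with a Jacobian given by a power of the norm, and since \<open>f\<close> and
  \<open>h\<close> depend on \<open>norm a\<close> and \<open>norm b\<close> alone, d appears in
  exponents and constants only.\<close>

definition in_Lp :: "real \<Rightarrow> 'x measure \<Rightarrow> ('x \<Rightarrow> complex) \<Rightarrow> bool" where
  "in_Lp p M f \<longleftrightarrow> f \<in> borel_measurable M \<and> integrable M (\<lambda>x. norm (f x) powr p)"

lemma rep_in_ae_class:
  assumes "f \<in> borel_measurable M"
  shows "rep (ae_class M f) \<in> borel_measurable M" "AE x in M. rep (ae_class M f) x = f x"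
proof -
  have "f \<in> ae_class M f" using assms by (simp add: ae_class_def)
  then have "rep (ae_class M f) \<in> ae_class M f" unfolding rep_def by (rule someI[where P = "\<lambda>g. g \<in> ae_class M f"])
  then show "rep (ae_class M f) \<in> borel_measurable M" "AE x in M. rep (ae_class M f) x = f x"
    by (auto simp: ae_class_def)
qed

lemma ae_class_cong:
  assumes "AE x in M. f x = g x"
  shows "ae_class M f = ae_class M g"
proof -
  have "(AE x in M. h x = f x) \<longleftrightarrow> (AE x in M. h x = g x)" for h
    using assms by (auto elim: AE_mp)
  then show ?thesis by (simp add: ae_class_def)
qed

lemma ae_class_eq_iff:
  assumes "f \<in> borel_measurable M"
  shows "ae_class M f = ae_class M g \<longleftrightarrow> (AE x in M. f x = g x)"
proof
  assume "ae_class M f = ae_class M g"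
  moreover have "f \<in> ae_class M f" using assms by (simp add: ae_class_def)
  ultimately show "AE x in M. f x = g x" by (auto simp: ae_class_def)
qed (rule ae_class_cong)

lemma in_Lp_cong:
  assumes "AE x in M. f x = g x" "f \<in> borel_measurable M" "in_Lp p M g"
  shows "in_Lp p M f"
proof -
  have [measurable]: "f \<in> borel_measurable M" by fact
  have ae: "AE x in M. norm (g x) powr p = norm (f x) powr p" using assms(1) by eventually_elim simp
  have int: "integrable M (\<lambda>x. norm (g x) powr p)" using assms(3) by (simp add: in_Lp_def)
  have "(\<lambda>x. norm (f x) powr p) \<in> borel_measurable M" by measurable
  from integrable_cong_AE_imp[OF int this ae] show ?thesis by (simp add: in_Lp_def)
qed

text \<open>The bridge to functions: a class \<open>F\<close> is rewritten as
  \<open>ae_class M (rep F)\<close>, after which only lemmas about honest functions are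
  applied.\<close>

lemma in_Lp_rep:
  assumes "F \<in> Lp p M"
  shows "in_Lp p M (rep F)" "ae_class M (rep F) = F"
proof -
  obtain f where f: "in_Lp p M f" "F = ae_class M f"
    using assms by (auto simp: Lp_def in_Lp_def)
  then have m: "f \<in> borel_measurable M" by (simp add: in_Lp_def)
  show "in_Lp p M (rep F)" using in_Lp_cong[OF _ _ f(1)] rep_in_ae_class[OF m] f(2) by auto
  show "ae_class M (rep F) = F" using rep_in_ae_class[OF m] f(2) by (simp add: ae_class_cong)
qed

lemma ae_class_in_Lp: "in_Lp p M f \<Longrightarrow> ae_class M f \<in> Lp p M"
  by (auto simp: Lp_def in_Lp_def)

lemma class_add_ae_class:
  assumes "f \<in> borel_measurable M" "g \<in> borel_measurable M"
  shows "class_add M (ae_class M f) (ae_class M g) = ae_class M (\<lambda>x. f x + g x)"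
  unfolding class_add_def
  by (rule ae_class_cong, use rep_in_ae_class(2)[OF assms(1)] rep_in_ae_class(2)[OF assms(2)] in eventually_elim) simp

lemma class_diff_ae_class:
  assumes "f \<in> borel_measurable M" "g \<in> borel_measurable M"
  shows "class_diff M (ae_class M f) (ae_class M g) = ae_class M (\<lambda>x. f x - g x)"
  unfolding class_diff_def
  by (rule ae_class_cong, use rep_in_ae_class(2)[OF assms(1)] rep_in_ae_class(2)[OF assms(2)] in eventually_elim) simp

lemma class_scale_ae_class:
  assumes "f \<in> borel_measurable M"
  shows "class_scale M c (ae_class M f) = ae_class M (\<lambda>x. c * f x)"
  unfolding class_scale_def
  by (rule ae_class_cong, use rep_in_ae_class(2)[OF assms(1)] in eventually_elim) simp

lemma Lp_norm_ae_class:
  assumes "in_Lp p M f"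
  shows "Lp_norm p M (ae_class M f) = (\<integral>x. norm (f x) powr p \<partial>M) powr (1 / p)"
proof -
  have m: "f \<in> borel_measurable M" using assms by (simp add: in_Lp_def)
  have "(\<integral>x. norm (rep (ae_class M f) x) powr p \<partial>M) = (\<integral>x. norm (f x) powr p \<partial>M)"
    by (rule integral_cong_AE)
      (use rep_in_ae_class[OF m] m in \<open>auto elim: eventually_mono\<close>)
  then show ?thesis by (simp add: Lp_norm_def)
qed

lemma in_Lp_add:
  assumes "in_Lp p M f" "in_Lp p M g" "0 \<le> p"
  shows "in_Lp p M (\<lambda>x. f x + g x)"
proof -
  have [measurable]: "f \<in> borel_measurable M" "g \<in> borel_measurable M"
    using assms by (auto simp: in_Lp_def)
  have "integrable M (\<lambda>x. norm (f x + g x) powr p)"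
  proof (rule Bochner_Integration.integrable_bound)
    show "integrable M (\<lambda>x. 2 powr p * (norm (f x) powr p + norm (g x) powr p))"
      using assms by (auto simp: in_Lp_def)
    show "AE x in M. norm (norm (f x + g x) powr p) \<le> norm (2 powr p * (norm (f x) powr p + norm (g x) powr p))"
    proof (rule AE_I2)
      fix x
      let ?m = "max (norm (f x)) (norm (g x))"
      have "norm (f x + g x) powr p \<le> (2 * ?m) powr p"
        using norm_triangle_ineq[of "f x" "g x"] assms(3) by (intro powr_mono2) auto
      also have "\<dots> = 2 powr p * ?m powr p" by (simp add: powr_mult)
      also have "?m powr p \<le> norm (f x) powr p + norm (g x) powr p"
        by (simp add: max_def)
      finally show "norm (norm (f x + g x) powr p) \<le> norm (2 powr p * (norm (f x) powr p + norm (g x) powr p))"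
        by (simp add: mult_left_mono)
    qed
  qed measurable
  then show ?thesis by (simp add: in_Lp_def)
qed

lemma in_Lp_scale: "in_Lp p M f \<Longrightarrow> in_Lp p M (\<lambda>x. c * f x)"
  by (auto simp: in_Lp_def norm_mult powr_mult)

lemma in_Lp_1_iff: "in_Lp 1 M f \<longleftrightarrow> integrable M f"
  by (auto simp: in_Lp_def integrable_norm_iff)

text \<open>Jensen's inequality for the convex function \<open>t powr p\<close> and the weight
  \<open>w\<close>, scaled so that the total mass of \<open>w\<close> is arbitrary. In Young's
  inequality \<open>w\<close> will be the norm of \<open>f\<close>.\<close>

lemma weighted_power_mean:
  fixes w X :: "'x \<Rightarrow> real"
  assumes [measurable]: "w \<in> borel_measurable M" "X \<in> borel_measurable M"
    and nonneg: "\<And>x. 0 \<le> w x" "\<And>x. 0 \<le> X x" and p: "1 \<le> p"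
    and w: "integrable M w" and wX: "integrable M (\<lambda>x. w x * X x powr p)"
  shows "integrable M (\<lambda>x. w x * X x)"
    and "(\<integral>x. w x * X x \<partial>M) powr p \<le> (\<integral>x. w x \<partial>M) powr (p - 1) * (\<integral>x. w x * X x powr p \<partial>M)"
proof -
  \<comment> \<open>Bounds \<open>w x * X x\<close> by the sum of the two functions assumed
    integrable.\<close>
  have le: "X x \<le> 1 + X x powr p" for x
  proof (cases "X x \<le> 1")
    case False
    then have "X x powr 1 \<le> X x powr p" using p by (intro powr_mono) auto
    then show ?thesis using False by simp
  next
    case True
    have "0 \<le> X x powr p" by simp
    with True show ?thesis by linarith
  qed
  show int: "integrable M (\<lambda>x. w x * X x)"
  proof (rule Bochner_Integration.integrable_bound)
    show "integrable M (\<lambda>x. w x + w x * X x powr p)" using w wX by simp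
    show "AE x in M. norm (w x * X x) \<le> norm (w x + w x * X x powr p)"
      using mult_left_mono[OF le nonneg(1)] nonneg by (auto simp: algebra_simps)
  qed measurable
  define N where "N = (\<integral>x. w x \<partial>M)"
  define m where "m = (\<integral>x. w x * X x \<partial>M) / N"
  have N0: "0 \<le> N" unfolding N_def by (rule integral_nonneg_AE) (simp add: nonneg)
  have R0: "0 \<le> (\<integral>x. w x * X x powr p \<partial>M)" by (rule integral_nonneg_AE) (simp add: nonneg)
  have m0: "0 \<le> m" unfolding m_def using N0 by (intro divide_nonneg_nonneg integral_nonneg_AE) (simp_all add: nonneg)
  show "(\<integral>x. w x * X x \<partial>M) powr p \<le> N powr (p - 1) * (\<integral>x. w x * X x powr p \<partial>M)"
  proof (cases "N = 0 \<or> m = 0")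
    case True
    have "(\<integral>x. w x * X x \<partial>M) = 0"
    proof (cases "N = 0")
      case True
      then have "AE x in M. w x = 0"
        using integral_nonneg_eq_0_iff_AE[OF w] nonneg by (auto simp: N_def)
      then show ?thesis by (intro integral_eq_zero_AE) auto
    next
      case False
      with \<open>N = 0 \<or> m = 0\<close> show ?thesis by (simp add: m_def)
    qed
    then show ?thesis using R0 by simp
  next
    case False
    then have N: "0 < N" and m: "0 < m" using N0 m0 by auto
    \<comment> \<open>The tangent to \<open>t powr p\<close> at the weighted mean \<open>m\<close>.
      Its linear term cancels on integration against \<open>w\<close>. The value 0 is checked by
      hand, the tangent theorem being applied to positive arguments.\<close>
    have tangent: "m powr p + p * m powr (p - 1) * (X x - m) \<le> X x powr p" for x
    proof (cases "X x = 0")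
      case True
      have "m powr p = m powr (p - 1) * m" using m by (simp add: powr_diff)
      then show ?thesis using True p m by (simp add: algebra_simps mult_le_cancel_left1)
    next
      case False
      then have "0 < X x" using nonneg(2)[of x] by simp
      have "p * m powr (p - 1) * (X x - m) \<le> X x powr p - m powr p"
        using m \<open>0 < X x\<close> p
        by (intro convex_on_imp_above_tangent[OF powr_convex[OF p]])
          (auto intro!: derivative_eq_intros simp: interior_open)
      then show ?thesis by simp
    qed
    have "(\<integral>x. (m powr p - p * m powr (p - 1) * m) * w x + p * m powr (p - 1) * (w x * X x) \<partial>M)
        \<le> (\<integral>x. w x * X x powr p \<partial>M)"
    proof (rule integral_mono)
      show "(m powr p - p * m powr (p - 1) * m) * w x + p * m powr (p - 1) * (w x * X x) \<le> w x * X x powr p" for x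
        using mult_left_mono[OF tangent[of x] nonneg(1)[of x]] by (simp add: algebra_simps)
    qed (use w int wX in auto)
    moreover have "(\<integral>x. (m powr p - p * m powr (p - 1) * m) * w x + p * m powr (p - 1) * (w x * X x) \<partial>M)
        = (m powr p - p * m powr (p - 1) * m) * N + p * m powr (p - 1) * (\<integral>x. w x * X x \<partial>M)"
      using w int by (simp add: N_def)
    moreover have mN: "(\<integral>x. w x * X x \<partial>M) = m * N" using N by (simp add: m_def)
    ultimately have "N * m powr p \<le> (\<integral>x. w x * X x powr p \<partial>M)" by (simp add: algebra_simps)
    then have "N powr (p - 1) * (N * m powr p) \<le> N powr (p - 1) * (\<integral>x. w x * X x powr p \<partial>M)"
      by (rule mult_left_mono) simp
    moreover have "N powr (p - 1) * (N * m powr p) = (m * N) powr p"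
      using N m by (simp add: powr_mult powr_diff)
    ultimately show ?thesis using mN by simp
  qed
qed

section \<open>Convolution operators\<close>

text \<open>What Fubini and left translation demand of a Haar measure, free of topology. The
  topology of the group enters only later, through density of \<open>Cc\<close>.\<close>

locale left_invariant_measure = group G + sigma_finite_measure \<mu>
  for G :: "'g monoid" (structure) and \<mu> :: "'g measure" +
  assumes space_eq: "space \<mu> = carrier G"
    and mult_measurable: "(\<lambda>z. fst z \<otimes> snd z) \<in> \<mu> \<Otimes>\<^sub>M \<mu> \<rightarrow>\<^sub>M \<mu>"
    and inv_measurable [measurable]: "(\<lambda>x. inv x) \<in> \<mu> \<rightarrow>\<^sub>M \<mu>"
    and left_inv: "g \<in> carrier G \<Longrightarrow> A \<in> sets \<mu> \<Longrightarrow> emeasure \<mu> ((\<lambda>x. g \<otimes> x) ` A) = emeasure \<mu> A"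
begin

sublocale pair: pair_sigma_finite \<mu> \<mu> ..

lemma mult_measurable' [measurable (raw)]:
  assumes "f \<in> N \<rightarrow>\<^sub>M \<mu>" "g \<in> N \<rightarrow>\<^sub>M \<mu>"
  shows "(\<lambda>x. f x \<otimes> g x) \<in> N \<rightarrow>\<^sub>M \<mu>"
  using measurable_compose[OF measurable_Pair[OF assms] mult_measurable] by simp

lemma inv_measurable' [measurable (raw)]:
  assumes "f \<in> N \<rightarrow>\<^sub>M \<mu>"
  shows "(\<lambda>x. inv (f x)) \<in> N \<rightarrow>\<^sub>M \<mu>"
  using measurable_compose[OF assms inv_measurable] by simp

lemma measurable_const_carrier: "g \<in> carrier G \<Longrightarrow> (\<lambda>x. g) \<in> N \<rightarrow>\<^sub>M \<mu>"
  by (simp add: space_eq)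

text \<open>Invariance is assumed for images of sets. The preimage of a set under \<open>g\<close>
  is its image under \<open>inv g\<close>, which gives invariance of the push-forward and so of
  integrals.\<close>

lemma distr_left_mult:
  assumes g: "g \<in> carrier G"
  shows "distr \<mu> \<mu> (\<lambda>x. g \<otimes> x) = \<mu>"
proof (rule measure_eqI)
  note [measurable] = measurable_const_carrier[OF g]
  fix A assume "A \<in> sets (distr \<mu> \<mu> (\<lambda>x. g \<otimes> x))"
  then have A [measurable]: "A \<in> sets \<mu>" by simp
  have sub: "A \<subseteq> carrier G" using sets.sets_into_space[OF A] by (simp add: space_eq)
  have "(\<lambda>x. g \<otimes> x) -` A \<inter> space \<mu> = (\<lambda>x. inv g \<otimes> x) ` A"
  proof (intro equalityI subsetI)
    fix x assume "x \<in> (\<lambda>x. g \<otimes> x) -` A \<inter> space \<mu>"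
    then have "g \<otimes> x \<in> A" "x = inv g \<otimes> (g \<otimes> x)" using g by (auto simp: space_eq m_assoc[symmetric])
    then show "x \<in> (\<lambda>x. inv g \<otimes> x) ` A" by blast
  next
    fix x assume "x \<in> (\<lambda>x. inv g \<otimes> x) ` A"
    then obtain a where "a \<in> A" "x = inv g \<otimes> a" by blast
    then show "x \<in> (\<lambda>x. g \<otimes> x) -` A \<inter> space \<mu>"
      using g sub by (auto simp: space_eq m_assoc[symmetric])
  qed
  then show "emeasure (distr \<mu> \<mu> (\<lambda>x. g \<otimes> x)) A = emeasure \<mu> A"
    using g A by (simp add: emeasure_distr left_inv)
qed simp

lemma nn_integral_left_mult:
  assumes [measurable]: "F \<in> borel_measurable \<mu>" and g: "g \<in> carrier G"
  shows "(\<integral>\<^sup>+x. F (g \<otimes> x) \<partial>\<mu>) = (\<integral>\<^sup>+x. F x \<partial>\<mu>)"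
proof -
  note [measurable] = measurable_const_carrier[OF g]
  have "(\<integral>\<^sup>+x. F x \<partial>distr \<mu> \<mu> (\<lambda>x. g \<otimes> x)) = (\<integral>\<^sup>+x. F (g \<otimes> x) \<partial>\<mu>)"
    by (rule nn_integral_distr) measurable
  then show ?thesis by (simp add: distr_left_mult[OF g])
qed

lemma integral_left_mult:
  fixes F :: "'g \<Rightarrow> complex"
  assumes [measurable]: "F \<in> borel_measurable \<mu>" and g: "g \<in> carrier G"
  shows "(\<integral>x. F (g \<otimes> x) \<partial>\<mu>) = (\<integral>x. F x \<partial>\<mu>)"
proof -
  note [measurable] = measurable_const_carrier[OF g]
  have "(\<integral>x. F x \<partial>distr \<mu> \<mu> (\<lambda>x. g \<otimes> x)) = (\<integral>x. F (g \<otimes> x) \<partial>\<mu>)"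
    by (rule integral_distr) measurable
  then show ?thesis by (simp add: distr_left_mult[OF g])
qed

lemma convolution_measurable [measurable]:
  assumes [measurable]: "f \<in> borel_measurable \<mu>" "H \<in> borel_measurable \<mu>"
  shows "convolution G \<mu> f H \<in> borel_measurable \<mu>"
  unfolding convolution_def by measurable

text \<open>Young's inequality for \<open>L^1\<close> acting on \<open>L^p\<close>, in p-th powers.
  For fixed \<open>x\<close> the power mean inequality in \<open>y\<close> with weight
  \<open>norm (f y)\<close> bounds the convolution by \<open>A x\<close>; exchanging integrals and
  left invariance in \<open>x\<close> evaluate the integral of \<open>A\<close>. Its finiteness also
  makes the convolution integral converge for almost every \<open>x\<close>.\<close>

lemma young:
  assumes f: "integrable \<mu> f" and H: "in_Lp p \<mu> H" and p: "1 \<le> p"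
  shows young_integrable: "AE x in \<mu>. integrable \<mu> (\<lambda>y. f y * H (inv y \<otimes> x))"
    and young_in_Lp: "in_Lp p \<mu> (convolution G \<mu> f H)"
    and young_ineq: "(\<integral>x. norm (convolution G \<mu> f H x) powr p \<partial>\<mu>)
        \<le> (\<integral>x. norm (f x) \<partial>\<mu>) powr p * (\<integral>x. norm (H x) powr p \<partial>\<mu>)"
proof -
  let ?e = "\<lambda>x y. norm (f y) * norm (H (inv y \<otimes> x)) powr p"
  let ?c = "convolution G \<mu> f H"
  have fm [measurable]: "f \<in> borel_measurable \<mu>" and [measurable]: "H \<in> borel_measurable \<mu>"
    using f H by (auto simp: in_Lp_def)
  define N where "N = (\<integral>x. norm (f x) \<partial>\<mu>)"
  define S where "S = (\<integral>x. norm (H x) powr p \<partial>\<mu>)"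
  define A where "A x = (\<integral>\<^sup>+y. ennreal (?e x y) \<partial>\<mu>)" for x
  have [measurable]: "A \<in> borel_measurable \<mu>" unfolding A_def by measurable
  have N0: "0 \<le> N" and S0: "0 \<le> S" by (simp_all add: N_def S_def)
  have Nn: "(\<integral>\<^sup>+x. ennreal (norm (f x)) \<partial>\<mu>) = ennreal N"
    unfolding N_def using f by (intro nn_integral_eq_integral) auto
  have Sn: "(\<integral>\<^sup>+x. ennreal (norm (H x) powr p) \<partial>\<mu>) = ennreal S"
    unfolding S_def using H by (intro nn_integral_eq_integral) (auto simp: in_Lp_def)
  have "(\<integral>\<^sup>+x. A x \<partial>\<mu>) = (\<integral>\<^sup>+y. (\<integral>\<^sup>+x. ennreal (?e x y) \<partial>\<mu>) \<partial>\<mu>)"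
    unfolding A_def by (rule pair.Fubini'[symmetric]) measurable
  also have "\<dots> = (\<integral>\<^sup>+y. ennreal (norm (f y)) * ennreal S \<partial>\<mu>)"
  proof (rule nn_integral_cong, goal_cases)
    case (1 y)
    then have y: "inv y \<in> carrier G" by (simp add: space_eq)
    note [measurable] = measurable_const_carrier[OF y]
    have "(\<integral>\<^sup>+x. ennreal (?e x y) \<partial>\<mu>)
        = ennreal (norm (f y)) * (\<integral>\<^sup>+x. ennreal (norm (H (inv y \<otimes> x)) powr p) \<partial>\<mu>)"
      by (simp add: ennreal_mult nn_integral_cmult)
    also have "(\<integral>\<^sup>+x. ennreal (norm (H (inv y \<otimes> x)) powr p) \<partial>\<mu>) = ennreal S"
      using nn_integral_left_mult[OF _ y, of "\<lambda>x. ennreal (norm (H x) powr p)"] by (simp add: Sn)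
    finally show ?case .
  qed
  also have "\<dots> = ennreal (N * S)"
    using N0 S0 by (simp add: nn_integral_multc Nn ennreal_mult)
  finally have intA: "(\<integral>\<^sup>+x. A x \<partial>\<mu>) = ennreal (N * S)" .
  then have "AE x in \<mu>. A x \<noteq> \<infinity>" by (intro nn_integral_PInf_AE) auto
  then have finA: "AE x in \<mu>. x \<in> carrier G \<and> A x < \<infinity>"
    using AE_space[of \<mu>] by eventually_elim (simp add: space_eq top.not_eq_extremum)
  have point: "integrable \<mu> (\<lambda>y. f y * H (inv y \<otimes> x))"
    "ennreal (norm (?c x) powr p) \<le> ennreal (N powr (p - 1)) * A x"
    if x: "x \<in> carrier G" and fin: "A x < \<infinity>" for x
  proof -
    note [measurable] = measurable_const_carrier[OF x]
    have int: "integrable \<mu> (\<lambda>y. ?e x y)"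
      using fin by (intro integrableI_nonneg) (auto simp: A_def)
    have m: "(\<lambda>y. norm (f y)) \<in> borel_measurable \<mu>" "(\<lambda>y. norm (H (inv y \<otimes> x))) \<in> borel_measurable \<mu>"
      by measurable
    note mean = weighted_power_mean[OF m norm_ge_zero norm_ge_zero p integrable_norm[OF f] int]
    from mean(1) have "integrable \<mu> (\<lambda>y. norm (f y * H (inv y \<otimes> x)))" by (simp add: norm_mult)
    then show "integrable \<mu> (\<lambda>y. f y * H (inv y \<otimes> x))"
      by (rule integrable_norm_cancel) measurable
    have "norm (?c x) \<le> (\<integral>y. norm (f y) * norm (H (inv y \<otimes> x)) \<partial>\<mu>)"
      using integral_norm_bound[of \<mu> "\<lambda>y. f y * H (inv y \<otimes> x)"] by (simp add: convolution_def norm_mult)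
    then have "norm (?c x) powr p \<le> (\<integral>y. norm (f y) * norm (H (inv y \<otimes> x)) \<partial>\<mu>) powr p"
      using p by (intro powr_mono2) simp_all
    then have "norm (?c x) powr p
        \<le> N powr (p - 1) * (\<integral>y. ?e x y \<partial>\<mu>)"
      using mean(2) unfolding N_def by (rule order_trans)
    then have "ennreal (norm (?c x) powr p)
      \<le> ennreal (N powr (p - 1) * (\<integral>y. ?e x y \<partial>\<mu>))"
      by (rule ennreal_leI)
    also have "\<dots> = ennreal (N powr (p - 1)) * A x"
      unfolding A_def by (subst nn_integral_eq_integral[OF int]) (simp_all add: ennreal_mult)
    finally show "ennreal (norm (?c x) powr p) \<le> ennreal (N powr (p - 1)) * A x" .
  qed
  show "AE x in \<mu>. integrable \<mu> (\<lambda>y. f y * H (inv y \<otimes> x))"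
    using finA by eventually_elim (use point in auto)
  have "(\<integral>\<^sup>+x. ennreal (norm (?c x) powr p) \<partial>\<mu>) \<le> (\<integral>\<^sup>+x. ennreal (N powr (p - 1)) * A x \<partial>\<mu>)"
    by (rule nn_integral_mono_AE, use finA in eventually_elim) (use point in auto)
  also have "\<dots> = ennreal (N powr (p - 1) * (N * S))"
    using N0 S0 by (simp add: nn_integral_cmult intA ennreal_mult)
  also have "\<dots> = ennreal (N powr p * S)"
    using N0 by (cases "N = 0") (simp_all add: powr_diff)
  finally have le: "(\<integral>\<^sup>+x. ennreal (norm (?c x) powr p) \<partial>\<mu>) \<le> ennreal (N powr p * S)" .
  have int: "integrable \<mu> (\<lambda>x. norm (?c x) powr p)"
  proof (rule integrableI_nonneg)
    show "(\<lambda>x. norm (?c x) powr p) \<in> borel_measurable \<mu>" by simp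
  qed (use le_less_trans[OF le ennreal_less_top] in simp_all)
  then show "in_Lp p \<mu> ?c" by (simp add: in_Lp_def)
  have "ennreal (\<integral>x. norm (?c x) powr p \<partial>\<mu>) \<le> ennreal (N powr p * S)"
    using le by (subst nn_integral_eq_integral[OF int, symmetric]) simp_all
  then show "(\<integral>x. norm (?c x) powr p \<partial>\<mu>)
        \<le> (\<integral>x. norm (f x) \<partial>\<mu>) powr p * (\<integral>x. norm (H x) powr p \<partial>\<mu>)"
    using S0 by (simp add: N_def S_def ennreal_le_iff)
qed

lemma convolution_cong_left:
  assumes "AE x in \<mu>. f x = f' x" and [measurable]: "f \<in> borel_measurable \<mu>" "f' \<in> borel_measurable \<mu>"
    "H \<in> borel_measurable \<mu>" and x: "x \<in> carrier G"
  shows "convolution G \<mu> f H x = convolution G \<mu> f' H x"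
proof -
  note [measurable] = measurable_const_carrier[OF x]
  show ?thesis unfolding convolution_def
  proof (rule integral_cong_AE)
    show "AE y in \<mu>. f y * H (inv y \<otimes> x) = f' y * H (inv y \<otimes> x)"
      using assms(1) by eventually_elim simp
  qed measurable
qed

lemma convolution_add_left:
  assumes "integrable \<mu> f" "integrable \<mu> g" "in_Lp p \<mu> H" "1 \<le> p"
  shows "AE x in \<mu>. convolution G \<mu> (\<lambda>y. f y + g y) H x = convolution G \<mu> f H x + convolution G \<mu> g H x"
  using young_integrable[OF assms(1,3,4)] young_integrable[OF assms(2,3,4)]
  by eventually_elim (simp add: convolution_def algebra_simps)

lemma convolution_diff_left:
  assumes "integrable \<mu> f" "integrable \<mu> g" "in_Lp p \<mu> H" "1 \<le> p"
  shows "AE x in \<mu>. convolution G \<mu> (\<lambda>y. f y - g y) H x = convolution G \<mu> f H x - convolution G \<mu> g H x"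
  using young_integrable[OF assms(1,3,4)] young_integrable[OF assms(2,3,4)]
  by eventually_elim (simp add: convolution_def algebra_simps)

lemma convolution_add_right:
  assumes "integrable \<mu> f" "in_Lp p \<mu> H" "in_Lp p \<mu> K" "1 \<le> p"
  shows "AE x in \<mu>. convolution G \<mu> f (\<lambda>y. H y + K y) x = convolution G \<mu> f H x + convolution G \<mu> f K x"
  using young_integrable[OF assms(1,2,4)] young_integrable[OF assms(1,3,4)]
  by eventually_elim (simp add: convolution_def algebra_simps)

lemma convolution_scale_right:
  "convolution G \<mu> f (\<lambda>y. c * H y) = (\<lambda>x. c * convolution G \<mu> f H x)"
proof
  fix x
  have "convolution G \<mu> f (\<lambda>y. c * H y) x = (\<integral>y. c * (f y * H (inv y \<otimes> x)) \<partial>\<mu>)"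
    unfolding convolution_def by (rule Bochner_Integration.integral_cong) simp_all
  then show "convolution G \<mu> f (\<lambda>y. c * H y) x = c * convolution G \<mu> f H x" by (simp add: convolution_def)
qed

text \<open>For fixed \<open>x\<close>, altering \<open>H\<close> on a null set alters the integrand
  on an inverted and translated set, about which left invariance says nothing directly. Instead
  Young's inequality is applied to the difference \<open>D\<close>, whose p-norm is 0.\<close>

lemma convolution_cong_right:
  assumes f: "integrable \<mu> f" and H: "in_Lp p \<mu> H" and ae: "AE x in \<mu>. K x = H x"
    and K: "K \<in> borel_measurable \<mu>" and p: "1 \<le> p"
  shows "AE x in \<mu>. convolution G \<mu> f K x = convolution G \<mu> f H x"
proof -
  have [measurable]: "H \<in> borel_measurable \<mu>" "K \<in> borel_measurable \<mu>" "f \<in> borel_measurable \<mu>"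
    using H K f by (auto simp: in_Lp_def)
  define D where "D x = K x - H x" for x
  have [measurable]: "D \<in> borel_measurable \<mu>" unfolding D_def by measurable
  have "AE x in \<mu>. D x = 0" using ae by eventually_elim (simp add: D_def)
  then have int0: "(\<integral>x. norm (D x) powr p \<partial>\<mu>) = 0" by (intro integral_eq_zero_AE) auto
  have "in_Lp p \<mu> (\<lambda>x. 0)" by (simp add: in_Lp_def)
  then have DL: "in_Lp p \<mu> D"
    by (rule in_Lp_cong[rotated 2]) (use \<open>AE x in \<mu>. D x = 0\<close> in simp_all)
  have "AE x in \<mu>. norm (convolution G \<mu> f D x) powr p = 0"
    using young_ineq[OF f DL p] young_in_Lp[OF f DL p] int0
    by (subst integral_nonneg_eq_0_iff_AE[symmetric]) (auto simp: in_Lp_def intro!: antisym)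
  with convolution_add_right[OF f H DL p] show ?thesis
    by eventually_elim (simp add: D_def)
qed

text \<open>The substitution \<open>z \<mapsto> y \<otimes> z\<close> followed by Fubini. Absolute
  convergence for almost every \<open>x\<close> comes from \<open>B\<close>: two left translations
  show that its integral is the product of the integrals of \<open>norm f\<close>,
  \<open>norm h\<close> and \<open>norm H powr p\<close>, and \<open>t \<le> 1 + t powr p\<close>
  passes from the p-th power of \<open>H\<close> to \<open>H\<close> itself.\<close>

lemma convolution_assoc:
  assumes f: "integrable \<mu> f" and h: "integrable \<mu> h" and H: "in_Lp p \<mu> H" and p: "1 \<le> p"
  shows "AE x in \<mu>. convolution G \<mu> (convolution G \<mu> f h) H x = convolution G \<mu> f (convolution G \<mu> h H) x"
proof -
  let ?e = "\<lambda>x y z. norm (f y) * norm (h z) * norm (H (inv z \<otimes> (inv y \<otimes> x))) powr p"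
  have fm [measurable]: "f \<in> borel_measurable \<mu>" and hm [measurable]: "h \<in> borel_measurable \<mu>"
    and Hm [measurable]: "H \<in> borel_measurable \<mu>"
    using f h H by (auto simp: in_Lp_def)
  define B where "B x = (\<integral>\<^sup>+y. (\<integral>\<^sup>+z. ennreal (?e x y z) \<partial>\<mu>) \<partial>\<mu>)" for x
  have Bm [measurable]: "B \<in> borel_measurable \<mu>" unfolding B_def by measurable
  define Nf where "Nf = (\<integral>\<^sup>+y. ennreal (norm (f y)) \<partial>\<mu>)"
  define Nh where "Nh = (\<integral>\<^sup>+y. ennreal (norm (h y)) \<partial>\<mu>)"
  define S where "S = (\<integral>\<^sup>+x. ennreal (norm (H x) powr p) \<partial>\<mu>)"
  have fin: "Nf < \<infinity>" "Nh < \<infinity>" "S < \<infinity>"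
    using f h H by (auto simp: Nf_def Nh_def S_def in_Lp_def integrable_iff_bounded)
  have "(\<integral>\<^sup>+x. B x \<partial>\<mu>) = (\<integral>\<^sup>+y. (\<integral>\<^sup>+x. (\<integral>\<^sup>+z. ennreal (?e x y z) \<partial>\<mu>) \<partial>\<mu>) \<partial>\<mu>)"
    unfolding B_def by (rule pair.Fubini'[symmetric]) measurable
  also have "\<dots> = (\<integral>\<^sup>+y. ennreal (norm (f y)) * (Nh * S) \<partial>\<mu>)"
  proof (rule nn_integral_cong, goal_cases)
    case (1 y)
    then have y: "inv y \<in> carrier G" by (simp add: space_eq)
    note [measurable] = measurable_const_carrier[OF y]
    have "(\<integral>\<^sup>+x. (\<integral>\<^sup>+z. ennreal (?e x y z) \<partial>\<mu>) \<partial>\<mu>)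
      = (\<integral>\<^sup>+z. (\<integral>\<^sup>+x. ennreal (?e x y z) \<partial>\<mu>) \<partial>\<mu>)"
      by (rule pair.Fubini'[symmetric]) measurable
    also have "\<dots> = (\<integral>\<^sup>+z. ennreal (norm (f y)) * (ennreal (norm (h z)) * S) \<partial>\<mu>)"
    proof (rule nn_integral_cong, goal_cases)
      case (1 z)
      then have z: "inv z \<in> carrier G" by (simp add: space_eq)
      note [measurable] = measurable_const_carrier[OF z]
      have "(\<integral>\<^sup>+x. ennreal (?e x y z) \<partial>\<mu>)
        = (\<integral>\<^sup>+x. ennreal (norm (f y) * norm (h z)) * ennreal (norm (H (inv z \<otimes> (inv y \<otimes> x))) powr p) \<partial>\<mu>)"
        by (simp add: ennreal_mult)
      also have "\<dots> = ennreal (norm (f y) * norm (h z)) * (\<integral>\<^sup>+x. ennreal (norm (H (inv z \<otimes> (inv y \<otimes> x))) powr p) \<partial>\<mu>)"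
        by (rule nn_integral_cmult) measurable
      also have "(\<integral>\<^sup>+x. ennreal (norm (H (inv z \<otimes> (inv y \<otimes> x))) powr p) \<partial>\<mu>) = (\<integral>\<^sup>+x. ennreal (norm (H (inv z \<otimes> x)) powr p) \<partial>\<mu>)"
        by (rule nn_integral_left_mult[OF _ y, of "\<lambda>x. ennreal (norm (H (inv z \<otimes> x)) powr p)"]) measurable
      also have "\<dots> = S"
        unfolding S_def by (rule nn_integral_left_mult[OF _ z, of "\<lambda>x. ennreal (norm (H x) powr p)"]) measurable
      finally show ?case by (simp add: ennreal_mult mult.assoc)
    qed
    also have "\<dots> = ennreal (norm (f y)) * (Nh * S)"
      unfolding Nh_def by (subst nn_integral_cmult, measurable, subst nn_integral_multc, measurable)
    finally show ?case .
  qed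
  also have "\<dots> = Nf * (Nh * S)" unfolding Nf_def by (rule nn_integral_multc) measurable
  also have "\<dots> < \<infinity>" using fin by (simp add: ennreal_mult_less_top)
  finally have "AE x in \<mu>. B x \<noteq> \<infinity>" by (intro nn_integral_PInf_AE) simp_all
  then show ?thesis using AE_space
  proof eventually_elim
    fix x assume Bx: "B x \<noteq> \<infinity>" and "x \<in> space \<mu>"
    then have x: "x \<in> carrier G" by (simp add: space_eq)
    note [measurable] = measurable_const_carrier[OF x]
    \<comment> \<open>The integrand of the left-hand side with \<open>y\<close> and \<open>z\<close>
      in swapped order of integration; shifting \<open>z\<close> by \<open>y\<close> turns it into
      that of the right-hand side.\<close>
    define J where "J y z = f y * h (inv y \<otimes> z) * H (inv z \<otimes> x)" for y z
    have Jm [measurable]: "case_prod J \<in> borel_measurable (\<mu> \<Otimes>\<^sub>M \<mu>)" unfolding J_def by measurable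
    have subst: "J y (y \<otimes> z) = f y * (h z * H (inv z \<otimes> (inv y \<otimes> x)))"
      if "y \<in> carrier G" "z \<in> carrier G" for y z
      using that x by (simp add: J_def m_assoc[symmetric] inv_mult_group)
    have le: "t \<le> 1 + t powr p" if "0 \<le> t" for t :: real
    proof (cases "t \<le> 1")
      case False
      then have "t powr 1 \<le> t powr p" using p by (intro powr_mono) auto
      then show ?thesis using False by simp
    qed (use powr_ge_zero[of t p] in linarith)
    have "(\<integral>\<^sup>+y. (\<integral>\<^sup>+z. ennreal (norm (J y z)) \<partial>\<mu>) \<partial>\<mu>)
      \<le> (\<integral>\<^sup>+y. ennreal (norm (f y)) * Nh
            + (\<integral>\<^sup>+z. ennreal (?e x y z) \<partial>\<mu>) \<partial>\<mu>)"
    proof (rule nn_integral_mono, goal_cases)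
      case (1 y)
      then have y: "y \<in> carrier G" by (simp add: space_eq)
      note [measurable] = measurable_const_carrier[OF y]
      have "(\<integral>\<^sup>+z. ennreal (norm (J y z)) \<partial>\<mu>) = (\<integral>\<^sup>+z. ennreal (norm (J y (y \<otimes> z))) \<partial>\<mu>)"
        by (rule nn_integral_left_mult[OF _ y, of "\<lambda>z. ennreal (norm (J y z))", symmetric]) measurable
      also have "\<dots> \<le> (\<integral>\<^sup>+z. ennreal (norm (f y)) * ennreal (norm (h z))
          + ennreal (?e x y z) \<partial>\<mu>)"
      proof (rule nn_integral_mono, goal_cases)
        case (1 z)
        then have z: "z \<in> carrier G" by (simp add: space_eq)
        have "norm (J y (y \<otimes> z)) \<le> norm (f y) * norm (h z) * (1 + norm (H (inv z \<otimes> (inv y \<otimes> x))) powr p)"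
          using le[of "norm (H (inv z \<otimes> (inv y \<otimes> x)))"]
          by (simp add: subst[OF y z] norm_mult mult.assoc mult_left_mono)
        then have "ennreal (norm (J y (y \<otimes> z))) \<le> ennreal (norm (f y) * norm (h z) + ?e x y z)"
          by (intro ennreal_leI) (simp add: algebra_simps)
        then show ?case
          by (simp add: ennreal_mult)
      qed
      also have "\<dots> = ennreal (norm (f y)) * Nh
            + (\<integral>\<^sup>+z. ennreal (?e x y z) \<partial>\<mu>)"
        unfolding Nh_def by (subst nn_integral_add, measurable, subst nn_integral_cmult, measurable)
      finally show ?case .
    qed
    also have "\<dots> = Nf * Nh + B x"
      unfolding Nf_def B_def by (subst nn_integral_add, measurable, subst nn_integral_multc, measurable)
    also have "\<dots> < \<infinity>"
      using fin Bx by (simp add: ennreal_mult_less_top top.not_eq_extremum)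
    finally have finJ: "(\<integral>\<^sup>+y. (\<integral>\<^sup>+z. ennreal (norm (J y z)) \<partial>\<mu>) \<partial>\<mu>) < \<infinity>" .
    have int: "integrable (\<mu> \<Otimes>\<^sub>M \<mu>) (case_prod J)"
    proof (rule integrableI_bounded)
      have "(\<integral>\<^sup>+q. ennreal (norm (case q of (y, z) \<Rightarrow> J y z)) \<partial>(\<mu> \<Otimes>\<^sub>M \<mu>)) = (\<integral>\<^sup>+y. (\<integral>\<^sup>+z. ennreal (norm (J y z)) \<partial>\<mu>) \<partial>\<mu>)"
        by (subst nn_integral_fst[symmetric]) simp_all
      with finJ show "(\<integral>\<^sup>+q. ennreal (norm (case q of (y, z) \<Rightarrow> J y z)) \<partial>(\<mu> \<Otimes>\<^sub>M \<mu>)) < \<infinity>" by simp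
    qed measurable
    have "convolution G \<mu> f (convolution G \<mu> h H) x = (\<integral>y. (\<integral>z. J y z \<partial>\<mu>) \<partial>\<mu>)"
      unfolding convolution_def
    proof (rule Bochner_Integration.integral_cong[OF refl])
      fix y assume "y \<in> space \<mu>"
      then have y: "y \<in> carrier G" by (simp add: space_eq)
      note [measurable] = measurable_const_carrier[OF y]
      have "(\<integral>z. J y z \<partial>\<mu>) = (\<integral>z. J y (y \<otimes> z) \<partial>\<mu>)"
        by (rule integral_left_mult[OF _ y, of "\<lambda>z. J y z", symmetric]) measurable
      also have "\<dots> = (\<integral>z. f y * (h z * H (inv z \<otimes> (inv y \<otimes> x))) \<partial>\<mu>)"
        by (rule Bochner_Integration.integral_cong) (simp_all add: subst y space_eq)
      finally show "f y * (\<integral>z. h z * H (inv z \<otimes> (inv y \<otimes> x)) \<partial>\<mu>) = (\<integral>z. J y z \<partial>\<mu>)" by simp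
    qed
    also have "\<dots> = (\<integral>z. (\<integral>y. J y z \<partial>\<mu>) \<partial>\<mu>)"
      by (rule pair.Fubini_integral[OF int, symmetric])
    also have "\<dots> = convolution G \<mu> (convolution G \<mu> f h) H x"
      unfolding convolution_def J_def by (rule Bochner_Integration.integral_cong) simp_all
    finally show "convolution G \<mu> (convolution G \<mu> f h) H x = convolution G \<mu> f (convolution G \<mu> h H) x" by simp
  qed
qed

lemma integrable_convolution:
  assumes "integrable \<mu> f" "integrable \<mu> h"
  shows "integrable \<mu> (convolution G \<mu> f h)"
  using young_in_Lp[of f 1 h] assms by (simp add: in_Lp_1_iff)

end

text \<open>The algebras are records that are not shown to satisfy the ring axioms, so the inverse
  inside \<open>circ\<close> is read off from its definite description, with uniqueness supplied as
  a premise.\<close>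

lemma a_inv_eqI:
  assumes "y \<in> carrier R" "y' \<in> carrier R" "y \<oplus>\<^bsub>R\<^esub> y' = \<zero>\<^bsub>R\<^esub>" "y' \<oplus>\<^bsub>R\<^esub> y = \<zero>\<^bsub>R\<^esub>"
    and "\<And>z. z \<in> carrier R \<Longrightarrow> y \<oplus>\<^bsub>R\<^esub> z = \<zero>\<^bsub>R\<^esub> \<Longrightarrow> z = y'"
  shows "\<ominus>\<^bsub>R\<^esub> y = y'"
  unfolding a_inv_def m_inv_def
proof (rule the_equality)
  fix z assume "z \<in> carrier (add_monoid R) \<and> y \<otimes>\<^bsub>add_monoid R\<^esub> z = \<one>\<^bsub>add_monoid R\<^esub> \<and>
    z \<otimes>\<^bsub>add_monoid R\<^esub> y = \<one>\<^bsub>add_monoid R\<^esub>"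
  then have "z \<in> carrier R" "y \<oplus>\<^bsub>R\<^esub> z = \<zero>\<^bsub>R\<^esub>" by simp_all
  then show "z = y'" by (rule assms(5))
qed (simp add: assms(2,3,4))

section \<open>Convolution operators on classes\<close>

context left_invariant_measure
begin

text \<open>\<open>conv_op\<close> is computed on a chosen representative; this makes every
  representative admissible.\<close>

lemma conv_op_ae_class:
  assumes "integrable \<mu> f" "in_Lp p \<mu> H" "1 \<le> p"
  shows "conv_op p G \<mu> f (ae_class \<mu> H) = ae_class \<mu> (convolution G \<mu> f H)"
proof -
  have m: "H \<in> borel_measurable \<mu>" using assms by (simp add: in_Lp_def)
  note r = rep_in_ae_class[OF m]
  show ?thesis
    using convolution_cong_right[OF assms(1,2) r(2,1) assms(3)] assms(2)
    by (simp add: conv_op_def ae_class_in_Lp ae_class_cong)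
qed

lemma convolution_measurable_Lp:
  assumes "integrable \<mu> f" "in_Lp p \<mu> H"
  shows "convolution G \<mu> f H \<in> borel_measurable \<mu>"
  using assms by (intro convolution_measurable) (auto simp: in_Lp_def)

lemma conv_op_in_Lp:
  assumes "integrable \<mu> f" "1 \<le> p" "F \<in> Lp p \<mu>"
  shows "conv_op p G \<mu> f F \<in> Lp p \<mu>"
  using conv_op_ae_class[OF assms(1) in_Lp_rep(1)[OF assms(3)] assms(2)]
    young_in_Lp[OF assms(1) in_Lp_rep(1)[OF assms(3)] assms(2)]
  by (simp add: in_Lp_rep(2)[OF assms(3)] ae_class_in_Lp)

lemma conv_op_add:
  assumes "integrable \<mu> f" "integrable \<mu> g" "1 \<le> p" "F \<in> Lp p \<mu>"
  shows "class_add \<mu> (conv_op p G \<mu> f F) (conv_op p G \<mu> g F) = conv_op p G \<mu> (\<lambda>x. f x + g x) F"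
proof -
  note H = in_Lp_rep[OF assms(4)]
  have "class_add \<mu> (conv_op p G \<mu> f (ae_class \<mu> (rep F))) (conv_op p G \<mu> g (ae_class \<mu> (rep F)))
      = ae_class \<mu> (\<lambda>x. convolution G \<mu> f (rep F) x + convolution G \<mu> g (rep F) x)"
    using assms H(1) by (simp add: conv_op_ae_class class_add_ae_class convolution_measurable_Lp)
  also have "\<dots> = ae_class \<mu> (convolution G \<mu> (\<lambda>x. f x + g x) (rep F))"
    by (rule ae_class_cong) (use convolution_add_left[OF assms(1,2) H(1) assms(3)] in \<open>auto elim: eventually_mono\<close>)
  also have "\<dots> = conv_op p G \<mu> (\<lambda>x. f x + g x) (ae_class \<mu> (rep F))"
    using assms H(1) by (simp add: conv_op_ae_class)
  finally show ?thesis by (simp add: H(2))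
qed

lemma conv_op_diff:
  assumes "integrable \<mu> f" "integrable \<mu> g" "1 \<le> p" "F \<in> Lp p \<mu>"
  shows "class_diff \<mu> (conv_op p G \<mu> f F) (conv_op p G \<mu> g F) = conv_op p G \<mu> (\<lambda>x. f x - g x) F"
proof -
  note H = in_Lp_rep[OF assms(4)]
  have "class_diff \<mu> (conv_op p G \<mu> f (ae_class \<mu> (rep F))) (conv_op p G \<mu> g (ae_class \<mu> (rep F)))
      = ae_class \<mu> (\<lambda>x. convolution G \<mu> f (rep F) x - convolution G \<mu> g (rep F) x)"
    using assms H(1) by (simp add: conv_op_ae_class class_diff_ae_class convolution_measurable_Lp)
  also have "\<dots> = ae_class \<mu> (convolution G \<mu> (\<lambda>x. f x - g x) (rep F))"
    by (rule ae_class_cong) (use convolution_diff_left[OF assms(1,2) H(1) assms(3)] in \<open>auto elim: eventually_mono\<close>)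
  also have "\<dots> = conv_op p G \<mu> (\<lambda>x. f x - g x) (ae_class \<mu> (rep F))"
    using assms H(1) by (simp add: conv_op_ae_class)
  finally show ?thesis by (simp add: H(2))
qed

lemma conv_op_norm:
  assumes "integrable \<mu> f" "1 \<le> p" "F \<in> Lp p \<mu>"
  shows "Lp_norm p \<mu> (conv_op p G \<mu> f F) \<le> (\<integral>x. norm (f x) \<partial>\<mu>) * Lp_norm p \<mu> F"
proof -
  note H = in_Lp_rep[OF assms(3)]
  have "Lp_norm p \<mu> (conv_op p G \<mu> f (ae_class \<mu> (rep F)))
      = (\<integral>x. norm (convolution G \<mu> f (rep F) x) powr p \<partial>\<mu>) powr (1 / p)"
    using assms H(1) young_in_Lp[OF assms(1) H(1) assms(2)] by (simp add: conv_op_ae_class Lp_norm_ae_class)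
  also have "\<dots> \<le> ((\<integral>x. norm (f x) \<partial>\<mu>) powr p * (\<integral>x. norm (rep F x) powr p \<partial>\<mu>)) powr (1 / p)"
    using young_ineq[OF assms(1) H(1) assms(2)] assms(2) by (intro powr_mono2) simp_all
  also have "\<dots> = (\<integral>x. norm (f x) \<partial>\<mu>) * (\<integral>x. norm (rep F x) powr p \<partial>\<mu>) powr (1 / p)"
    using assms(2) by (simp add: powr_mult powr_powr)
  finally show ?thesis by (simp add: H(2) Lp_norm_def)
qed

lemma conv_op_compose:
  assumes "integrable \<mu> f" "integrable \<mu> h" "1 \<le> p"
  shows "compose (Lp p \<mu>) (conv_op p G \<mu> f) (conv_op p G \<mu> h) = conv_op p G \<mu> (convolution G \<mu> f h)"
proof
  fix F show "compose (Lp p \<mu>) (conv_op p G \<mu> f) (conv_op p G \<mu> h) F = conv_op p G \<mu> (convolution G \<mu> f h) F"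
  proof (cases "F \<in> Lp p \<mu>")
    case True
    note H = in_Lp_rep[OF True]
    have "conv_op p G \<mu> f (conv_op p G \<mu> h (ae_class \<mu> (rep F))) = conv_op p G \<mu> (convolution G \<mu> f h) (ae_class \<mu> (rep F))"
      using assms H(1) young_in_Lp[OF assms(2) H(1) assms(3)] convolution_assoc[OF assms(1,2) H(1) assms(3)]
      by (simp add: conv_op_ae_class integrable_convolution ae_class_cong)
    then show ?thesis using True by (simp add: H(2) compose_eq)
  qed (simp add: compose_def conv_op_def)
qed

lemma conv_op_bounded:
  assumes "integrable \<mu> f" "1 \<le> p"
  shows "conv_op p G \<mu> f \<in> Lp_bounded_ops p \<mu>"
proof -
  have add: "conv_op p G \<mu> f (class_add \<mu> F K) = class_add \<mu> (conv_op p G \<mu> f F) (conv_op p G \<mu> f K)"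
    if F: "F \<in> Lp p \<mu>" and K: "K \<in> Lp p \<mu>" for F K
  proof -
    note H = in_Lp_rep[OF F] and J = in_Lp_rep[OF K]
    have m: "rep F \<in> borel_measurable \<mu>" "rep K \<in> borel_measurable \<mu>" using H J by (auto simp: in_Lp_def)
    have "conv_op p G \<mu> f (class_add \<mu> (ae_class \<mu> (rep F)) (ae_class \<mu> (rep K)))
        = class_add \<mu> (conv_op p G \<mu> f (ae_class \<mu> (rep F))) (conv_op p G \<mu> f (ae_class \<mu> (rep K)))"
      using assms H(1) J(1) m convolution_add_right[OF assms(1) H(1) J(1) assms(2)] in_Lp_add[OF H(1) J(1)]
      by (simp add: conv_op_ae_class class_add_ae_class convolution_measurable_Lp ae_class_cong)
    then show ?thesis by (simp add: H(2) J(2))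
  qed
  have scale: "conv_op p G \<mu> f (class_scale \<mu> c F) = class_scale \<mu> c (conv_op p G \<mu> f F)"
    if F: "F \<in> Lp p \<mu>" for F c
  proof -
    note H = in_Lp_rep[OF F]
    have m: "rep F \<in> borel_measurable \<mu>" using H by (auto simp: in_Lp_def)
    have "conv_op p G \<mu> f (class_scale \<mu> c (ae_class \<mu> (rep F))) = class_scale \<mu> c (conv_op p G \<mu> f (ae_class \<mu> (rep F)))"
      using assms H(1) m in_Lp_scale[OF H(1)]
      by (simp add: conv_op_ae_class class_scale_ae_class convolution_measurable_Lp convolution_scale_right)
    then show ?thesis by (simp add: H(2))
  qed
  have "conv_op p G \<mu> f \<in> extensional (Lp p \<mu>)" by (simp add: conv_op_def)
  then show ?thesis
    unfolding Lp_bounded_ops_def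
    using add scale conv_op_norm[OF assms] conv_op_in_Lp[OF assms]
    by (intro CollectI conjI ballI allI exI) (simp_all add: PiE_def)
qed

lemma conv_op_zero: "conv_op p G \<mu> (\<lambda>x. 0) = (\<lambda>F\<in>Lp p \<mu>. class_zero \<mu>)"
  by (simp add: conv_op_def convolution_def class_zero_def)

lemma conv_op_plus:
  assumes "integrable \<mu> f" "integrable \<mu> g" "1 \<le> p"
  shows "(\<lambda>F\<in>Lp p \<mu>. class_add \<mu> (conv_op p G \<mu> f F) (conv_op p G \<mu> g F)) = conv_op p G \<mu> (\<lambda>x. f x + g x)"
proof
  fix F show "(\<lambda>F\<in>Lp p \<mu>. class_add \<mu> (conv_op p G \<mu> f F) (conv_op p G \<mu> g F)) F = conv_op p G \<mu> (\<lambda>x. f x + g x) F"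
    by (cases "F \<in> Lp p \<mu>") (simp_all add: conv_op_add[OF assms] conv_op_def[of p G \<mu> "\<lambda>x. f x + g x"])
qed

lemma conv_op_cong:
  assumes "AE x in \<mu>. f x = g x" "integrable \<mu> f" "integrable \<mu> g" "1 \<le> p"
  shows "conv_op p G \<mu> f = conv_op p G \<mu> g"
proof
  fix F show "conv_op p G \<mu> f F = conv_op p G \<mu> g F"
  proof (cases "F \<in> Lp p \<mu>")
    case True
    note H = in_Lp_rep[OF True]
    have "AE x in \<mu>. convolution G \<mu> f (rep F) x = convolution G \<mu> g (rep F) x"
      using AE_space by eventually_elim (use assms H in \<open>auto intro!: convolution_cong_left simp: in_Lp_def space_eq\<close>)
    then show ?thesis by (simp add: conv_op_def ae_class_cong)
  qed (simp add: conv_op_def)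
qed

end

section \<open>Pseudofunctions and the circle operation in both algebras\<close>

locale haar_group = left_invariant_measure G \<mu>
  for G :: "('g::topological_space) monoid" (structure) and \<mu> :: "'g measure" +
  assumes Cc_dense: "integrable \<mu> f \<Longrightarrow> 0 < \<epsilon> \<Longrightarrow>
    \<exists>g\<in>Cc G. integrable \<mu> g \<and> (\<integral>x. norm (f x - g x) \<partial>\<mu>) < \<epsilon>"
begin

text \<open>By Young's inequality the operator norm is at most the \<open>L^1\<close> norm, so
  approximation by \<open>Cc\<close> in \<open>L^1\<close> suffices.\<close>

lemma conv_op_in_PF:
  assumes f: "integrable \<mu> f" and p: "1 \<le> p"
  shows "conv_op p G \<mu> f \<in> PF p G \<mu>"
proof -
  have "\<exists>g\<in>Cc G. Lp_opnorm p \<mu> (Lp_op_diff p \<mu> (conv_op p G \<mu> f) (conv_op p G \<mu> g)) < \<epsilon>"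
    if \<epsilon>: "0 < \<epsilon>" for \<epsilon> :: real
  proof -
    obtain g where g: "g \<in> Cc G" "integrable \<mu> g" and d: "(\<integral>x. norm (f x - g x) \<partial>\<mu>) < \<epsilon>"
      using Cc_dense[OF f \<epsilon>] by blast
    have fg: "integrable \<mu> (\<lambda>x. f x - g x)" using f g by simp
    have "Lp_opnorm p \<mu> (Lp_op_diff p \<mu> (conv_op p G \<mu> f) (conv_op p G \<mu> g)) \<le> (\<integral>x. norm (f x - g x) \<partial>\<mu>)"
      unfolding Lp_opnorm_def
    proof (rule cSUP_least)
      \<comment> \<open>The zero class shows that the supremum defining the operator norm ranges
        over a nonempty set.\<close>
      have z: "in_Lp p \<mu> (\<lambda>x. 0)" by (simp add: in_Lp_def)
      then have "ae_class \<mu> (\<lambda>x. 0) \<in> {F \<in> Lp p \<mu>. Lp_norm p \<mu> F \<le> 1}"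
        by (simp add: ae_class_in_Lp Lp_norm_ae_class)
      then show "{F \<in> Lp p \<mu>. Lp_norm p \<mu> F \<le> 1} \<noteq> {}" by blast
    next
      fix F assume "F \<in> {F \<in> Lp p \<mu>. Lp_norm p \<mu> F \<le> 1}"
      then have F: "F \<in> Lp p \<mu>" and n: "Lp_norm p \<mu> F \<le> 1" by auto
      have "Lp_norm p \<mu> (Lp_op_diff p \<mu> (conv_op p G \<mu> f) (conv_op p G \<mu> g) F)
          \<le> (\<integral>x. norm (f x - g x) \<partial>\<mu>) * Lp_norm p \<mu> F"
        using conv_op_norm[OF fg p F] F by (simp add: Lp_op_diff_def conv_op_diff[OF f g(2) p F])
      also have "\<dots> \<le> (\<integral>x. norm (f x - g x) \<partial>\<mu>) * 1"
        using n by (rule mult_left_mono) simp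
      finally show "Lp_norm p \<mu> (Lp_op_diff p \<mu> (conv_op p G \<mu> f) (conv_op p G \<mu> g) F) \<le> (\<integral>x. norm (f x - g x) \<partial>\<mu>)"
        by simp
    qed
    with d g show ?thesis by (auto intro: le_less_trans)
  qed
  then show ?thesis using conv_op_bounded[OF f p] by (simp add: PF_def)
qed

text \<open>The only delicate term is the additive inverse of the product, which is shown to be the
  operator of the negated convolution.\<close>

lemma circ_PF:
  assumes f: "integrable \<mu> f" and h: "integrable \<mu> h" and p: "1 \<le> p"
  shows "circ (PF_algebra p G \<mu>) (conv_op p G \<mu> f) (conv_op p G \<mu> h)
    = conv_op p G \<mu> (\<lambda>x. f x + h x - convolution G \<mu> f h x)"
proof -
  define k where "k = convolution G \<mu> f h"
  have k: "integrable \<mu> k" and k': "integrable \<mu> (\<lambda>x. - k x)"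
    using integrable_convolution[OF f h] by (simp_all add: k_def)
  have "\<ominus>\<^bsub>PF_algebra p G \<mu>\<^esub> (conv_op p G \<mu> k) = conv_op p G \<mu> (\<lambda>x. - k x)"
  proof (rule a_inv_eqI)
    show "conv_op p G \<mu> k \<in> carrier (PF_algebra p G \<mu>)" "conv_op p G \<mu> (\<lambda>x. - k x) \<in> carrier (PF_algebra p G \<mu>)"
      using conv_op_in_PF[OF k p] conv_op_in_PF[OF k' p] by (simp_all add: PF_algebra_def)
    show "conv_op p G \<mu> k \<oplus>\<^bsub>PF_algebra p G \<mu>\<^esub> conv_op p G \<mu> (\<lambda>x. - k x) = \<zero>\<^bsub>PF_algebra p G \<mu>\<^esub>"
      "conv_op p G \<mu> (\<lambda>x. - k x) \<oplus>\<^bsub>PF_algebra p G \<mu>\<^esub> conv_op p G \<mu> k = \<zero>\<^bsub>PF_algebra p G \<mu>\<^esub>"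
      using conv_op_plus[OF k k' p] conv_op_plus[OF k' k p] by (simp_all add: PF_algebra_def conv_op_zero)
    fix z assume "z \<in> carrier (PF_algebra p G \<mu>)"
      and z0: "conv_op p G \<mu> k \<oplus>\<^bsub>PF_algebra p G \<mu>\<^esub> z = \<zero>\<^bsub>PF_algebra p G \<mu>\<^esub>"
    then have z: "z \<in> extensional (Lp p \<mu>)" "\<And>F. F \<in> Lp p \<mu> \<Longrightarrow> z F \<in> Lp p \<mu>"
      by (auto simp: PF_algebra_def PF_def Lp_bounded_ops_def PiE_def)
    \<comment> \<open>Here \<open>z\<close> is an arbitrary pseudofunction and need not come from a
      function on the group, so it is determined class by class.\<close>
    show "z = conv_op p G \<mu> (\<lambda>x. - k x)"
    proof (rule extensionalityI[OF z(1)])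
      show "conv_op p G \<mu> (\<lambda>x. - k x) \<in> extensional (Lp p \<mu>)" by (simp add: conv_op_def)
      fix F assume F: "F \<in> Lp p \<mu>"
      note H = in_Lp_rep[OF F] and Z = in_Lp_rep[OF z(2)[OF F]]
      have m: "rep (z F) \<in> borel_measurable \<mu>" "convolution G \<mu> k (rep F) \<in> borel_measurable \<mu>"
        using Z convolution_measurable_Lp[OF k H(1)] by (auto simp: in_Lp_def)
      have "class_add \<mu> (conv_op p G \<mu> k F) (z F) = class_zero \<mu>"
        using fun_cong[OF z0, of F] F by (simp add: PF_algebra_def)
      then have "class_add \<mu> (conv_op p G \<mu> k (ae_class \<mu> (rep F))) (ae_class \<mu> (rep (z F))) = ae_class \<mu> (\<lambda>x. 0)"
        by (simp add: H(2) Z(2) class_zero_def)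
      then have "AE x in \<mu>. convolution G \<mu> k (rep F) x + rep (z F) x = 0"
        using m by (simp add: conv_op_ae_class[OF k H(1) p] class_add_ae_class ae_class_eq_iff)
      then have "AE x in \<mu>. rep (z F) x = convolution G \<mu> (\<lambda>x. - k x) (rep F) x"
        by eventually_elim (simp add: convolution_def add_eq_0_iff)
      then have "ae_class \<mu> (rep (z F)) = conv_op p G \<mu> (\<lambda>x. - k x) (ae_class \<mu> (rep F))"
        by (simp add: conv_op_ae_class[OF k' H(1) p] ae_class_cong)
      then show "z F = conv_op p G \<mu> (\<lambda>x. - k x) F" by (simp add: H(2) Z(2))
    qed
  qed
  moreover have fh: "integrable \<mu> (\<lambda>x. f x + h x)" using f h by simp
  ultimately show ?thesis
    using conv_op_plus[OF f h p] conv_op_compose[OF f h p] conv_op_plus[OF fh k' p]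
    by (simp add: circ_def a_minus_def PF_algebra_def k_def[symmetric])
qed

lemma circ_L1:
  assumes f: "integrable \<mu> f" and h: "integrable \<mu> h"
  shows "circ (L1_algebra G \<mu>) (ae_class \<mu> f) (ae_class \<mu> h)
    = ae_class \<mu> (\<lambda>x. f x + h x - convolution G \<mu> f h x)"
proof -
  define k where "k = convolution G \<mu> f h"
  have k: "integrable \<mu> k" using integrable_convolution[OF f h] by (simp add: k_def)
  have [measurable]: "f \<in> borel_measurable \<mu>" "h \<in> borel_measurable \<mu>" "k \<in> borel_measurable \<mu>"
    using f h k by auto
  note rf = rep_in_ae_class[OF borel_measurable_integrable[OF f]]
    and rh = rep_in_ae_class[OF borel_measurable_integrable[OF h]]
  have "integrable \<mu> (rep (ae_class \<mu> f))" 
    using in_Lp_cong[OF rf(2,1), of 1] f by (simp add: in_Lp_1_iff)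
  \<comment> \<open>The right representative is exchanged almost everywhere through Young's
    inequality, the left one then at every point, since it is integrated directly.\<close>
  then have "AE x in \<mu>. convolution G \<mu> (rep (ae_class \<mu> f)) (rep (ae_class \<mu> h)) x = convolution G \<mu> (rep (ae_class \<mu> f)) h x"
    using h by (intro convolution_cong_right[OF _ _ rh(2,1), of _ 1]) (simp_all add: in_Lp_1_iff)
  then have "AE x in \<mu>. convolution G \<mu> (rep (ae_class \<mu> f)) (rep (ae_class \<mu> h)) x = k x"
    using AE_space
  proof eventually_elim
    case (elim x)
    then show ?case using convolution_cong_left[OF rf(2,1), of h x] by (simp add: k_def space_eq)
  qed
  then have mult: "ae_class \<mu> f \<otimes>\<^bsub>L1_algebra G \<mu>\<^esub> ae_class \<mu> h = ae_class \<mu> k"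
    by (simp add: L1_algebra_def ae_class_cong)
  have "\<ominus>\<^bsub>L1_algebra G \<mu>\<^esub> (ae_class \<mu> k) = ae_class \<mu> (\<lambda>x. - k x)"
  proof (rule a_inv_eqI)
    show "ae_class \<mu> k \<in> carrier (L1_algebra G \<mu>)" "ae_class \<mu> (\<lambda>x. - k x) \<in> carrier (L1_algebra G \<mu>)"
      using k by (auto simp: L1_algebra_def in_Lp_1_iff intro!: ae_class_in_Lp)
    show "ae_class \<mu> k \<oplus>\<^bsub>L1_algebra G \<mu>\<^esub> ae_class \<mu> (\<lambda>x. - k x) = \<zero>\<^bsub>L1_algebra G \<mu>\<^esub>"
      "ae_class \<mu> (\<lambda>x. - k x) \<oplus>\<^bsub>L1_algebra G \<mu>\<^esub> ae_class \<mu> k = \<zero>\<^bsub>L1_algebra G \<mu>\<^esub>"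
      by (simp_all add: L1_algebra_def class_zero_def class_add_ae_class)
    fix z assume "z \<in> carrier (L1_algebra G \<mu>)" and z0: "ae_class \<mu> k \<oplus>\<^bsub>L1_algebra G \<mu>\<^esub> z = \<zero>\<^bsub>L1_algebra G \<mu>\<^esub>"
    then have Z: "in_Lp 1 \<mu> (rep z)" "ae_class \<mu> (rep z) = z"
      by (auto simp: L1_algebra_def in_Lp_rep)
    then have [measurable]: "rep z \<in> borel_measurable \<mu>" by (simp add: in_Lp_def)
    have "class_add \<mu> (ae_class \<mu> k) (ae_class \<mu> (rep z)) = ae_class \<mu> (\<lambda>x. 0)"
      using z0 by (simp add: Z(2) L1_algebra_def class_zero_def)
    then have "AE x in \<mu>. k x + rep z x = 0"
      by (simp add: class_add_ae_class ae_class_eq_iff)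
    then have "AE x in \<mu>. rep z x = - k x" by eventually_elim (simp add: add_eq_0_iff)
    then have "ae_class \<mu> (rep z) = ae_class \<mu> (\<lambda>x. - k x)" by (rule ae_class_cong)
    then show "z = ae_class \<mu> (\<lambda>x. - k x)" by (simp add: Z(2))
  qed
  with mult show ?thesis
    by (simp add: circ_def a_minus_def k_def[symmetric])
      (simp add: L1_algebra_def class_add_ae_class)
qed

lemma zero_PF: "\<zero>\<^bsub>PF_algebra p G \<mu>\<^esub> = conv_op p G \<mu> (\<lambda>x. 0)"
  by (simp add: PF_algebra_def conv_op_zero)

lemma zero_L1: "\<zero>\<^bsub>L1_algebra G \<mu>\<^esub> = ae_class \<mu> (\<lambda>x. 0)"
  by (simp add: L1_algebra_def class_zero_def)

text \<open>One test function \<open>H\<close> serves both algebras: it detects that the operator of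
  \<open>f + h - f * h\<close> is nonzero on \<open>L^p\<close>, without appeal to faithfulness of
  the representation of \<open>L^1\<close>.\<close>

theorem not_directly_finite:
  assumes f: "integrable \<mu> f" and h: "integrable \<mu> h"
    and hf: "AE x in \<mu>. convolution G \<mu> h f x = h x + f x"
    and H: "\<And>p. 1 \<le> p \<Longrightarrow> in_Lp p \<mu> H"
    and fh: "\<not> (AE x in \<mu>. convolution G \<mu> (\<lambda>x. f x + h x - convolution G \<mu> f h x) H x = 0)"
    and p: "1 \<le> p"
  shows "\<not> directly_finite (L1_algebra G \<mu>)" "\<not> directly_finite (PF_algebra p G \<mu>)"
proof -
  let ?E = "\<lambda>x. f x + h x - convolution G \<mu> f h x"
  have E: "integrable \<mu> ?E" using f h integrable_convolution[OF f h] by simp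
  have D: "integrable \<mu> (\<lambda>x. h x + f x - convolution G \<mu> h f x)"
    using f h integrable_convolution[OF h f] by simp
  have D0: "AE x in \<mu>. h x + f x - convolution G \<mu> h f x = 0" using hf by eventually_elim simp
  have convE: "\<not> conv_op p G \<mu> ?E = conv_op p G \<mu> (\<lambda>x. 0)"
  proof
    assume "conv_op p G \<mu> ?E = conv_op p G \<mu> (\<lambda>x. 0)"
    then have "conv_op p G \<mu> ?E (ae_class \<mu> H) = conv_op p G \<mu> (\<lambda>x. 0) (ae_class \<mu> H)" by simp
    then have "ae_class \<mu> (convolution G \<mu> ?E H) = ae_class \<mu> (convolution G \<mu> (\<lambda>x. 0) H)"
      by (simp only: conv_op_ae_class[OF E H[OF p] p] conv_op_ae_class[OF integrable_zero H[OF p] p])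
    then have "AE x in \<mu>. convolution G \<mu> ?E H x = convolution G \<mu> (\<lambda>x. 0) H x"
      using ae_class_eq_iff[OF convolution_measurable_Lp[OF E H[OF p]]] by blast
    then show False using fh by (simp add: convolution_def)
  qed
  show "\<not> directly_finite (PF_algebra p G \<mu>)"
  proof
    assume df: "directly_finite (PF_algebra p G \<mu>)"
    have "circ (PF_algebra p G \<mu>) (conv_op p G \<mu> h) (conv_op p G \<mu> f) = \<zero>\<^bsub>PF_algebra p G \<mu>\<^esub>"
      using conv_op_cong[OF D0 D _ p] by (simp add: circ_PF[OF h f p] zero_PF)
    then have "circ (PF_algebra p G \<mu>) (conv_op p G \<mu> f) (conv_op p G \<mu> h) = \<zero>\<^bsub>PF_algebra p G \<mu>\<^esub>"
      using df conv_op_in_PF[OF f p] conv_op_in_PF[OF h p] by (simp add: directly_finite_def PF_algebra_def)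
    then show False using convE by (simp add: circ_PF[OF f h p] zero_PF)
  qed
  show "\<not> directly_finite (L1_algebra G \<mu>)"
  proof
    assume df: "directly_finite (L1_algebra G \<mu>)"
    have "circ (L1_algebra G \<mu>) (ae_class \<mu> h) (ae_class \<mu> f) = \<zero>\<^bsub>L1_algebra G \<mu>\<^esub>"
      using ae_class_cong[OF D0] by (simp add: circ_L1[OF h f] zero_L1)
    moreover have "ae_class \<mu> f \<in> carrier (L1_algebra G \<mu>)" "ae_class \<mu> h \<in> carrier (L1_algebra G \<mu>)"
      using f h by (auto simp: L1_algebra_def in_Lp_1_iff intro!: ae_class_in_Lp)
    ultimately have "circ (L1_algebra G \<mu>) (ae_class \<mu> f) (ae_class \<mu> h) = \<zero>\<^bsub>L1_algebra G \<mu>\<^esub>"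
      using df by (simp add: directly_finite_def)
    then have "ae_class \<mu> ?E = ae_class \<mu> (\<lambda>x. 0)"
      by (simp add: circ_L1[OF f h] zero_L1)
    then have "AE x in \<mu>. ?E x = 0"
      by (rule iffD1[OF ae_class_eq_iff[OF borel_measurable_integrable[OF E]]])
    \<comment> \<open>A null function induces the zero operator, so the non-vanishing of the
      operator also settles the case of \<open>L^1\<close>.\<close>
    then show False using convE conv_op_cong[OF _ E _ p, of "\<lambda>x. 0"] by simp
  qed
qed

end

section \<open>Density of compactly supported functions\<close>

context
  fixes G :: "('g::euclidean_space) monoid" and \<mu> :: "'g measure"
  assumes haar: "left_haar_measure G \<mu>"
begin

lemma haar_sets: "sets \<mu> = sets (restrict_space borel (carrier G))"
  and haar_space: "space \<mu> = carrier G"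
  and haar_compact_finite: "compact K \<Longrightarrow> K \<subseteq> carrier G \<Longrightarrow> emeasure \<mu> K < \<infinity>"
  using haar by (auto simp: left_haar_measure_def)

lemma haar_borel_sets: "K \<in> sets borel \<Longrightarrow> K \<subseteq> carrier G \<Longrightarrow> K \<in> sets \<mu>"
  by (auto simp: haar_sets sets_restrict_space)

lemma haar_openin_sets: "openin (top_of_set (carrier G)) U \<Longrightarrow> U \<in> sets \<mu>"
  by (auto simp: haar_sets sets_restrict_space openin_open)

lemma Cc_integrable:
  assumes "g \<in> Cc G"
  shows "integrable \<mu> g"
proof -
  obtain K where K: "continuous_on (carrier G) g" "compact K" "K \<subseteq> carrier G" "\<And>x. x \<notin> K \<Longrightarrow> g x = 0"
    using assms by (auto simp: Cc_def)
  have Ks: "K \<in> sets \<mu>" using K by (intro haar_borel_sets borel_compact)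
  have "g \<in> borel_measurable (restrict_space borel (carrier G))"
    by (rule borel_measurable_continuous_on_restrict) fact
  then have m: "g \<in> borel_measurable \<mu>"
    by (simp add: measurable_def haar_sets haar_space space_restrict_space)
  have "compact (g ` K)" using K by (intro compact_continuous_image continuous_on_subset[OF K(1)])
  then obtain B where B: "\<And>x. x \<in> K \<Longrightarrow> norm (g x) \<le> B"
    using compact_imp_bounded bounded_iff by (metis imageI)
  show ?thesis
  proof (rule Bochner_Integration.integrable_bound)
    show "integrable \<mu> (\<lambda>x. indicat_real K x * B)"
      using Ks haar_compact_finite[OF K(2,3)] by simp
    show "AE x in \<mu>. norm (g x) \<le> norm (indicat_real K x * B)"
    proof (rule AE_I2)
      fix x
      show "norm (g x) \<le> norm (indicat_real K x * B)"
        using B[of x] K(4)[of x] by (cases "x \<in> K") auto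
    qed
  qed fact
qed

lemma Cc_add: "f \<in> Cc G \<Longrightarrow> g \<in> Cc G \<Longrightarrow> (\<lambda>x. f x + g x) \<in> Cc G"
proof -
  assume f: "f \<in> Cc G" and g: "g \<in> Cc G"
  obtain K where "compact K" "K \<subseteq> carrier G" "\<forall>x. x \<notin> K \<longrightarrow> f x = 0" using f by (auto simp: Cc_def)
  moreover obtain L where "compact L" "L \<subseteq> carrier G" "\<forall>x. x \<notin> L \<longrightarrow> g x = 0" using g by (auto simp: Cc_def)
  ultimately have "compact (K \<union> L)" "K \<union> L \<subseteq> carrier G" "\<forall>x. x \<notin> K \<union> L \<longrightarrow> f x + g x = 0" by auto
  then show ?thesis using f g unfolding Cc_def
    by (intro CollectI conjI exI[of _ "K \<union> L"]) (auto intro: continuous_on_add)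
qed

text \<open>Inner regularity is available for open sets only, so \<open>A\<close> is first enclosed
  in an open \<open>U\<close> and then \<open>K\<close> is chosen inside \<open>U\<close>, not
  inside \<open>A\<close>. A Urysohn function \<open>u\<close> that is 1 on \<open>K\<close> and 0
  off a neighbourhood of \<open>K\<close> in \<open>U\<close> differs from the indicator of
  \<open>A\<close> by at most 1, and only on \<open>U - A\<close> and \<open>U - K\<close>.\<close>

lemma Cc_approx_indicator:
  fixes c :: complex
  assumes lc: "locally compact (carrier G)" and A: "A \<in> sets \<mu>" "emeasure \<mu> A < \<infinity>" and \<epsilon>: "0 < (\<epsilon>::real)"
  shows "\<exists>g\<in>Cc G. (\<integral>x. norm (indicat_real A x *\<^sub>R c - g x) \<partial>\<mu>) < \<epsilon>"
proof -
  \<comment> \<open>The total error will be at most \<open>2 * norm c * \<delta>\<close>; the added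
    1 covers \<open>c = 0\<close> and makes the final inequality strict.\<close>
  define \<delta> where "\<delta> = \<epsilon> / (2 * norm c + 1)"
  have \<delta>: "0 < \<delta>" using \<epsilon> by (simp add: \<delta>_def add_nonneg_pos)
  let ?S = "carrier G"
  have outer: "emeasure \<mu> A = (INF U\<in>{U. openin (top_of_set ?S) U \<and> A \<subseteq> U}. emeasure \<mu> U)"
    using haar A(1) by (simp add: left_haar_measure_def)
  have "emeasure \<mu> A < emeasure \<mu> A + ennreal \<delta>"
    using A(2) \<delta> by (cases "emeasure \<mu> A") (auto simp: ennreal_plus[symmetric] ennreal_less_iff simp del: ennreal_plus)
  then obtain U where U: "openin (top_of_set ?S) U" "A \<subseteq> U" "emeasure \<mu> U < emeasure \<mu> A + ennreal \<delta>"
    unfolding outer INF_less_iff by auto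
  have Us: "U \<in> sets \<mu>" by (rule haar_openin_sets) fact
  have Ufin: "emeasure \<mu> U < \<infinity>"
    by (rule less_trans[OF U(3)]) (use A(2) in simp)
  have inner: "emeasure \<mu> U = (SUP K\<in>{K. compact K \<and> K \<subseteq> U}. emeasure \<mu> K)"
    using haar U(1) by (simp add: left_haar_measure_def)
  obtain K where K: "compact K" "K \<subseteq> U" "emeasure \<mu> U < emeasure \<mu> K + ennreal \<delta>"
  proof -
    have "\<exists>K\<in>{K. compact K \<and> K \<subseteq> U}. emeasure \<mu> U < emeasure \<mu> K + ennreal \<delta>"
      by (rule SUP_approx_ennreal[OF \<delta> _ inner]) (use Ufin in auto)
    then show ?thesis using that by blast
  qed
  have US: "U \<subseteq> ?S" using U(1) openin_imp_subset by blast
  have Ks: "K \<in> sets \<mu>" using K US by (intro haar_borel_sets borel_compact) auto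
  \<comment> \<open>Local compactness provides a compact \<open>W\<close> inside \<open>U\<close>
    that contains the neighbourhood \<open>V\<close> of \<open>K\<close>, and hence a compact
    support for \<open>u\<close>.\<close>
  have "locally compact U" using lc U(1) locally_open_subset by blast
  then obtain V W where VW: "K \<subseteq> V" "V \<subseteq> W" "W \<subseteq> U" "openin (top_of_set U) V" "compact W"
    using K unfolding locally_compact_compact by meson
  have VS: "openin (top_of_set ?S) V" using VW(4) U(1) openin_trans by blast
  obtain u :: "'g \<Rightarrow> real" where u: "continuous_on ?S u" "\<And>x. x \<in> ?S \<Longrightarrow> u x \<in> closed_segment 1 0"
    "\<And>x. x \<in> K \<Longrightarrow> u x = 1" "\<And>x. x \<in> ?S - V \<Longrightarrow> u x = 0"
  proof (rule Urysohn_local[of ?S K "?S - V" 1 0])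
    show "closedin (top_of_set ?S) K" using K US by (intro closedin_subset_trans[of UNIV K ?S]) (auto intro: compact_imp_closed)
    show "closedin (top_of_set ?S) (?S - V)" using VS by (metis closedin_diff closedin_subtopology_refl topspace_euclidean_subtopology closedin_topspace)
    show "K \<inter> (?S - V) = {}" using VW by auto
  qed auto
  define g where "g x = (if x \<in> ?S then of_real (u x) * c else 0)" for x
  have u01: "0 \<le> u x" "u x \<le> 1" if "x \<in> ?S" for x
    using u(2)[OF that] by (auto simp: closed_segment_eq_real_ivl)
  have g: "g \<in> Cc G"
    unfolding Cc_def
  proof (intro CollectI conjI exI[of _ W])
    have "continuous_on ?S (\<lambda>x. of_real (u x) * c)" by (intro continuous_intros u)
    then show "continuous_on ?S g" by (rule continuous_on_eq) (simp add: g_def)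
    show "\<forall>x. x \<notin> W \<longrightarrow> g x = 0" using VW u(4) by (auto simp: g_def)
  qed (use VW US in auto)
  have gi: "integrable \<mu> g" by (rule Cc_integrable) fact
  have iA: "integrable \<mu> (\<lambda>x. indicat_real A x *\<^sub>R c)" using A by simp
  have D: "emeasure \<mu> (U - A) \<le> ennreal \<delta>" "emeasure \<mu> (U - K) \<le> ennreal \<delta>"
  proof -
    show "emeasure \<mu> (U - A) \<le> ennreal \<delta>"
      using U A Us by (subst emeasure_Diff) (auto simp: ennreal_minus_le_iff less_imp_le add.commute)
    have "emeasure \<mu> K \<noteq> \<infinity>" using emeasure_mono[OF K(2) Us] Ufin by (auto simp: top_unique)
    then show "emeasure \<mu> (U - K) \<le> ennreal \<delta>"
      using K Ks Us by (subst emeasure_Diff) (auto simp: ennreal_minus_le_iff less_imp_le add.commute)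
  qed
  have fin: "emeasure \<mu> (U - A) < \<infinity>" "emeasure \<mu> (U - K) < \<infinity>"
    using D by (auto intro: le_less_trans)
  have "(\<integral>x. norm (indicat_real A x *\<^sub>R c - g x) \<partial>\<mu>)
      \<le> (\<integral>x. norm c * (indicat_real (U - A) x + indicat_real (U - K) x) \<partial>\<mu>)"
  proof (rule integral_mono)
    show "integrable \<mu> (\<lambda>x. norm (indicat_real A x *\<^sub>R c - g x))" using iA gi by simp
    show "integrable \<mu> (\<lambda>x. norm c * (indicat_real (U - A) x + indicat_real (U - K) x))"
      using fin A(1) Us Ks by (intro integrable_mult_right Bochner_Integration.integrable_add integrable_real_indicator) auto
    fix x assume "x \<in> space \<mu>"
    then have x: "x \<in> ?S" by (simp add: haar_space)
    have "indicat_real A x *\<^sub>R c - g x = of_real (indicat_real A x - u x) * c"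
      using x by (simp add: g_def scaleR_conv_of_real algebra_simps)
    then have "norm (indicat_real A x *\<^sub>R c - g x) = \<bar>indicat_real A x - u x\<bar> * norm c"
      by (simp only: norm_mult norm_of_real)
    moreover have "\<bar>indicat_real A x - u x\<bar> \<le> indicat_real (U - A) x + indicat_real (U - K) x"
      using u01[OF x] u(3)[of x] u(4)[of x] x U(2) VW by (auto simp: indicator_def)
    ultimately show "norm (indicat_real A x *\<^sub>R c - g x) \<le> norm c * (indicat_real (U - A) x + indicat_real (U - K) x)"
      by (metis mult.commute mult_left_mono norm_ge_zero)
  qed
  also have "\<dots> = norm c * (measure \<mu> (U - A) + measure \<mu> (U - K))"
    using fin A(1) Us Ks by (simp add: integrable_real_indicator)
  also have "\<dots> \<le> norm c * (\<delta> + \<delta>)"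
    using D \<delta> by (intro mult_left_mono add_mono) (auto simp: measure_def intro: enn2real_leI)
  also have "\<dots> < (2 * norm c + 1) * \<delta>" using \<delta> by (simp add: algebra_simps)
  also have "\<dots> = \<epsilon>" using \<epsilon> by (simp add: \<delta>_def) (smt (verit) norm_ge_zero)
  finally show ?thesis using g by blast
qed

text \<open>Induction from indicators through sums to dominated limits. The error is quantified in
  the conclusion because the later cases invoke the hypothesis with half of it.\<close>

lemma Cc_dense_in_L1:
  fixes f :: "'g \<Rightarrow> complex"
  assumes lc: "locally compact (carrier G)" and f: "integrable \<mu> f"
  shows "\<And>\<epsilon>::real. 0 < \<epsilon> \<Longrightarrow> \<exists>g\<in>Cc G. (\<integral>x. norm (f x - g x) \<partial>\<mu>) < \<epsilon>"
  using f
proof (induction rule: integrable_induct)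
  case (base A c)
  then show ?case using Cc_approx_indicator[OF lc] by blast
next
  case (add f1 f2)
  obtain g1 where g1: "g1 \<in> Cc G" "(\<integral>x. norm (f1 x - g1 x) \<partial>\<mu>) < \<epsilon> / 2" using add.IH(1)[of "\<epsilon> / 2"] add.prems by auto
  obtain g2 where g2: "g2 \<in> Cc G" "(\<integral>x. norm (f2 x - g2 x) \<partial>\<mu>) < \<epsilon> / 2" using add.IH(2)[of "\<epsilon> / 2"] add.prems by auto
  note i = Cc_integrable[OF g1(1)] Cc_integrable[OF g2(1)]
  have "(\<integral>x. norm ((f1 x + f2 x) - (g1 x + g2 x)) \<partial>\<mu>) \<le> (\<integral>x. norm (f1 x - g1 x) + norm (f2 x - g2 x) \<partial>\<mu>)"
  proof (rule integral_mono)
    show "norm ((f1 x + f2 x) - (g1 x + g2 x)) \<le> norm (f1 x - g1 x) + norm (f2 x - g2 x)" for x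
      by (rule norm_diff_triangle_ineq)
  qed (use add.hyps i in auto)
  also have "\<dots> = (\<integral>x. norm (f1 x - g1 x) \<partial>\<mu>) + (\<integral>x. norm (f2 x - g2 x) \<partial>\<mu>)"
    using add.hyps i by simp
  also have "\<dots> < \<epsilon>" using g1 g2 by simp
  finally show ?case by (rule bexI[OF _ Cc_add[OF g1(1) g2(1)]])
next
  case (lim f s)
  have [measurable]: "f \<in> borel_measurable \<mu>" "\<And>i. s i \<in> borel_measurable \<mu>" using lim.hyps by auto
  have "(\<lambda>i. (\<integral>x. norm (f x - s i x) \<partial>\<mu>)) \<longlonglongrightarrow> (\<integral>x. 0 \<partial>\<mu>)"
  \<comment> \<open>The induction rule supplies \<open>norm (s i x) \<le> 2 * norm (f x)\<close>,
    whence the factor 3 for the difference.\<close>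
  proof (rule integral_dominated_convergence[where w = "\<lambda>x. 3 * norm (f x)"])
    show "integrable \<mu> (\<lambda>x. 3 * norm (f x))" using lim.hyps by simp
    show "AE x in \<mu>. (\<lambda>i. norm (f x - s i x)) \<longlonglongrightarrow> 0"
    proof (rule AE_I2)
      fix x assume "x \<in> space \<mu>"
      from tendsto_norm[OF tendsto_diff[OF tendsto_const[of "f x"] lim.hyps(2)[OF this]]]
      show "(\<lambda>i. norm (f x - s i x)) \<longlonglongrightarrow> 0" by simp
    qed
    fix i
    show "AE x in \<mu>. norm (norm (f x - s i x)) \<le> 3 * norm (f x)"
    proof (rule AE_I2)
      fix x assume "x \<in> space \<mu>"
      then show "norm (norm (f x - s i x)) \<le> 3 * norm (f x)"
        using norm_triangle_ineq4[of "f x" "s i x"] lim.hyps(3)[of x i] by simp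
    qed
  qed measurable
  then have "\<forall>\<^sub>F i in sequentially. (\<integral>x. norm (f x - s i x) \<partial>\<mu>) < \<epsilon> / 2"
    using lim.prems by (intro order_tendstoD(2)) auto
  then obtain i where i: "(\<integral>x. norm (f x - s i x) \<partial>\<mu>) < \<epsilon> / 2" by (auto simp: eventually_sequentially)
  obtain g where g: "g \<in> Cc G" "(\<integral>x. norm (s i x - g x) \<partial>\<mu>) < \<epsilon> / 2" using lim.IH[of "\<epsilon> / 2" i] lim.prems by auto
  note gi = Cc_integrable[OF g(1)]
  have "(\<integral>x. norm (f x - g x) \<partial>\<mu>) \<le> (\<integral>x. norm (f x - s i x) + norm (s i x - g x) \<partial>\<mu>)"
  proof (rule integral_mono)
    show "norm (f x - g x) \<le> norm (f x - s i x) + norm (s i x - g x)" for x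
      using norm_triangle_ineq[of "f x - s i x" "s i x - g x"] by simp
  qed (use lim.hyps gi in auto)
  also have "\<dots> = (\<integral>x. norm (f x - s i x) \<partial>\<mu>) + (\<integral>x. norm (s i x - g x) \<partial>\<mu>)"
    using lim.hyps gi by simp
  also have "\<dots> < \<epsilon>" using i g by simp
  finally show ?case by (rule bexI[OF _ g(1)])
qed

end

section \<open>Lebesgue measure on a normed field\<close>

lemma nn_integral_lborel_translate:
  fixes F :: "'a::euclidean_space \<Rightarrow> ennreal"
  assumes [measurable]: "F \<in> borel_measurable borel"
  shows "(\<integral>\<^sup>+x. F (t + x) \<partial>lborel) = (\<integral>\<^sup>+x. F x \<partial>lborel)"
proof -
  have "(\<integral>\<^sup>+x. F x \<partial>distr lborel borel ((+) t)) = (\<integral>\<^sup>+x. F (t + x) \<partial>lborel)"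
    by (rule nn_integral_distr) measurable
  then show ?thesis by (simp only: lborel_distr_plus)
qed

text \<open>Multiplication by \<open>c\<close> carries Lebesgue measure to a translation invariant measure; the
  argument is that of the uniqueness of Haar measure.\<close>

lemma nn_integral_lborel_mult:
  fixes F :: "'a::{real_normed_field,euclidean_space} \<Rightarrow> ennreal"
  assumes [measurable]: "F \<in> borel_measurable borel" and c: "c \<noteq> 0"
  shows "(\<integral>\<^sup>+x. F (c * x) \<partial>lborel) = ennreal (norm c powr - real DIM('a)) * (\<integral>\<^sup>+x. F x \<partial>lborel)"
proof -
  \<comment> \<open>An auxiliary weight of known mass \<open>V\<close>, even under negation.
    Integrating \<open>F (c * x) * B (y - c * x)\<close> over both variables in two ways isolates
    the integral of \<open>F\<close>.\<close>
  define B :: "'a \<Rightarrow> ennreal" where "B y = (if norm y < 1 then 1 else 0)" for y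
  have B_minus [simp]: "B (- y) = B y" for y by (simp add: B_def)
  have [measurable]: "B \<in> borel_measurable borel" unfolding B_def by measurable
  define V where "V = emeasure lborel (ball (0::'a) 1)"
  have BV: "(\<integral>\<^sup>+y. B y \<partial>lborel) = V"
  proof -
    have "B = indicator (ball 0 1)" by (auto simp: B_def indicator_def)
    then show ?thesis by (simp add: V_def)
  qed
  have V: "V = ennreal (unit_ball_vol (DIM('a)))"
    by (simp add: V_def emeasure_ball)
  have V0: "V \<noteq> 0" "V \<noteq> \<infinity>" unfolding V by (simp_all add: ennreal_eq_0_iff not_le)
  have [measurable]: "(\<lambda>x. c * x) \<in> borel_measurable (borel :: 'a measure)" by measurable
  have "(\<integral>\<^sup>+x. F (c * x) \<partial>lborel) * V = (\<integral>\<^sup>+x. F (c * x) * V \<partial>lborel)"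
    by (rule nn_integral_multc[symmetric]) measurable
  also have "\<dots> = (\<integral>\<^sup>+x. (\<integral>\<^sup>+y. F (c * x) * B (- (c * x) + y) \<partial>lborel) \<partial>lborel)"
  proof (rule nn_integral_cong, goal_cases)
    case (1 x)
    have "(\<integral>\<^sup>+y. F (c * x) * B (- (c * x) + y) \<partial>lborel) = F (c * x) * (\<integral>\<^sup>+y. B (- (c * x) + y) \<partial>lborel)"
      by (rule nn_integral_cmult) measurable
    also have "(\<integral>\<^sup>+y. B (- (c * x) + y) \<partial>lborel) = (\<integral>\<^sup>+y. B y \<partial>lborel)"
      by (rule nn_integral_lborel_translate) measurable
    finally show ?case by (simp add: BV)
  qed
  also have "\<dots> = (\<integral>\<^sup>+y. (\<integral>\<^sup>+x. F (c * x) * B (- (c * x) + y) \<partial>lborel) \<partial>lborel)"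
    by (rule lborel_pair.Fubini'[symmetric]) measurable
  also have "\<dots> = (\<integral>\<^sup>+y. (\<integral>\<^sup>+x. F (y + c * x) * B (c * x) \<partial>lborel) \<partial>lborel)"
  proof (rule nn_integral_cong, goal_cases)
    case (1 y)
    \<comment> \<open>Shifting \<open>x\<close> by \<open>y / c\<close> moves the dependence on
      \<open>y\<close> from \<open>B\<close> to \<open>F\<close>; evenness of \<open>B\<close>
      removes the sign.\<close>
    have "(\<integral>\<^sup>+x. F (c * x) * B (- (c * x) + y) \<partial>lborel)
      = (\<integral>\<^sup>+x. F (c * (y / c + x)) * B (- (c * (y / c + x)) + y) \<partial>lborel)"
      by (rule nn_integral_lborel_translate[symmetric]) measurable
    also have "\<dots> = (\<integral>\<^sup>+x. F (y + c * x) * B (c * x) \<partial>lborel)"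
      using c by (intro nn_integral_cong) (simp add: distrib_left)
    finally show ?case .
  qed
  also have "\<dots> = (\<integral>\<^sup>+x. (\<integral>\<^sup>+y. F (y + c * x) * B (c * x) \<partial>lborel) \<partial>lborel)"
    by (rule lborel_pair.Fubini'[symmetric]) measurable
  also have "\<dots> = (\<integral>\<^sup>+x. (\<integral>\<^sup>+y. F y \<partial>lborel) * B (c * x) \<partial>lborel)"
  proof (rule nn_integral_cong, goal_cases)
    case (1 x)
    have "(\<integral>\<^sup>+y. F (y + c * x) * B (c * x) \<partial>lborel) = (\<integral>\<^sup>+y. F (y + c * x) \<partial>lborel) * B (c * x)"
      by (rule nn_integral_multc) measurable
    also have "(\<integral>\<^sup>+y. F (y + c * x) \<partial>lborel) = (\<integral>\<^sup>+y. F y \<partial>lborel)"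
      using nn_integral_lborel_translate[of F "c * x"] by (simp add: add.commute)
    finally show ?case .
  qed
  also have "\<dots> = (\<integral>\<^sup>+y. F y \<partial>lborel) * (\<integral>\<^sup>+x. B (c * x) \<partial>lborel)"
    by (rule nn_integral_cmult) measurable
  \<comment> \<open>The scaling constant is now the volume of a ball of radius
    \<open>1 / norm c\<close> relative to the unit ball.\<close>
  also have "(\<lambda>x. B (c * x)) = indicator (ball 0 (1 / norm c))"
    using c by (auto simp: B_def indicator_def norm_mult field_simps)
  also have "integral\<^sup>N lborel (indicator (ball (0::'a) (1 / norm c))) = ennreal (unit_ball_vol (real DIM('a)) * (1 / norm c) ^ DIM('a))"
    using c by (simp add: emeasure_ball)
  also have "\<dots> = ennreal (norm c powr - real DIM('a)) * V"
    using c by (simp add: V powr_minus powr_realpow ennreal_mult[symmetric] power_divide field_simps)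
  finally have "V * (\<integral>\<^sup>+x. F (c * x) \<partial>lborel) = V * (ennreal (norm c powr - real DIM('a)) * (\<integral>\<^sup>+x. F x \<partial>lborel))"
    by (simp add: ac_simps)
  then show ?thesis using V0 by (simp add: ennreal_mult_cancel_left)
qed

lemma nn_integral_lborel_affine:
  fixes F :: "'a::{real_normed_field,euclidean_space} \<Rightarrow> ennreal"
  assumes [measurable]: "F \<in> borel_measurable borel" and c: "c \<noteq> 0"
  shows "(\<integral>\<^sup>+x. F (t + c * x) \<partial>lborel) = ennreal (norm c powr - real DIM('a)) * (\<integral>\<^sup>+x. F x \<partial>lborel)"
proof -
  have "(\<integral>\<^sup>+x. F (t + c * x) \<partial>lborel) = ennreal (norm c powr - real DIM('a)) * (\<integral>\<^sup>+x. F (t + x) \<partial>lborel)"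
    by (rule nn_integral_lborel_mult[OF _ c, of "\<lambda>x. F (t + x)"]) measurable
  then show ?thesis by (simp add: nn_integral_lborel_translate)
qed

section \<open>Coordinates on the affine group\<close>

definition aff :: "'a::field \<Rightarrow> 'a \<Rightarrow> 'a ^ 2 ^ 2" where
  "aff b a = (\<chi> i j. if i = 1 then (if j = 1 then a else b) else (if j = 1 then 0 else 1))"

lemma aff_nth [simp]: "aff b a $ 1 $ 1 = a" "aff b a $ 1 $ 2 = b" "aff b a $ 2 $ 1 = 0" "aff b a $ 2 $ 2 = 1"
  by (simp_all add: aff_def)

lemma aff_eq_iff: "A = aff b a \<longleftrightarrow> A $ 1 $ 1 = a \<and> A $ 1 $ 2 = b \<and> A $ 2 $ 1 = 0 \<and> A $ 2 $ 2 = 1"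
  by (auto simp: vec_eq_iff forall_2)

lemma aff_in_carrier [simp]: "aff b a \<in> carrier affine_group \<longleftrightarrow> a \<noteq> 0"
  by (simp add: affine_group_def)

lemma carrier_affE:
  assumes "x \<in> carrier affine_group"
  obtains b a where "x = aff b a" "a \<noteq> 0"
  using assms by (auto simp: affine_group_def aff_eq_iff)

lemma aff_mult: "aff \<beta> \<alpha> ** aff b a = aff (\<beta> + \<alpha> * b) (\<alpha> * a)"
  by (simp add: aff_eq_iff matrix_matrix_mult_def sum_2)

lemma aff_mult': "aff \<beta> \<alpha> \<otimes>\<^bsub>affine_group\<^esub> aff b a = aff (\<beta> + \<alpha> * b) (\<alpha> * a)"
  by (simp add: affine_group_def aff_mult)

lemma aff_inv: "a \<noteq> 0 \<Longrightarrow> inv\<^bsub>affine_group\<^esub> (aff b a) = aff (- (b / a)) (1 / a)"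
  by (rule group.inv_equality[OF group_affine_group])
    (simp_all add: aff_mult', simp add: affine_group_def vec_eq_iff forall_2 mat_def)

lemma continuous_on_aff [continuous_intros]:
  fixes f g :: "_ \<Rightarrow> 'a::{real_normed_field,euclidean_space}"
  assumes "continuous_on S f" "continuous_on S g"
  shows "continuous_on S (\<lambda>x. aff (f x) (g x))"
proof -
  have "continuous_on S (\<lambda>x. if i = 1 then (if j = 1 then g x else f x) else (if j = 1 then 0 else 1))" for i j :: 2
    by (cases "i = 1"; cases "j = 1") (simp_all add: assms)
  then show ?thesis unfolding aff_def by (intro continuous_on_vec_lambda)
qed

lemma measurable_aff [measurable (raw)]:
  fixes f g :: "_ \<Rightarrow> 'a::{real_normed_field,euclidean_space}"
  assumes [measurable]: "f \<in> borel_measurable M" "g \<in> borel_measurable M"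
  shows "(\<lambda>x. aff (f x) (g x)) \<in> borel_measurable M"
proof -
  have "(\<lambda>z. aff (fst z) (snd z) :: 'a ^ 2 ^ 2) \<in> borel_measurable borel"
    by (intro borel_measurable_continuous_onI continuous_intros)
  then have "(\<lambda>z. aff (fst z) (snd z) :: 'a ^ 2 ^ 2) \<in> borel \<Otimes>\<^sub>M borel \<rightarrow>\<^sub>M borel" by (simp add: borel_prod)
  from measurable_compose[OF measurable_Pair[OF assms] this] show ?thesis by simp
qed

lemma measurable_vec_nth [measurable (raw)]:
  fixes f :: "_ \<Rightarrow> 'a::euclidean_space ^ 'n"
  assumes "f \<in> borel_measurable M"
  shows "(\<lambda>x. f x $ i) \<in> borel_measurable M"
proof -
  have "(\<lambda>v :: 'a ^ 'n. v $ i) \<in> borel_measurable borel"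
    by (intro borel_measurable_continuous_onI continuous_intros)
  from measurable_compose[OF assms this] show ?thesis .
qed

lemma measurable_matrix_mult [measurable (raw)]:
  fixes f g :: "_ \<Rightarrow> 'a::{real_normed_field,euclidean_space} ^ 2 ^ 2"
  assumes "f \<in> borel_measurable M" "g \<in> borel_measurable M"
  shows "(\<lambda>x. f x ** g x) \<in> borel_measurable M"
proof -
  have "(\<lambda>z. fst z ** snd z :: 'a ^ 2 ^ 2) \<in> borel_measurable borel"
    unfolding matrix_matrix_mult_def
    by (intro borel_measurable_continuous_onI continuous_intros)
  then have "(\<lambda>z. fst z ** snd z :: 'a ^ 2 ^ 2) \<in> borel \<Otimes>\<^sub>M borel \<rightarrow>\<^sub>M borel" by (simp add: borel_prod)
  from measurable_compose[OF measurable_Pair[OF assms] this] show ?thesis by simp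
qed

text \<open>A closed set intersected with an open one, which is the form that yields local
  compactness inside the space of all matrices.\<close>

lemma carrier_affine_eq:
  "carrier (affine_group :: ('a::{real_normed_field,euclidean_space} ^ 2 ^ 2) monoid)
    = {A. A $ 2 $ 1 = 0 \<and> A $ 2 $ 2 = 1} \<inter> {A. A $ 1 $ 1 \<noteq> 0}"
  by (auto simp: affine_group_def)

lemma closed_affine: "closed {A :: 'a::{real_normed_field,euclidean_space} ^ 2 ^ 2. A $ 2 $ 1 = 0 \<and> A $ 2 $ 2 = 1}"
  by (intro closed_Collect_conj closed_Collect_eq continuous_intros)

lemma open_affine: "open {A :: 'a::{real_normed_field,euclidean_space} ^ 2 ^ 2. A $ 1 $ 1 \<noteq> 0}"
  by (intro open_Collect_neq continuous_intros)

lemma locally_compact_affine: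
  "locally compact (carrier (affine_group :: ('a::{real_normed_field,euclidean_space} ^ 2 ^ 2) monoid))"
  unfolding carrier_affine_eq
  by (intro locally_compact_Int closed_imp_locally_compact open_imp_locally_compact closed_affine open_affine)

lemma compact_aff_image:
  fixes A B :: "'a::{real_normed_field,euclidean_space} set"
  assumes "compact A" "compact B"
  shows "compact ((\<lambda>z. aff (fst z) (snd z)) ` (A \<times> B))"
  by (intro compact_continuous_image compact_Times assms continuous_intros)

lemma haar_measurable_id:
  assumes "left_haar_measure G \<mu>"
  shows "(\<lambda>x. x) \<in> borel_measurable \<mu>"
proof -
  have "(\<lambda>x. x) \<in> restrict_space borel (carrier G) \<rightarrow>\<^sub>M borel"
    by (rule measurable_restrict_space1) simp
  then show ?thesis using assms
    by (simp add: left_haar_measure_def measurable_def space_restrict_space)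
qed

lemma measurable_into_haar:
  assumes haar: "left_haar_measure G \<mu>"
    and f: "f \<in> borel_measurable N" "\<And>x. x \<in> space N \<Longrightarrow> f x \<in> carrier G"
  shows "f \<in> N \<rightarrow>\<^sub>M \<mu>"
proof -
  have "f \<in> N \<rightarrow>\<^sub>M restrict_space borel (carrier G)"
    using f by (intro measurable_restrict_space2) auto
  then show ?thesis using haar
    by (simp add: left_haar_measure_def measurable_def space_restrict_space)
qed

lemma affine_haar_group:
  fixes \<mu> :: "('a::{real_normed_field,euclidean_space} ^ 2 ^ 2) measure"
  assumes haar: "left_haar_measure affine_group \<mu>"
  shows "haar_group affine_group \<mu>"
proof -
  let ?G = "affine_group :: ('a ^ 2 ^ 2) monoid"
  note hsp = haar_space[OF haar]
  note id [measurable] = haar_measurable_id[OF haar]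
  interpret group ?G by (rule group_affine_group)
  show ?thesis
  proof (intro haar_group.intro left_invariant_measure.intro haar_group_axioms.intro left_invariant_measure_axioms.intro)
    show "group ?G" by (rule group_affine_group)
    show "sigma_finite_measure \<mu>"
    proof
      \<comment> \<open>A compact exhaustion of the group. A ball around \<open>a = 0\<close> is
        removed so that each \<open>K n\<close> is compact within the carrier, hence of finite
        measure.\<close>
      define K where "K n = (\<lambda>z. aff (fst z) (snd z) :: 'a ^ 2 ^ 2) ` (cball 0 (real n) \<times> (cball 0 (real n) - ball 0 (1 / (real n + 1))))" for n
      have cK: "compact (K n)" for n
        unfolding K_def by (intro compact_aff_image compact_cball compact_diff) auto
      have sK: "K n \<subseteq> carrier ?G" for n
        unfolding K_def by auto
      show "\<exists>A. countable A \<and> A \<subseteq> sets \<mu> \<and> \<Union> A = space \<mu> \<and> (\<forall>a\<in>A. emeasure \<mu> a \<noteq> \<infinity>)"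
      proof (intro exI[of _ "range K"] conjI ballI)
        show "range K \<subseteq> sets \<mu>"
          using cK sK by (auto intro!: haar_borel_sets[OF haar] borel_compact)
        show "\<Union> (range K) = space \<mu>"
        proof (intro equalityI subsetI)
          fix x assume "x \<in> space \<mu>"
          then obtain b a where x: "x = aff b a" "a \<noteq> 0" unfolding hsp by (rule carrier_affE)
          obtain n where n: "norm b + norm a + 1 / norm a < real n" using reals_Archimedean2 by blast
          have p: "0 < 1 / norm a" using x by simp
          have "norm b \<le> real n" "norm a \<le> real n" using n p norm_ge_zero[of a] norm_ge_zero[of b] by linarith+
          moreover have "1 / norm a \<le> real n + 1" using n norm_ge_zero[of a] norm_ge_zero[of b] by linarith
          then have "1 / (real n + 1) \<le> norm a" using x by (simp add: field_simps)
          ultimately have "x \<in> K n" unfolding K_def x by (intro image_eqI[of _ _ "(b, a)"]) auto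
          then show "x \<in> \<Union> (range K)" by blast
        qed (use sK hsp in auto)
        fix A assume "A \<in> range K"
        then obtain n where "A = K n" by blast
        then show "emeasure \<mu> A \<noteq> \<infinity>" using haar_compact_finite[OF haar cK[of n] sK[of n]] by simp
      qed auto
    qed
    show "space \<mu> = carrier ?G" by (rule hsp)
    show "(\<lambda>z. fst z \<otimes>\<^bsub>?G\<^esub> snd z) \<in> \<mu> \<Otimes>\<^sub>M \<mu> \<rightarrow>\<^sub>M \<mu>"
    proof (rule measurable_into_haar[OF haar])
      have "(\<lambda>z. fst z ** snd z) \<in> \<mu> \<Otimes>\<^sub>M \<mu> \<rightarrow>\<^sub>M borel"
        using measurable_compose[OF measurable_fst id] measurable_compose[OF measurable_snd id]
        by (intro measurable_matrix_mult)
      then show "(\<lambda>z. fst z \<otimes>\<^bsub>?G\<^esub> snd z) \<in> \<mu> \<Otimes>\<^sub>M \<mu> \<rightarrow>\<^sub>M borel" by (simp add: affine_group_def)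
      show "fst z \<otimes>\<^bsub>?G\<^esub> snd z \<in> carrier ?G" if "z \<in> space (\<mu> \<Otimes>\<^sub>M \<mu>)" for z
        using that by (auto simp: space_pair_measure hsp)
    qed
    show "(\<lambda>x. inv\<^bsub>?G\<^esub> x) \<in> \<mu> \<rightarrow>\<^sub>M \<mu>"
    proof (rule measurable_into_haar[OF haar])
      have "(\<lambda>x. aff (- (x $ 1 $ 2 / x $ 1 $ 1)) (1 / x $ 1 $ 1)) \<in> borel_measurable \<mu>"
        by measurable
      moreover have "inv\<^bsub>?G\<^esub> x = aff (- (x $ 1 $ 2 / x $ 1 $ 1)) (1 / x $ 1 $ 1)" if "x \<in> space \<mu>" for x
        using that unfolding hsp by (elim carrier_affE) (simp add: aff_inv)
      ultimately show "(\<lambda>x. inv\<^bsub>?G\<^esub> x) \<in> borel_measurable \<mu>"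
        by (subst measurable_cong) 
      show "inv\<^bsub>?G\<^esub> x \<in> carrier ?G" if "x \<in> space \<mu>" for x using that by (simp add: hsp)
    qed
    show "emeasure \<mu> ((\<lambda>x. g \<otimes>\<^bsub>?G\<^esub> x) ` A) = emeasure \<mu> A" if "g \<in> carrier ?G" "A \<in> sets \<mu>" for g A
      using haar that by (simp add: left_haar_measure_def)
    show "\<exists>g\<in>Cc ?G. integrable \<mu> g \<and> (\<integral>x. norm (f x - g x) \<partial>\<mu>) < \<epsilon>" if "integrable \<mu> f" "0 < \<epsilon>" for f \<epsilon>
      using Cc_dense_in_L1[OF haar locally_compact_affine that] Cc_integrable[OF haar] by blast
  qed
qed

section \<open>Haar measure in coordinates\<close>

text \<open>Integration against the explicit left Haar measure. Left translation by
  \<open>aff \<beta> \<alpha>\<close> scales both \<open>b\<close> and \<open>a\<close> by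
  \<open>\<alpha>\<close>, each with a Jacobian of exponent d, hence the weight of exponent
  \<open>- 2 * d\<close>. At \<open>a = 0\<close> the weight is 0 by the convention for
  \<open>powr\<close>, so points outside the group do not contribute.\<close>

definition aff_integral :: "('a::{real_normed_field,euclidean_space} ^ 2 ^ 2 \<Rightarrow> ennreal) \<Rightarrow> ennreal" where
  "aff_integral F = (\<integral>\<^sup>+a. (\<integral>\<^sup>+b. F (aff b a) \<partial>lborel) * ennreal (norm a powr (- 2 * real DIM('a))) \<partial>lborel)"

lemma aff_integral_left_mult:
  fixes F :: "'a::{real_normed_field,euclidean_space} ^ 2 ^ 2 \<Rightarrow> ennreal"
  assumes [measurable]: "F \<in> borel_measurable borel" and \<alpha>: "\<alpha> \<noteq> 0"
  shows "aff_integral (\<lambda>y. F (aff \<beta> \<alpha> ** y)) = aff_integral F"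
proof -
  let ?d = "real DIM('a)"
  define J where "J a = (\<integral>\<^sup>+b. F (aff b a) \<partial>lborel) * ennreal (norm a powr (- 2 * ?d))" for a
  have [measurable]: "J \<in> borel_measurable borel" unfolding J_def by measurable
  have "aff_integral (\<lambda>y. F (aff \<beta> \<alpha> ** y)) = (\<integral>\<^sup>+a. ennreal (norm \<alpha> powr ?d) * J (\<alpha> * a) \<partial>lborel)"
    unfolding aff_integral_def
  proof (rule nn_integral_cong, goal_cases)
    case (1 a)
    have "(\<integral>\<^sup>+b. F (aff \<beta> \<alpha> ** aff b a) \<partial>lborel) = ennreal (norm \<alpha> powr - ?d) * (\<integral>\<^sup>+b. F (aff b (\<alpha> * a)) \<partial>lborel)"
      unfolding aff_mult by (rule nn_integral_lborel_affine[OF _ \<alpha>, of "\<lambda>b. F (aff b (\<alpha> * a))"]) measurable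
    moreover have "norm \<alpha> powr - ?d * norm a powr (- 2 * ?d) = norm \<alpha> powr ?d * norm (\<alpha> * a) powr (- 2 * ?d)"
    proof -
      have "norm \<alpha> powr ?d * norm \<alpha> powr (- 2 * ?d) = norm \<alpha> powr - ?d"
        by (simp add: powr_add[symmetric])
      then show ?thesis by (simp only: norm_mult powr_mult mult.assoc[symmetric])
    qed
    then have "ennreal (norm \<alpha> powr - ?d) * ennreal (norm a powr (- 2 * ?d)) = ennreal (norm \<alpha> powr ?d) * ennreal (norm (\<alpha> * a) powr (- 2 * ?d))"
      by (simp add: ennreal_mult[symmetric])
    moreover have "(u * z) * w = v * (z * w')" if "u * w = v * w'" for u w v w' z :: ennreal
      using that by (metis mult.assoc mult.commute)
    ultimately show ?case
      by (simp add: J_def)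
  qed
  also have "\<dots> = ennreal (norm \<alpha> powr ?d) * (\<integral>\<^sup>+a. J (\<alpha> * a) \<partial>lborel)"
    by (rule nn_integral_cmult) measurable
  also have "(\<integral>\<^sup>+a. J (\<alpha> * a) \<partial>lborel) = ennreal (norm \<alpha> powr - ?d) * (\<integral>\<^sup>+a. J a \<partial>lborel)"
    by (rule nn_integral_lborel_mult[OF _ \<alpha>]) measurable
  also have "ennreal (norm \<alpha> powr ?d) * (ennreal (norm \<alpha> powr - ?d) * (\<integral>\<^sup>+a. J a \<partial>lborel)) = (\<integral>\<^sup>+a. J a \<partial>lborel)"
    using \<alpha> by (simp add: mult.assoc[symmetric] ennreal_mult[symmetric] powr_add[symmetric])
  finally show ?thesis by (simp add: aff_integral_def J_def)
qed

text \<open>Right translation merely shifts \<open>b\<close> and scales only \<open>a\<close>, so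
  one factor of exponent d survives: the modular function, up to inversion.\<close>

lemma aff_integral_right_mult:
  fixes F :: "'a::{real_normed_field,euclidean_space} ^ 2 ^ 2 \<Rightarrow> ennreal"
  assumes [measurable]: "F \<in> borel_measurable borel" and \<alpha>: "\<alpha> \<noteq> 0"
  shows "aff_integral (\<lambda>y. F (y ** aff \<beta> \<alpha>)) = ennreal (norm \<alpha> powr real DIM('a)) * aff_integral F"
proof -
  let ?d = "real DIM('a)"
  define J where "J a = (\<integral>\<^sup>+b. F (aff b a) \<partial>lborel) * ennreal (norm a powr (- 2 * ?d))" for a
  have [measurable]: "J \<in> borel_measurable borel" unfolding J_def by measurable
  have "aff_integral (\<lambda>y. F (y ** aff \<beta> \<alpha>)) = (\<integral>\<^sup>+a. ennreal (norm \<alpha> powr (2 * ?d)) * J (\<alpha> * a) \<partial>lborel)"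
    unfolding aff_integral_def
  proof (rule nn_integral_cong, goal_cases)
    case (1 a)
    have "(\<integral>\<^sup>+b. F (aff b a ** aff \<beta> \<alpha>) \<partial>lborel) = (\<integral>\<^sup>+b. F (aff (a * \<beta> + b) (\<alpha> * a)) \<partial>lborel)"
      by (simp add: aff_mult ac_simps)
    also have "\<dots> = (\<integral>\<^sup>+b. F (aff b (\<alpha> * a)) \<partial>lborel)"
      by (rule nn_integral_lborel_translate) measurable
    finally have "(\<integral>\<^sup>+b. F (aff b a ** aff \<beta> \<alpha>) \<partial>lborel) = (\<integral>\<^sup>+b. F (aff b (\<alpha> * a)) \<partial>lborel)" .
    moreover have "norm a powr (- 2 * ?d) = norm \<alpha> powr (2 * ?d) * norm (\<alpha> * a) powr (- 2 * ?d)"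
    proof -
      have "norm \<alpha> powr (2 * ?d) * norm \<alpha> powr (- 2 * ?d) = 1"
        using \<alpha> by (simp add: powr_add[symmetric])
      then show ?thesis by (simp only: norm_mult powr_mult mult.assoc[symmetric] mult_1_left)
    qed
    then have "ennreal (norm a powr (- 2 * ?d)) = ennreal (norm \<alpha> powr (2 * ?d)) * ennreal (norm (\<alpha> * a) powr (- 2 * ?d))"
      by (simp add: ennreal_mult[symmetric])
    ultimately show ?case
      by (simp only: J_def ac_simps)
  qed
  also have "\<dots> = ennreal (norm \<alpha> powr (2 * ?d)) * (\<integral>\<^sup>+a. J (\<alpha> * a) \<partial>lborel)"
    by (rule nn_integral_cmult) measurable
  also have "(\<integral>\<^sup>+a. J (\<alpha> * a) \<partial>lborel) = ennreal (norm \<alpha> powr - ?d) * (\<integral>\<^sup>+a. J a \<partial>lborel)"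
    by (rule nn_integral_lborel_mult[OF _ \<alpha>]) measurable
  also have "ennreal (norm \<alpha> powr (2 * ?d)) * (ennreal (norm \<alpha> powr - ?d) * (\<integral>\<^sup>+a. J a \<partial>lborel)) = ennreal (norm \<alpha> powr ?d) * (\<integral>\<^sup>+a. J a \<partial>lborel)"
    using \<alpha> by (simp add: mult.assoc[symmetric] ennreal_mult[symmetric] powr_add[symmetric])
  finally show ?thesis by (simp add: aff_integral_def J_def)
qed

lemma haar_measurable_borel:
  assumes "left_haar_measure G \<mu>" "X \<in> N \<rightarrow>\<^sub>M \<mu>"
  shows "X \<in> borel_measurable N"
  using measurable_compose[OF assms(2) haar_measurable_id[OF assms(1)]] by simp

text \<open>The kernels \<open>T\<close> and \<open>S\<close> are variables with defining equations,
  so that the lemma can be declared as a measurability rule for the kernels defined in the next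
  proof.\<close>

lemma haar_measurable_kernels:
  fixes \<mu> :: "('a::{real_normed_field,euclidean_space} ^ 2 ^ 2) measure"
  assumes haar: "left_haar_measure affine_group \<mu>"
    and F: "F \<in> borel_measurable borel" and g: "g \<in> borel_measurable borel"
    and T: "\<And>x b a. T x b a = (F x * g (inv\<^bsub>affine_group\<^esub> x ** aff b a) :: ennreal)"
    and S: "\<And>x b a. S x b a = (F (aff b a ** x) * g (inv\<^bsub>affine_group\<^esub> x) :: ennreal)"
    and X: "X \<in> N \<rightarrow>\<^sub>M \<mu>" and B: "B \<in> borel_measurable N" and A: "A \<in> borel_measurable N"
  shows "(\<lambda>q. T (X q) (B q) (A q)) \<in> borel_measurable N" "(\<lambda>q. S (X q) (B q) (A q)) \<in> borel_measurable N"
proof -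
  interpret haar_group affine_group \<mu> by (rule affine_haar_group) fact
  note X' = haar_measurable_borel[OF haar X]
  note I = haar_measurable_borel[OF haar inv_measurable'[OF X]]
  note M = measurable_aff[OF B A]
  show "(\<lambda>q. T (X q) (B q) (A q)) \<in> borel_measurable N"
    unfolding T by (intro borel_measurable_times_ennreal measurable_compose[OF X' F]
      measurable_compose[OF measurable_matrix_mult[OF I M] g])
  show "(\<lambda>q. S (X q) (B q) (A q)) \<in> borel_measurable N"
    unfolding S by (intro borel_measurable_times_ennreal measurable_compose[OF I g]
      measurable_compose[OF measurable_matrix_mult[OF M X'] F])
qed

text \<open>The classical argument for uniqueness of Haar measure: the double integral of
  \<open>F x * g (inv x \<otimes> y)\<close>, with \<open>y\<close> integrated by
  \<open>aff_integral\<close>, is evaluated in two ways. Left invariance in \<open>y\<close> gives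
  the left-hand side. Replacing \<open>x\<close> by \<open>y \<otimes> x\<close> gives
  \<open>F (y \<otimes> x) * g (inv x)\<close>, and the integral over \<open>y\<close> is then a
  right translate, which contributes the power of the norm.\<close>

lemma haar_times_aff_integral:
  fixes \<mu> :: "('a::{real_normed_field,euclidean_space} ^ 2 ^ 2) measure"
  assumes haar: "left_haar_measure affine_group \<mu>"
    and F [measurable]: "F \<in> borel_measurable borel" and g [measurable]: "g \<in> borel_measurable borel"
  shows "(\<integral>\<^sup>+x. F x \<partial>\<mu>) * aff_integral g
    = (\<integral>\<^sup>+x. g (inv\<^bsub>affine_group\<^esub> x) * ennreal (norm (x $ 1 $ 1) powr real DIM('a)) \<partial>\<mu>) * aff_integral F"
proof -
  let ?G = "affine_group :: ('a ^ 2 ^ 2) monoid"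
  let ?F = "\<lambda>x a. (\<integral>\<^sup>+b. F (aff b a ** x) \<partial>lborel)"
  interpret haar_group ?G \<mu> by (rule affine_haar_group) fact
  interpret ml: pair_sigma_finite \<mu> "lborel :: 'a measure" ..
  note id [measurable] = haar_measurable_id[OF haar]
  let ?d = "real DIM('a)"
  define w where "w a = ennreal (norm a powr (- 2 * ?d))" for a :: 'a
  have [measurable]: "w \<in> borel_measurable borel" unfolding w_def by measurable
  define T where "T x b a = F x * g (inv\<^bsub>?G\<^esub> x ** aff b a)" for x b a
  define S where "S x b a = F (aff b a ** x) * g (inv\<^bsub>?G\<^esub> x)" for x b a
  note [measurable (raw)] = haar_measurable_kernels[OF haar F g T_def S_def]
  have [measurable]: "F \<in> borel_measurable \<mu>" by (rule measurable_compose[OF id F])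
  have [measurable]: "(\<lambda>x. g (inv\<^bsub>?G\<^esub> x)) \<in> borel_measurable \<mu>"
    by (rule measurable_compose[OF measurable_compose[OF inv_measurable id] g])
  have "(\<integral>\<^sup>+x. F x \<partial>\<mu>) * aff_integral g = (\<integral>\<^sup>+x. F x * aff_integral g \<partial>\<mu>)"
    by (rule nn_integral_multc[symmetric]) measurable
  also have "\<dots> = (\<integral>\<^sup>+x. (\<integral>\<^sup>+a. (\<integral>\<^sup>+b. T x b a \<partial>lborel) * w a \<partial>lborel) \<partial>\<mu>)"
  proof (rule nn_integral_cong, goal_cases)
    case (1 x)
    then obtain \<beta> \<alpha> where x: "x = aff \<beta> \<alpha>" "\<alpha> \<noteq> 0" unfolding space_eq by (rule carrier_affE)
    have "aff_integral g = aff_integral (\<lambda>y. g (inv\<^bsub>?G\<^esub> x ** y))"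
      using x by (simp add: aff_inv aff_integral_left_mult)
    then have "F x * aff_integral g = F x * (\<integral>\<^sup>+a. (\<integral>\<^sup>+b. g (inv\<^bsub>?G\<^esub> x ** aff b a) \<partial>lborel) * w a \<partial>lborel)"
      by (simp add: aff_integral_def w_def)
    also have "\<dots> = (\<integral>\<^sup>+a. F x * ((\<integral>\<^sup>+b. g (inv\<^bsub>?G\<^esub> x ** aff b a) \<partial>lborel) * w a) \<partial>lborel)"
      by (rule nn_integral_cmult[symmetric]) measurable
    also have "\<dots> = (\<integral>\<^sup>+a. (\<integral>\<^sup>+b. T x b a \<partial>lborel) * w a \<partial>lborel)"
    proof (rule nn_integral_cong, goal_cases)
      case (1 a)
      have "(\<integral>\<^sup>+b. T x b a \<partial>lborel) = F x * (\<integral>\<^sup>+b. g (inv\<^bsub>?G\<^esub> x ** aff b a) \<partial>lborel)"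
        unfolding T_def by (rule nn_integral_cmult) measurable
      then show ?case
        by (simp add: mult.assoc)
    qed
    finally show ?case .
  qed
  also have "\<dots> = (\<integral>\<^sup>+a. (\<integral>\<^sup>+x. (\<integral>\<^sup>+b. T x b a \<partial>lborel) * w a \<partial>\<mu>) \<partial>lborel)"
    by (rule ml.Fubini'[symmetric]) measurable
  also have "\<dots> = (\<integral>\<^sup>+a. (\<integral>\<^sup>+x. (\<integral>\<^sup>+b. S x b a \<partial>lborel) * w a \<partial>\<mu>) \<partial>lborel)"
  proof (rule nn_integral_cong, goal_cases)
    case (1 a)
    \<comment> \<open>Replacing \<open>x\<close> by \<open>aff b a \<otimes> x\<close> requires
      \<open>a \<noteq> 0\<close>; for \<open>a = 0\<close> the weight \<open>w\<close>
      vanishes.\<close>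
    show ?case
    proof (cases "a = 0")
      case False
      have "(\<integral>\<^sup>+x. (\<integral>\<^sup>+b. T x b a \<partial>lborel) \<partial>\<mu>) = (\<integral>\<^sup>+b. (\<integral>\<^sup>+x. T x b a \<partial>\<mu>) \<partial>lborel)"
        by (rule ml.Fubini'[symmetric]) measurable
      also have "\<dots> = (\<integral>\<^sup>+b. (\<integral>\<^sup>+x. S x b a \<partial>\<mu>) \<partial>lborel)"
      proof (rule nn_integral_cong, goal_cases)
        case (1 b)
        have y: "aff b a \<in> carrier ?G" using False by simp
        have "(\<integral>\<^sup>+x. T x b a \<partial>\<mu>) = (\<integral>\<^sup>+x. T (aff b a \<otimes>\<^bsub>?G\<^esub> x) b a \<partial>\<mu>)"
          by (rule nn_integral_left_mult[OF _ y, of "\<lambda>x. T x b a", symmetric]) measurable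
        also have "\<dots> = (\<integral>\<^sup>+x. S x b a \<partial>\<mu>)"
        proof (rule nn_integral_cong, goal_cases)
          case (1 x)
          then have x: "x \<in> carrier ?G" by (simp add: space_eq)
          have "inv\<^bsub>?G\<^esub> (aff b a \<otimes>\<^bsub>?G\<^esub> x) \<otimes>\<^bsub>?G\<^esub> aff b a = inv\<^bsub>?G\<^esub> x"
            using x y by (simp add: inv_mult_group m_assoc)
          then show ?case
            by (simp add: T_def S_def affine_group_def)
        qed
        finally show ?case .
      qed
      also have "\<dots> = (\<integral>\<^sup>+x. (\<integral>\<^sup>+b. S x b a \<partial>lborel) \<partial>\<mu>)"
        by (rule ml.Fubini') measurable
      finally show ?thesis
        by (subst (1 2) nn_integral_multc; measurable; simp)
    qed (simp add: w_def)
  qed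
  also have "\<dots> = (\<integral>\<^sup>+x. (\<integral>\<^sup>+a. (\<integral>\<^sup>+b. S x b a \<partial>lborel) * w a \<partial>lborel) \<partial>\<mu>)"
    by (rule ml.Fubini') measurable
  also have "\<dots> = (\<integral>\<^sup>+x. g (inv\<^bsub>?G\<^esub> x) * ennreal (norm (x $ 1 $ 1) powr ?d) * aff_integral F \<partial>\<mu>)"
  proof (rule nn_integral_cong, goal_cases)
    case (1 x)
    then obtain \<beta> \<alpha> where x: "x = aff \<beta> \<alpha>" "\<alpha> \<noteq> 0" unfolding space_eq by (rule carrier_affE)
    have "(\<integral>\<^sup>+a. (\<integral>\<^sup>+b. S x b a \<partial>lborel) * w a \<partial>lborel)
      = (\<integral>\<^sup>+a. g (inv\<^bsub>?G\<^esub> x) * (?F x a * w a) \<partial>lborel)"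
    proof (rule nn_integral_cong, goal_cases)
      case (1 a)
      have "(\<integral>\<^sup>+b. S x b a \<partial>lborel) = ?F x a * g (inv\<^bsub>?G\<^esub> x)"
        unfolding S_def by (rule nn_integral_multc) measurable
      then show ?case
        by (simp add: ac_simps)
    qed
    also have "\<dots> = g (inv\<^bsub>?G\<^esub> x) * (\<integral>\<^sup>+a. ?F x a * w a \<partial>lborel)"
      by (rule nn_integral_cmult) measurable
    also have "(\<integral>\<^sup>+a. ?F x a * w a \<partial>lborel) = aff_integral (\<lambda>y. F (y ** x))"
      by (simp add: aff_integral_def w_def)
    also have "\<dots> = ennreal (norm (x $ 1 $ 1) powr ?d) * aff_integral F"
      using x by (simp add: aff_integral_right_mult)
    finally show ?case by (simp add: mult.assoc)
  qed
  also have "\<dots> = (\<integral>\<^sup>+x. g (inv\<^bsub>?G\<^esub> x) * ennreal (norm (x $ 1 $ 1) powr ?d) \<partial>\<mu>) * aff_integral F"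
    by (rule nn_integral_multc) measurable
  finally show ?thesis .
qed

text \<open>In the preceding identity \<open>g\<close> is fixed as the indicator of a compact box of
  positive finite \<open>aff_integral\<close>; the quotient \<open>D / aff_integral g\<close> is
  then the constant. What remains is that it is neither 0 nor infinite.\<close>

lemma haar_eq_aff_integral:
  fixes \<mu> :: "('a::{real_normed_field,euclidean_space} ^ 2 ^ 2) measure"
  assumes haar: "left_haar_measure affine_group \<mu>"
  obtains C :: real where "0 < C"
    "\<And>F. F \<in> borel_measurable borel \<Longrightarrow> (\<integral>\<^sup>+x. F x \<partial>\<mu>) = ennreal C * aff_integral F"
proof -
  let ?d = "real DIM('a)"
  \<comment> \<open>The radius below 1 keeps \<open>a\<close> away from 0, so the weight lies
    between two positive constants on the box.\<close>
  let ?A = "cball 1 (1 / 2) :: 'a set" and ?B = "cball 0 1 :: 'a set"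
  define w where "w a = ennreal (norm a powr (- 2 * ?d))" for a :: 'a
  have [measurable]: "w \<in> borel_measurable borel" unfolding w_def by measurable
  define K where "K = (\<lambda>z. aff (fst z) (snd z)) ` (?B \<times> ?A)"
  define g :: "'a ^ 2 ^ 2 \<Rightarrow> ennreal" where "g = indicator K"
  have K: "compact K" unfolding K_def by (intro compact_aff_image) auto
  have annulus: "1 / 2 \<le> norm a" "norm a \<le> 3 / 2" if "a \<in> ?A" for a :: 'a
    using that norm_triangle_ineq3[of 1 a] by (auto simp: dist_norm)
  have KG: "K \<subseteq> carrier affine_group" unfolding K_def using annulus by fastforce
  have gm: "g \<in> borel_measurable borel" unfolding g_def by (rule borel_measurable_indicator) (rule borel_compact[OF K])
  have g_aff: "g (aff b a) = indicator ?B b * indicator ?A a" for b a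
  proof -
    have "aff b a \<in> K \<longleftrightarrow> b \<in> ?B \<and> a \<in> ?A"
      unfolding K_def by (auto simp: image_iff aff_eq_iff)
    then show ?thesis by (auto simp: g_def indicator_def)
  qed
  have [measurable]: "(indicator (cball c r) :: 'a \<Rightarrow> ennreal) \<in> borel_measurable borel" for c :: 'a and r
    by (rule borel_measurable_indicator) simp
  have pos: "emeasure lborel (cball c r) \<noteq> 0" if "0 < r" for c :: 'a and r
    using that by (simp add: emeasure_cball ennreal_eq_0_iff not_le)
  have "aff_integral g = (\<integral>\<^sup>+a. emeasure lborel ?B * (indicator ?A a * w a) \<partial>lborel)"
    unfolding aff_integral_def g_aff w_def by (subst nn_integral_multc) (simp_all add: mult.assoc)
  also have "\<dots> = emeasure lborel ?B * (\<integral>\<^sup>+a. indicator ?A a * w a \<partial>lborel)"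
    by (rule nn_integral_cmult) simp
  finally have Ng: "aff_integral g = emeasure lborel ?B * (\<integral>\<^sup>+a. indicator ?A a * w a \<partial>lborel)" .
  have "(\<integral>\<^sup>+a. indicator ?A a * w a \<partial>lborel) \<le> (\<integral>\<^sup>+a. indicator ?A a * ennreal ((1 / 2) powr (- 2 * ?d)) \<partial>lborel)"
    using annulus by (intro nn_integral_mono)
      (auto simp: indicator_def w_def intro!: ennreal_leI powr_mono2')
  also have "\<dots> = emeasure lborel ?A * ennreal ((1 / 2) powr (- 2 * ?d))"
    by (subst nn_integral_multc) simp_all
  also have "\<dots> < \<infinity>" by (simp add: ennreal_mult_less_top emeasure_lborel_cball_finite[unfolded infinity_ennreal_def])
  finally have fin: "aff_integral g < \<infinity>"
    unfolding Ng by (simp add: ennreal_mult_less_top emeasure_lborel_cball_finite[unfolded infinity_ennreal_def])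
  have "(\<integral>\<^sup>+a. indicator ?A a * ennreal ((3 / 2) powr (- 2 * ?d)) \<partial>lborel) \<le> (\<integral>\<^sup>+a. indicator ?A a * w a \<partial>lborel)"
  proof (rule nn_integral_mono, goal_cases)
    case (1 a)
    show ?case
      using annulus[of a] by (cases "a \<in> ?A") (auto simp: w_def intro!: ennreal_leI powr_mono2')
  qed
  moreover have "(\<integral>\<^sup>+a. indicator ?A a * ennreal ((3 / 2) powr (- 2 * ?d)) \<partial>lborel) = emeasure lborel ?A * ennreal ((3 / 2) powr (- 2 * ?d))"
    by (subst nn_integral_multc) simp_all
  moreover have "\<dots> \<noteq> 0" using pos[of "1/2" 1] by simp
  ultimately have "(\<integral>\<^sup>+a. indicator ?A a * w a \<partial>lborel) \<noteq> 0" by auto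
  then have nz: "aff_integral g \<noteq> 0" unfolding Ng using pos[of 1 0] by simp
  define D where "D = (\<integral>\<^sup>+x. g (inv\<^bsub>affine_group\<^esub> x) * ennreal (norm (x $ 1 $ 1) powr ?d) \<partial>\<mu>)"
  have main: "(\<integral>\<^sup>+x. F x \<partial>\<mu>) * aff_integral g = D * aff_integral F" if "F \<in> borel_measurable borel" for F
    unfolding D_def by (rule haar_times_aff_integral[OF haar that gm])
  have "(\<integral>\<^sup>+x. g x \<partial>\<mu>) = emeasure \<mu> K"
    using haar_borel_sets[OF haar borel_compact[OF K] KG] by (simp add: g_def)
  \<comment> \<open>The choice \<open>F = g\<close> identifies \<open>D\<close> with the measure of
    a compact set, which is finite.\<close>
  then have "emeasure \<mu> K * aff_integral g = D * aff_integral g" using main[OF gm] by simp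
  then have "emeasure \<mu> K = D"
    using nz fin by (metis ennreal_mult_cancel_left infinity_ennreal_def mult.commute less_irrefl)
  then have Dfin: "D < \<infinity>" using haar_compact_finite[OF haar K KG] by simp
  have "emeasure \<mu> (space \<mu>) \<noteq> 0"
    using haar unfolding haar_space[OF haar] left_haar_measure_def by blast
  then have "(\<integral>\<^sup>+x. 1 \<partial>\<mu>) \<noteq> 0" by simp
  \<comment> \<open>The choice \<open>F = 1\<close>: if \<open>D\<close> were 0, the measure would
    be 0.\<close>
  then have "D \<noteq> 0" using main[of "\<lambda>_. 1"] nz by auto
  define C where "C = enn2real (D / aff_integral g)"
  have q: "D / aff_integral g < \<infinity>" using Dfin nz by (simp add: ennreal_divide_eq_top_iff less_top[symmetric])
  have C: "ennreal C = D / aff_integral g" unfolding C_def using q by simp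
  have "0 < C"
    unfolding C_def enn2real_positive_iff using q \<open>D \<noteq> 0\<close> fin by (simp add: ennreal_divide_eq_0_iff ennreal_zero_less_divide zero_less_iff_neq_zero)
  moreover have "(\<integral>\<^sup>+x. F x \<partial>\<mu>) = ennreal C * aff_integral F" if "F \<in> borel_measurable borel" for F
  proof -
    have "(\<integral>\<^sup>+x. F x \<partial>\<mu>) = (\<integral>\<^sup>+x. F x \<partial>\<mu>) * aff_integral g / aff_integral g"
      using nz fin by (simp add: ennreal_mult_divide_eq)
    also have "\<dots> = ennreal C * aff_integral F"
      unfolding main[OF that] C by (simp add: ennreal_times_divide mult.commute)
    finally show ?thesis .
  qed
  ultimately show thesis by (rule that)
qed

section \<open>Gaussian and exponential densities\<close>

text \<open>This is \<open>pi powr (d / 2)\<close>, kept abstract since it only normalises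
  \<open>gauss\<close>.\<close>

definition gauss_mass :: "'a::euclidean_space itself \<Rightarrow> real" where
  "gauss_mass _ = enn2real (\<integral>\<^sup>+(y::'a). ennreal (exp (- (norm y)\<^sup>2)) \<partial>lborel)"

text \<open>The centred normal density with variance \<open>v / 2\<close> in each coordinate.
  Setting it to 0 for \<open>v \<le> 0\<close> lets integrals over the parameter \<open>v\<close>
  run over the whole line.\<close>

definition gauss :: "real \<Rightarrow> 'a::euclidean_space \<Rightarrow> real" where
  "gauss v b = (if 0 < v then v powr (- real DIM('a) / 2) * exp (- (norm b)\<^sup>2 / v) / gauss_mass TYPE('a) else 0)"

definition exp_density :: "real \<Rightarrow> real \<Rightarrow> real" where
  "exp_density w v = (if 0 < v then w * exp (- w * v) else 0)"

lemma nn_integral_exp_tail: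
  assumes "0 < (w::real)"
  shows "(\<integral>\<^sup>+v. ennreal (exp (- w * v)) * indicator {c..} v \<partial>lborel) = ennreal (exp (- w * c) / w)"
proof -
  have "(\<integral>\<^sup>+v. ennreal (exp (- w * v)) * indicator {c..} v \<partial>lborel) = ennreal (0 - (- exp (- w * c) / w))"
  proof (rule nn_integral_FTC_atLeast)
    show "((\<lambda>v. - exp (- w * v) / w) has_real_derivative exp (- w * v)) (at v)" for v
      using assms by (auto intro!: derivative_eq_intros)
    have "((\<lambda>v. exp (- (w * v))) \<longlongrightarrow> 0) at_top"
      using assms by (intro filterlim_compose[OF exp_at_bot] filterlim_compose[OF filterlim_uminus_at_bot_at_top]
        filterlim_tendsto_pos_mult_at_top[OF tendsto_const]) (auto intro: filterlim_ident)
    then have "((\<lambda>v. exp (- (w * v)) * (- 1 / w)) \<longlongrightarrow> 0 * (- 1 / w)) at_top"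
      by (intro tendsto_mult tendsto_const)
    then show "((\<lambda>v. - exp (- w * v) / w) \<longlongrightarrow> 0) at_top" by simp
  qed (use assms in auto)
  then show ?thesis by simp
qed

lemma nn_integral_exp_tail_open:
  assumes "0 < (w::real)"
  shows "(\<integral>\<^sup>+v. ennreal (exp (- w * v)) * indicator {c<..} v \<partial>lborel) = ennreal (exp (- w * c) / w)"
  unfolding nn_integral_exp_tail[OF assms, symmetric]
  by (rule nn_integral_cong_AE, use AE_lborel_singleton[of c] in eventually_elim) (auto simp: indicator_def)

lemma exp_density_measurable [measurable]: "(\<lambda>v. exp_density w v) \<in> borel_measurable borel"
  unfolding exp_density_def by measurable

lemma exp_density_nonneg: "0 \<le> w \<Longrightarrow> 0 \<le> exp_density w v"
  by (simp add: exp_density_def)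

lemma nn_integral_exp_density:
  assumes "0 < w"
  shows "(\<integral>\<^sup>+v. ennreal (exp_density w v) \<partial>lborel) = 1"
proof -
  have "(\<integral>\<^sup>+v. ennreal (exp_density w v) \<partial>lborel) = (\<integral>\<^sup>+v. ennreal w * (ennreal (exp (- w * v)) * indicator {0<..} v) \<partial>lborel)"
    using assms by (intro nn_integral_cong) (auto simp: exp_density_def indicator_def ennreal_mult)
  also have "\<dots> = ennreal w * ennreal (exp (- w * 0) / w)"
    by (subst nn_integral_cmult) (simp_all add: nn_integral_exp_tail_open[OF assms, of 0, simplified])
  also have "\<dots> = 1" using assms by (simp add: ennreal_mult[symmetric])
  finally show ?thesis .
qed

text \<open>In one variable, \<open>- x^2 \<le> 1 - \<bar>x\<bar>\<close> compares with a two-sided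
  exponential; the general case is a product over \<open>Basis\<close>.\<close>

lemma gauss_mass_finite: "(\<integral>\<^sup>+(y::'a::euclidean_space). ennreal (exp (- (norm y)\<^sup>2)) \<partial>lborel) < \<infinity>"
proof -
  let ?e = "\<lambda>(x :: real). ennreal (exp (- 1 * x)) * indicator {0..} x"
  have real: "(\<integral>\<^sup>+(x::real). ennreal (exp (- x\<^sup>2)) \<partial>lborel) < \<infinity>"
  proof -
    have "(\<integral>\<^sup>+(x::real). ennreal (exp (- x\<^sup>2)) \<partial>lborel)
      \<le> (\<integral>\<^sup>+(x::real). ennreal (exp 1) * (?e x) + ennreal (exp 1) * (ennreal (exp (- 1 * (- x))) * indicator {0..} (- x)) \<partial>lborel)"
    proof (rule nn_integral_mono, goal_cases)
      case (1 x)
      have "0 \<le> (\<bar>x\<bar> - 1)\<^sup>2 + \<bar>x\<bar>" by simp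
      then have "- x\<^sup>2 \<le> 1 - \<bar>x\<bar>" by (simp add: power2_eq_square algebra_simps)
      then have le: "exp (- x\<^sup>2) \<le> exp 1 * exp (- \<bar>x\<bar>)" by (simp add: exp_add[symmetric])
      show ?case
      proof (cases "0 \<le> x")
        case True
        have "ennreal (exp (- x\<^sup>2)) \<le> ennreal (exp 1) * ennreal (exp (- x))"
          using le True by (simp add: ennreal_mult[symmetric] ennreal_leI)
        then show ?thesis using True by (auto intro: add_increasing2)
      next
        case False
        have "ennreal (exp (- x\<^sup>2)) \<le> ennreal (exp 1) * ennreal (exp x)"
          using le False by (simp add: ennreal_mult[symmetric] ennreal_leI)
        then show ?thesis using False by (auto intro: add_increasing)
      qed
    qed
    also have "\<dots> = ennreal (exp 1) * (\<integral>\<^sup>+x. ?e x \<partial>lborel) + ennreal (exp 1) * (\<integral>\<^sup>+(x::real). ennreal (exp (- 1 * (- x))) * indicator {0..} (- x) \<partial>lborel)"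
      by (subst nn_integral_add, measurable, subst (1 2) nn_integral_cmult, measurable)
    also have "(\<integral>\<^sup>+(x::real). ennreal (exp (- 1 * (- x))) * indicator {0..} (- x) \<partial>lborel) = (\<integral>\<^sup>+x. ?e x \<partial>lborel)"
      using nn_integral_real_affine[of "\<lambda>x. ?e x" "-1" 0] by simp
    also have "(\<integral>\<^sup>+(x::real). ?e x \<partial>lborel) = ennreal 1"
      using nn_integral_exp_tail[of 1 0] by simp
    finally show ?thesis by (rule le_less_trans) (simp add: ennreal_mult_less_top)
  qed
  have "(\<integral>\<^sup>+(y::'a). ennreal (exp (- (norm y)\<^sup>2)) \<partial>lborel) = (\<integral>\<^sup>+(y::'a). (\<Prod>b\<in>Basis. ennreal (exp (- (y \<bullet> b)\<^sup>2))) \<partial>lborel)"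
  proof (rule nn_integral_cong, goal_cases)
    case (1 y)
    have "(norm y)\<^sup>2 = (\<Sum>b\<in>Basis. (y \<bullet> b)\<^sup>2)"
      unfolding power2_norm_eq_inner by (subst euclidean_inner) (simp add: power2_eq_square)
    then show ?case
      by (simp add: prod_ennreal sum_negf[symmetric] exp_sum)
  qed
  also have "\<dots> = (\<Prod>b\<in>(Basis::'a set). (\<integral>\<^sup>+x. ennreal (exp (- x\<^sup>2)) \<partial>lborel))"
    by (rule nn_integral_lborel_prod) auto
  also have "\<dots> < \<infinity>" using real by (simp add: power_less_top_ennreal)
  finally show ?thesis .
qed

lemma gauss_mass_pos: "0 < gauss_mass TYPE('a::euclidean_space)"
proof -
  have "(\<integral>\<^sup>+(y::'a). ennreal (exp (- (norm y)\<^sup>2)) \<partial>lborel) \<noteq> 0"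
  proof
    assume "(\<integral>\<^sup>+(y::'a). ennreal (exp (- (norm y)\<^sup>2)) \<partial>lborel) = 0"
    then have "AE y::'a in lborel. ennreal (exp (- (norm y)\<^sup>2)) = 0"
      by (subst (asm) nn_integral_0_iff_AE) auto
    then have "AE y::'a in lborel. False" by eventually_elim (simp add: ennreal_eq_0_iff not_le)
    then show False by (simp add: AE_iff_null null_sets_def)
  qed
  then show ?thesis
    using gauss_mass_finite[where 'a = 'a]
    by (simp add: gauss_mass_def enn2real_positive_iff zero_less_iff_neq_zero)
qed

lemma gauss_nonneg: "0 \<le> gauss v (b :: 'a::euclidean_space)"
  using gauss_mass_pos[where 'a = 'a] by (simp add: gauss_def)

lemma gauss_measurable [measurable (raw)]:
  fixes g :: "_ \<Rightarrow> 'a::euclidean_space"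
  assumes [measurable]: "f \<in> borel_measurable M" "g \<in> borel_measurable M"
  shows "(\<lambda>x. gauss (f x) (g x)) \<in> borel_measurable M"
  unfolding gauss_def by measurable

lemma nn_integral_exp_norm:
  fixes t :: "'a::{real_normed_field,euclidean_space}"
  assumes c: "0 < c"
  shows "(\<integral>\<^sup>+(y::'a). ennreal (exp (- c * (norm (y - t))\<^sup>2)) \<partial>lborel) = ennreal (c powr (- real DIM('a) / 2) * gauss_mass TYPE('a))"
proof -
  let ?s = "of_real (sqrt c) :: 'a"
  have s: "?s \<noteq> 0" using c by simp
  have "(\<integral>\<^sup>+(y::'a). ennreal (exp (- c * (norm (y - t))\<^sup>2)) \<partial>lborel) = (\<integral>\<^sup>+(y::'a). ennreal (exp (- (norm (- (?s * t) + ?s * y))\<^sup>2)) \<partial>lborel)"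
  proof (rule nn_integral_cong, goal_cases)
    case (1 y)
    have "- (?s * t) + ?s * y = ?s * (y - t)" by (simp add: algebra_simps)
    then show ?case
      using c by (simp add: norm_mult power_mult_distrib del: mult_eq_0_iff)
  qed
  also have "\<dots> = ennreal (norm ?s powr - real DIM('a)) * (\<integral>\<^sup>+(y::'a). ennreal (exp (- (norm y)\<^sup>2)) \<partial>lborel)"
    by (rule nn_integral_lborel_affine[OF _ s]) measurable
  also have "(\<integral>\<^sup>+(y::'a). ennreal (exp (- (norm y)\<^sup>2)) \<partial>lborel) = ennreal (gauss_mass TYPE('a))"
    using gauss_mass_finite[where 'a = 'a] by (simp add: gauss_mass_def)
  also have "norm ?s powr - real DIM('a) = c powr (- real DIM('a) / 2)"
    using c by (simp add: powr_half_sqrt[symmetric] powr_powr)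
  finally show ?thesis using gauss_mass_pos[where 'a = 'a] by (simp add: ennreal_mult)
qed

lemma nn_integral_gauss:
  assumes "0 < v"
  shows "(\<integral>\<^sup>+(b::'a::{real_normed_field,euclidean_space}). ennreal (gauss v b) \<partial>lborel) = 1"
proof -
  let ?m = "gauss_mass TYPE('a)" and ?e = "- real DIM('a) / 2"
  have m: "0 < ?m" by (rule gauss_mass_pos)
  have "(\<integral>\<^sup>+(b::'a). ennreal (gauss v b) \<partial>lborel) = (\<integral>\<^sup>+(b::'a). ennreal (v powr ?e / ?m) * ennreal (exp (- (1 / v) * (norm (b - 0))\<^sup>2)) \<partial>lborel)"
    using assms m by (intro nn_integral_cong) (simp add: gauss_def ennreal_mult[symmetric])
  also have "\<dots> = ennreal (v powr ?e / ?m) * ennreal ((1 / v) powr ?e * ?m)"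
    using assms by (subst nn_integral_cmult, measurable, subst nn_integral_exp_norm) simp_all
  also have "\<dots> = ennreal (v powr ?e * (1 / v) powr ?e)"
    using m by (simp add: ennreal_mult[symmetric])
  also have "v powr ?e * (1 / v) powr ?e = 1"
    using assms by (simp add: powr_mult[symmetric])
  finally show ?thesis by simp
qed

lemma gauss_convolution:
  fixes x :: "'a::{real_normed_field,euclidean_space}"
  assumes s: "0 < s" and t: "0 < t"
  shows "(\<integral>\<^sup>+b. ennreal (gauss s b * gauss t (x - b)) \<partial>lborel) = ennreal (gauss (s + t) x)"
proof -
  let ?m = "gauss_mass TYPE('a)" and ?e = "- real DIM('a) / 2"
  have m: "0 < ?m" by (rule gauss_mass_pos)
  \<comment> \<open>Completing the square: in \<open>b\<close> the joint exponent has quadratic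
    coefficient \<open>1 / s + 1 / t = c\<close> and is minimal at \<open>y\<close>.\<close>
  define c where "c = (s + t) / (s * t)"
  define y where "y = (s / (s + t)) *\<^sub>R x"
  have c: "0 < c" using s t by (simp add: c_def)
  define A where "A = s powr ?e * t powr ?e * exp (- (norm x)\<^sup>2 / (s + t)) / (?m * ?m)"
  have square: "(norm b)\<^sup>2 / s + (norm (x - b))\<^sup>2 / t = (norm x)\<^sup>2 / (s + t) + c * (norm (b - y))\<^sup>2" for b
  proof -
    have nz: "s \<noteq> 0" "t \<noteq> 0" "s + t \<noteq> 0" using s t by auto
    have 1: "(norm (b - y))\<^sup>2 = b \<bullet> b - 2 * (s / (s + t)) * (x \<bullet> b) + (s / (s + t))\<^sup>2 * (x \<bullet> x)"
      unfolding power2_norm_eq_inner y_def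
      by (simp add: inner_diff_left inner_diff_right inner_commute power2_eq_square algebra_simps)
    have 2: "(norm (x - b))\<^sup>2 = x \<bullet> x - 2 * (x \<bullet> b) + b \<bullet> b"
      unfolding power2_norm_eq_inner by (simp add: inner_diff_left inner_diff_right inner_commute)
    have 3: "c * (s / (s + t)) = 1 / t" using nz by (simp add: c_def)
    have c': "c = 1 / s + 1 / t" using nz by (simp add: c_def add_divide_distrib)
    have "s / (s + t) = 1 - t / (s + t)" using nz by (simp add: field_simps)
    then have 4: "c * (s / (s + t))\<^sup>2 = 1 / t - 1 / (s + t)"
      using nz 3 by (simp add: power2_eq_square mult.assoc[symmetric] right_diff_distrib)
    have "c * (norm (b - y))\<^sup>2 = c * (b \<bullet> b) - 2 * (c * (s / (s + t))) * (x \<bullet> b) + c * (s / (s + t))\<^sup>2 * (x \<bullet> x)"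
      unfolding 1 by (simp add: algebra_simps)
    also have "\<dots> = (1 / s + 1 / t) * (b \<bullet> b) - 2 * (1 / t) * (x \<bullet> b) + (1 / t - 1 / (s + t)) * (x \<bullet> x)"
      unfolding 3 4 by (simp add: c')
    finally show ?thesis
      unfolding 2 power2_norm_eq_inner[of b] power2_norm_eq_inner[of x]
      by (simp add: algebra_simps add_divide_distrib diff_divide_distrib)
  qed
  have A0: "0 \<le> A" using m by (simp add: A_def)
  have "(\<integral>\<^sup>+b. ennreal (gauss s b * gauss t (x - b)) \<partial>lborel) = (\<integral>\<^sup>+b. ennreal A * ennreal (exp (- c * (norm (b - y))\<^sup>2)) \<partial>lborel)"
  proof (rule nn_integral_cong, goal_cases)
    case (1 b)
    have "exp (- (norm b)\<^sup>2 / s) * exp (- (norm (x - b))\<^sup>2 / t) = exp (- ((norm b)\<^sup>2 / s + (norm (x - b))\<^sup>2 / t))"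
      by (simp add: exp_add[symmetric])
    also have "\<dots> = exp (- (norm x)\<^sup>2 / (s + t)) * exp (- c * (norm (b - y))\<^sup>2)"
      unfolding square by (simp add: exp_add[symmetric])
    finally have e: "exp (- (norm b)\<^sup>2 / s) * exp (- (norm (x - b))\<^sup>2 / t) = exp (- (norm x)\<^sup>2 / (s + t)) * exp (- c * (norm (b - y))\<^sup>2)" .
    have "gauss s b * gauss t (x - b) = s powr ?e * t powr ?e / (?m * ?m) * (exp (- (norm b)\<^sup>2 / s) * exp (- (norm (x - b))\<^sup>2 / t))"
      using s t by (simp add: gauss_def)
    then have "gauss s b * gauss t (x - b) = A * exp (- c * (norm (b - y))\<^sup>2)"
      unfolding e by (simp add: A_def)
    then show ?case
      by (simp only: ennreal_mult[OF A0 exp_ge_zero])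
  qed
  also have "\<dots> = ennreal A * ennreal (c powr ?e * ?m)"
    using c by (subst nn_integral_cmult, measurable, subst nn_integral_exp_norm) simp_all
  also have "\<dots> = ennreal (A * (c powr ?e * ?m))"
    using m by (intro ennreal_mult[symmetric] A0) simp
  also have "A * (c powr ?e * ?m) = gauss (s + t) x"
  proof -
    have "s powr ?e * t powr ?e * c powr ?e = (s * t * c) powr ?e"
      using s t c by (simp add: powr_mult)
    also have "s * t * c = s + t" using s t by (simp add: c_def)
    finally show ?thesis using s t m by (simp add: A_def gauss_def field_simps)
  qed
  finally show ?thesis .
qed

lemma gauss_divide:
  fixes \<alpha> b :: "'a::{real_normed_field,euclidean_space}"
  assumes \<alpha>: "\<alpha> \<noteq> 0"
  shows "gauss v (b / \<alpha>) = norm \<alpha> powr real DIM('a) * gauss ((norm \<alpha>)\<^sup>2 * v) b"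
proof (cases "0 < v")
  case True
  let ?e = "- real DIM('a) / 2"
  have pos: "0 < (norm \<alpha>)\<^sup>2 * v" using True \<alpha> by simp
  have "(norm \<alpha>)\<^sup>2 = norm \<alpha> powr 2" using \<alpha> by simp
  then have "((norm \<alpha>)\<^sup>2) powr ?e = norm \<alpha> powr - real DIM('a)"
    by (simp only: powr_powr) simp
  then have "((norm \<alpha>)\<^sup>2 * v) powr ?e = norm \<alpha> powr - real DIM('a) * v powr ?e"
    by (simp add: powr_mult)
  moreover have "norm \<alpha> powr real DIM('a) * norm \<alpha> powr - real DIM('a) = 1"
    using \<alpha> by (simp add: powr_add[symmetric])
  ultimately have 1: "v powr ?e = norm \<alpha> powr real DIM('a) * ((norm \<alpha>)\<^sup>2 * v) powr ?e"
    by simp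
  have 2: "- (norm (b / \<alpha>))\<^sup>2 / v = - (norm b)\<^sup>2 / ((norm \<alpha>)\<^sup>2 * v)"
    by (simp add: norm_divide power_divide)
  show ?thesis
    unfolding gauss_def 2 if_P[OF True] if_P[OF pos] by (subst 1) (simp only: times_divide_eq_right mult.assoc)
next
  case False
  then have "\<not> 0 < (norm \<alpha>)\<^sup>2 * v" using \<alpha> by (simp add: zero_less_mult_iff)
  with False show ?thesis by (simp add: gauss_def)
qed

text \<open>With \<open>q\<close> the squared norm of \<open>b\<close>, the logarithmic derivative
  of \<open>gauss v b\<close> in \<open>v\<close> is \<open>- d / (2 * v) + q / v^2\<close>,
  negative once \<open>q / v < d / 2\<close>. The bounds \<open>1 / 2\<close> and 1 secure this in
  every dimension. The inequality \<open>ln x \<le> x - 1\<close> replaces differentiation.\<close>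

lemma gauss_less:
  fixes b :: "'a::euclidean_space"
  assumes b: "norm b < 1 / 2" and u: "1 \<le> u" and v: "u < v"
  shows "gauss v b < gauss u b"
proof -
  let ?D = "real DIM('a)"
  let ?q = "(norm b)\<^sup>2"
  have D: "1 \<le> ?D" using DIM_positive[where 'a = 'a] by linarith
  have "(norm b)\<^sup>2 \<le> (1 / 2)\<^sup>2" using b by (intro power_mono) auto
  then have q: "?q \<le> 1 / 4" by (simp add: power2_eq_square)
  have "ln (u / v) \<le> u / v - 1" using u v by (intro ln_le_minus_one) auto
  then have l: "1 - u / v \<le> ln v - ln u" using u v by (simp add: ln_div)
  have pos: "0 < 1 - u / v" using u v by simp
  have "?q / u - ?q / v = ?q / u * (1 - u / v)" using u v by (simp add: field_simps)
  also have "\<dots> < ?D / 2 * (1 - u / v)"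
  proof (rule mult_strict_right_mono[OF _ pos])
    have "?q / u \<le> ?q" using u by (simp add: divide_le_eq mult_left_mono[of 1 u ?q, simplified])
    also have "\<dots> < ?D / 2" using q D by linarith
    finally show "?q / u < ?D / 2" .
  qed
  also have "\<dots> \<le> ?D / 2 * (ln v - ln u)" using l D by (intro mult_left_mono) auto
  finally have "- ?D / 2 * ln v - ?q / v < - ?D / 2 * ln u - ?q / u" by (simp add: algebra_simps)
  then have "exp (- ?D / 2 * ln v - ?q / v) < exp (- ?D / 2 * ln u - ?q / u)" by simp
  then have "v powr (- ?D / 2) * exp (- ?q / v) < u powr (- ?D / 2) * exp (- ?q / u)"
    using u v by (simp add: powr_def exp_add[symmetric])
  then show ?thesis using u v gauss_mass_pos[where 'a = 'a] by (simp add: gauss_def divide_strict_right_mono)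
qed

text \<open>Away from the origin the exponential outweighs the negative power of \<open>v\<close> as
  \<open>v\<close> tends to 0. The function \<open>v powr - c * exp (- q / v)\<close> is maximal at
  \<open>v = q / c\<close>, which is where \<open>?B\<close> comes from.\<close>

lemma gauss_bounded:
  fixes b :: "'a::euclidean_space"
  assumes b: "b \<noteq> 0"
  shows "\<exists>B\<ge>0. \<forall>v. gauss v b \<le> B"
proof -
  define c where "c = real DIM('a) / 2"
  define q where "q = (norm b)\<^sup>2"
  have c: "0 < c" and q: "0 < q" using b by (simp_all add: c_def q_def)
  let ?B = "exp (c * ln (c / q) - c) / gauss_mass TYPE('a)"
  have "gauss v b \<le> ?B" if v: "0 < v" for v
  proof -
    have "ln (q / v / c) \<le> q / v / c - 1" using c q v by (intro ln_le_minus_one) simp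
    then have "c * ln (q / v / c) \<le> c * (q / v / c - 1)" using c by (intro mult_left_mono) simp_all
    also have "\<dots> = q / v - c" using c by (simp add: right_diff_distrib)
    finally have "- c * ln v - q / v \<le> c * ln (c / q) - c" using c q v by (simp add: ln_div ln_mult algebra_simps)
    then have "v powr - c * exp (- q / v) \<le> exp (c * ln (c / q) - c)"
      using v by (simp add: powr_def exp_add[symmetric])
    then show ?thesis using v gauss_mass_pos[where 'a = 'a]
      by (simp add: gauss_def c_def q_def divide_right_mono)
  qed
  then have "gauss v b \<le> ?B" for v
    using gauss_mass_pos[where 'a = 'a] by (cases "0 < v") (simp_all add: gauss_def)
  moreover have "0 \<le> ?B" using gauss_mass_pos[where 'a = 'a] by simp
  ultimately show ?thesis by blast
qed

text \<open>In terms of the Fourier transform, \<open>mix w\<close> is a multiple of the function with transform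
  \<open>t \<mapsto> 1 / (w + \<bar>t\<bar>\<^sup>2)\<close>, so that dilations act on the parameter \<open>w\<close>.\<close>

definition mix :: "real \<Rightarrow> 'a::euclidean_space \<Rightarrow> ennreal" where
  "mix w b = (\<integral>\<^sup>+v. ennreal (exp_density w v * gauss v b) \<partial>lborel)"

lemma mix_measurable [measurable (raw)]:
  fixes g :: "_ \<Rightarrow> 'a::euclidean_space"
  assumes [measurable]: "f \<in> borel_measurable M" "g \<in> borel_measurable M"
  shows "(\<lambda>x. mix (f x) (g x)) \<in> borel_measurable M"
  unfolding mix_def exp_density_def by measurable

lemma mix_finite:
  assumes "b \<noteq> 0" "0 < w"
  shows "mix w b < \<infinity>"
proof -
  obtain B where B: "0 \<le> B" "\<And>v. gauss v b \<le> B" using gauss_bounded[OF assms(1)] by blast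
  have "mix w b \<le> (\<integral>\<^sup>+v. ennreal (exp_density w v) * ennreal B \<partial>lborel)"
    unfolding mix_def using B assms
    by (intro nn_integral_mono) (simp add: ennreal_mult[symmetric] exp_density_nonneg mult_left_mono ennreal_leI)
  also have "\<dots> = ennreal B" using assms by (simp add: nn_integral_multc nn_integral_exp_density)
  finally show ?thesis by (rule le_less_trans) simp
qed

text \<open>Substitute \<open>(norm \<alpha>)\<^sup>2 * u\<close> for \<open>v\<close>: this divides
  the rate of the exponential density and multiplies the variance as \<open>gauss_divide\<close>
  prescribes.\<close>

lemma mix_divide:
  fixes \<alpha> b :: "'a::{real_normed_field,euclidean_space}"
  assumes \<alpha>: "\<alpha> \<noteq> 0" and w: "0 < w"
  shows "mix w (b / \<alpha>) = ennreal (norm \<alpha> powr real DIM('a)) * mix (w / (norm \<alpha>)\<^sup>2) b"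
proof -
  let ?c = "(norm \<alpha>)\<^sup>2"
  have c: "0 < ?c" using \<alpha> by simp
  have "mix (w / ?c) b = ennreal \<bar>?c\<bar> * (\<integral>\<^sup>+u. ennreal (exp_density (w / ?c) (0 + ?c * u) * gauss (0 + ?c * u) b) \<partial>lborel)"
    unfolding mix_def using c by (intro nn_integral_real_affine) simp_all
  also have "\<dots> = (\<integral>\<^sup>+u. ennreal ?c * ennreal (exp_density (w / ?c) (?c * u) * gauss (?c * u) b) \<partial>lborel)"
    by (subst nn_integral_cmult) simp_all
  also have "\<dots> = (\<integral>\<^sup>+u. ennreal (exp_density w u * gauss (?c * u) b) \<partial>lborel)"
  proof (rule nn_integral_cong, goal_cases)
    case (1 u)
    have "?c * exp_density (w / ?c) (?c * u) = exp_density w u"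
      using \<alpha> by (auto simp: exp_density_def zero_less_mult_iff)
    then show ?case
      using c by (subst ennreal_mult'[symmetric]) (simp_all add: mult.assoc[symmetric])
  qed
  finally have "ennreal (norm \<alpha> powr real DIM('a)) * mix (w / ?c) b
    = (\<integral>\<^sup>+u. ennreal (norm \<alpha> powr real DIM('a)) * ennreal (exp_density w u * gauss (?c * u) b) \<partial>lborel)"
    by (simp add: nn_integral_cmult)
  also have "\<dots> = mix w (b / \<alpha>)"
    unfolding mix_def
  proof (rule nn_integral_cong, goal_cases)
    case (1 u)
    show ?case
      unfolding gauss_divide[OF \<alpha>] by (subst ennreal_mult'[symmetric]) (simp_all add: ac_simps)
  qed
  finally show ?thesis by simp
qed

lemma nn_integral_mix_mult:
  fixes \<phi> :: "'a::euclidean_space \<Rightarrow> ennreal"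
  assumes [measurable]: "\<phi> \<in> borel_measurable borel" and w: "0 < w"
  shows "(\<integral>\<^sup>+b. mix w b * \<phi> b \<partial>lborel)
    = (\<integral>\<^sup>+s. ennreal (exp_density w s) * (\<integral>\<^sup>+b. ennreal (gauss s b) * \<phi> b \<partial>lborel) \<partial>lborel)"
proof -
  have "(\<integral>\<^sup>+b. mix w b * \<phi> b \<partial>lborel) = (\<integral>\<^sup>+b. (\<integral>\<^sup>+s. ennreal (exp_density w s * gauss s b) * \<phi> b \<partial>lborel) \<partial>lborel)"
    unfolding mix_def by (intro nn_integral_cong nn_integral_multc[symmetric]) measurable
  also have "\<dots> = (\<integral>\<^sup>+s. (\<integral>\<^sup>+b. ennreal (exp_density w s * gauss s b) * \<phi> b \<partial>lborel) \<partial>lborel)"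
    by (rule lborel_pair.Fubini') measurable
  also have "\<dots> = (\<integral>\<^sup>+s. ennreal (exp_density w s) * (\<integral>\<^sup>+b. ennreal (gauss s b) * \<phi> b \<partial>lborel) \<partial>lborel)"
  proof (rule nn_integral_cong, goal_cases)
    case (1 s)
    have "(\<integral>\<^sup>+b. ennreal (exp_density w s * gauss s b) * \<phi> b \<partial>lborel) = (\<integral>\<^sup>+b. ennreal (exp_density w s) * (ennreal (gauss s b) * \<phi> b) \<partial>lborel)"
      using w by (intro nn_integral_cong) (simp add: ennreal_mult exp_density_nonneg gauss_nonneg mult.assoc)
    also have "\<dots> = ennreal (exp_density w s) * (\<integral>\<^sup>+b. ennreal (gauss s b) * \<phi> b \<partial>lborel)"
      by (rule nn_integral_cmult) measurable
    finally show ?case .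
  qed
  finally show ?thesis .
qed

lemma exp_density_eq_0: "\<not> 0 < s \<Longrightarrow> exp_density w s = 0"
  by (simp add: exp_density_def)

lemma nn_integral_mix:
  assumes "0 < w"
  shows "(\<integral>\<^sup>+b. mix w (b :: 'a::{real_normed_field,euclidean_space}) \<partial>lborel) = 1"
proof -
  have "(\<integral>\<^sup>+b. mix w (b :: 'a) \<partial>lborel) = (\<integral>\<^sup>+s. ennreal (exp_density w s) * (\<integral>\<^sup>+b. ennreal (gauss s (b :: 'a)) \<partial>lborel) \<partial>lborel)"
    using nn_integral_mix_mult[of "\<lambda>_ :: 'a. 1" w] assms by simp
  also have "\<dots> = (\<integral>\<^sup>+s. ennreal (exp_density w s) \<partial>lborel)"
  proof (rule nn_integral_cong, goal_cases)
    case (1 s)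
    show ?case
      by (cases "0 < s") (simp_all add: nn_integral_gauss exp_density_eq_0)
  qed
  finally show ?thesis using assms by (simp add: nn_integral_exp_density)
qed

lemma mix_gauss_convolution:
  fixes x :: "'a::{real_normed_field,euclidean_space}"
  assumes w: "0 < w" and t: "0 < t"
  shows "(\<integral>\<^sup>+b. mix w b * ennreal (gauss t (x - b)) \<partial>lborel) = (\<integral>\<^sup>+s. ennreal (exp_density w s) * ennreal (gauss (s + t) x) \<partial>lborel)"
proof -
  have "(\<integral>\<^sup>+b. mix w b * ennreal (gauss t (x - b)) \<partial>lborel)
    = (\<integral>\<^sup>+s. ennreal (exp_density w s) * (\<integral>\<^sup>+b. ennreal (gauss s b) * ennreal (gauss t (x - b)) \<partial>lborel) \<partial>lborel)"
    by (rule nn_integral_mix_mult[OF _ w]) measurable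
  also have "\<dots> = (\<integral>\<^sup>+s. ennreal (exp_density w s) * ennreal (gauss (s + t) x) \<partial>lborel)"
  proof (rule nn_integral_cong, goal_cases)
    case (1 s)
    show ?case
      using gauss_convolution[of s t x] t
      by (cases "0 < s") (simp_all add: ennreal_mult gauss_nonneg exp_density_eq_0)
  qed
  finally show ?thesis .
qed

lemma mix_convolution:
  fixes x :: "'a::{real_normed_field,euclidean_space}"
  assumes w: "0 < w" and w': "0 < w'"
  shows "(\<integral>\<^sup>+b. mix w b * mix w' (x - b) \<partial>lborel)
    = (\<integral>\<^sup>+s. (\<integral>\<^sup>+t. ennreal (exp_density w s) * (ennreal (exp_density w' t) * ennreal (gauss (s + t) x)) \<partial>lborel) \<partial>lborel)"
proof -
  have "(\<integral>\<^sup>+b. mix w b * mix w' (x - b) \<partial>lborel)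
    = (\<integral>\<^sup>+s. ennreal (exp_density w s) * (\<integral>\<^sup>+b. ennreal (gauss s b) * mix w' (x - b) \<partial>lborel) \<partial>lborel)"
    by (rule nn_integral_mix_mult[OF _ w]) measurable
  also have "\<dots> = (\<integral>\<^sup>+s. (\<integral>\<^sup>+t. ennreal (exp_density w s) * (ennreal (exp_density w' t) * ennreal (gauss (s + t) x)) \<partial>lborel) \<partial>lborel)"
  proof (rule nn_integral_cong, goal_cases)
    case (1 s)
    show ?case
    proof (cases "0 < s")
      case True
      have "(\<integral>\<^sup>+b. ennreal (gauss s b) * mix w' (x - b) \<partial>lborel) = (\<integral>\<^sup>+b. mix w' b * ennreal (gauss s (x - b)) \<partial>lborel)"
      proof -
        have "(\<integral>\<^sup>+b. ennreal (gauss s b) * mix w' (x - b) \<partial>lborel)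
          = ennreal (norm (- 1 :: 'a) powr - real DIM('a)) * (\<integral>\<^sup>+b. ennreal (gauss s b) * mix w' (x - b) \<partial>lborel)" by simp
        also have "\<dots> = (\<integral>\<^sup>+b. ennreal (gauss s (x + (- 1) * b)) * mix w' (x - (x + (- 1) * b)) \<partial>lborel)"
          by (rule nn_integral_lborel_affine[symmetric]) simp_all
        finally show ?thesis by (simp add: mult.commute)
      qed
      also have "\<dots> = (\<integral>\<^sup>+t. ennreal (exp_density w' t) * ennreal (gauss (t + s) x) \<partial>lborel)"
        by (rule mix_gauss_convolution[OF w' True])
      finally show ?thesis by (simp add: nn_integral_cmult add.commute)
    qed (simp add: exp_density_eq_0)
  qed
  finally show ?thesis .
qed

text \<open>The sum of two independent exponential variances of rate \<open>w\<close> has the Gamma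
  density of shape 2. On the Fourier side this squares \<open>w / (w + \<bar>t\<bar>^2)\<close>, up
  to the normalisation of \<open>t\<close>.\<close>

lemma mix_convolution_self:
  fixes x :: "'a::{real_normed_field,euclidean_space}"
  assumes w: "0 < w"
  shows "(\<integral>\<^sup>+b. mix w b * mix w (x - b) \<partial>lborel)
    = (\<integral>\<^sup>+v. ennreal (w\<^sup>2 * v * exp (- w * v)) * ennreal (gauss v x) \<partial>lborel)"
proof -
  have "(\<integral>\<^sup>+b. mix w b * mix w (x - b) \<partial>lborel)
    = (\<integral>\<^sup>+s. (\<integral>\<^sup>+t. ennreal (exp_density w s) * (ennreal (exp_density w t) * ennreal (gauss (s + t) x)) \<partial>lborel) \<partial>lborel)"
    by (rule mix_convolution[OF w w])
  also have "\<dots> = (\<integral>\<^sup>+s. (\<integral>\<^sup>+v. ennreal (exp_density w s) * (ennreal (exp_density w (- s + v)) * ennreal (gauss v x)) \<partial>lborel) \<partial>lborel)"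
  proof (rule nn_integral_cong, goal_cases)
    case (1 s)
    have "(\<integral>\<^sup>+v. ennreal (exp_density w s) * (ennreal (exp_density w (- s + v)) * ennreal (gauss (s + (- s + v)) x)) \<partial>lborel)
      = (\<integral>\<^sup>+t. ennreal (exp_density w s) * (ennreal (exp_density w t) * ennreal (gauss (s + t) x)) \<partial>lborel)"
      by (rule nn_integral_lborel_translate) measurable
    then show ?case by simp
  qed
  also have "\<dots> = (\<integral>\<^sup>+v. (\<integral>\<^sup>+s. ennreal (exp_density w s) * (ennreal (exp_density w (- s + v)) * ennreal (gauss v x)) \<partial>lborel) \<partial>lborel)"
    by (rule lborel_pair.Fubini'[symmetric]) (unfold exp_density_def, measurable)
  also have "\<dots> = (\<integral>\<^sup>+v. ennreal (w\<^sup>2 * v * exp (- w * v)) * ennreal (gauss v x) \<partial>lborel)"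
  proof (rule nn_integral_cong, goal_cases)
    case (1 v)
    show ?case
    proof (cases "0 < v")
      case True
      have "(\<integral>\<^sup>+s. ennreal (exp_density w s) * (ennreal (exp_density w (- s + v)) * ennreal (gauss v x)) \<partial>lborel)
        = (\<integral>\<^sup>+s. (ennreal (w\<^sup>2 * exp (- w * v)) * ennreal (gauss v x)) * indicator {0<..<v} s \<partial>lborel)"
      proof (rule nn_integral_cong, goal_cases)
        case (1 s)
        \<comment> \<open>For \<open>0 < s < v\<close> the product of the two exponentials does not
          depend on \<open>s\<close>, so integration over \<open>s\<close> yields the length
          \<open>v\<close>.\<close>
        have "exp_density w s * exp_density w (- s + v) = (w\<^sup>2 * exp (- w * v)) * indicator {0<..<v} s"
          by (auto simp: exp_density_def indicator_def power2_eq_square exp_add[symmetric] algebra_simps)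
        then have "ennreal (exp_density w s) * ennreal (exp_density w (- s + v)) = ennreal (w\<^sup>2 * exp (- w * v)) * indicator {0<..<v} s"
          using w by (simp add: ennreal_mult[symmetric] exp_density_nonneg ennreal_indicator[symmetric] del: ennreal_indicator)
        then show ?case
          by (simp only: ac_simps) (metis mult.assoc mult.commute)
      qed
      also have "\<dots> = ennreal (w\<^sup>2 * exp (- w * v)) * ennreal (gauss v x) * ennreal v"
        using True by (simp add: nn_integral_cmult_indicator)
      also have "\<dots> = ennreal (w\<^sup>2 * v * exp (- w * v)) * ennreal (gauss v x)"
        using True by (simp add: ennreal_mult ac_simps)
      finally show ?thesis .
    qed (simp add: gauss_def)
  qed
  finally show ?thesis .
qed

section \<open>Radial integrals\<close>

lemma nn_integral_powr_tail:
  assumes q: "0 < q" and r: "0 < (r::real)"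
  shows "(\<integral>\<^sup>+t. ennreal (q * t powr (- q - 1)) * indicator {r..} t \<partial>lborel) = ennreal (r powr - q)"
proof -
  have "(\<integral>\<^sup>+t. ennreal (q * t powr (- q - 1)) * indicator {r..} t \<partial>lborel) = ennreal (0 - (- (r powr - q)))"
  proof (rule nn_integral_FTC_atLeast)
    show "((\<lambda>t. - (t powr - q)) has_real_derivative q * t powr (- q - 1)) (at t)" if "r \<le> t" for t
      using r that by (auto intro!: derivative_eq_intros)
    have "((\<lambda>t. t powr - q) \<longlongrightarrow> 0) at_top"
      using q by (intro tendsto_neg_powr filterlim_ident) simp
    then show "((\<lambda>t. - (t powr - q)) \<longlongrightarrow> 0) at_top" using tendsto_minus by fastforce
  qed (use q in auto)
  then show ?thesis by simp
qed

text \<open>Layer cake: the power of the norm is the integral of \<open>p * t powr (- p - 1)\<close>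
  over \<open>t \<ge> norm a\<close>. After Tonelli the ball of radius \<open>t\<close> contributes
  \<open>t ^ d\<close>, and the resulting power is integrable on \<open>{1..}\<close> exactly
  because \<open>p\<close> exceeds d.\<close>

lemma radial_tail_finite:
  assumes p: "real DIM('a::euclidean_space) < p"
  shows "(\<integral>\<^sup>+a. ennreal (norm a powr - p) * indicator {a. 1 < norm a} (a :: 'a) \<partial>lborel) < \<infinity>"
proof -
  let ?d = "DIM('a)"
  let ?e = "\<lambda>t a. ennreal (p * t powr (- p - 1)) * (if norm (a :: 'a) \<le> t \<and> 1 \<le> t then 1 else 0)"
  have p0: "0 < p" using p by (rule le_less_trans[rotated]) simp
  have "(\<integral>\<^sup>+a. ennreal (norm a powr - p) * indicator {a. 1 < norm a} (a :: 'a) \<partial>lborel)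
    \<le> (\<integral>\<^sup>+a. (\<integral>\<^sup>+t. ?e t a \<partial>lborel) \<partial>lborel)"
  proof (rule nn_integral_mono, goal_cases)
    case (1 a)
    show ?case
    proof (cases "1 < norm a")
      case True
      have "ennreal (norm a powr - p) = (\<integral>\<^sup>+t. ennreal (p * t powr (- p - 1)) * indicator {norm a..} t \<partial>lborel)"
        by (rule nn_integral_powr_tail[symmetric]) (use p0 True in auto)
      also have "\<dots> = (\<integral>\<^sup>+t. ennreal (p * t powr (- p - 1)) * (if norm a \<le> t \<and> 1 \<le> t then 1 else 0) \<partial>lborel)"
        using True by (intro nn_integral_cong) (auto simp: indicator_def)
      finally show ?thesis using True by simp
    qed simp
  qed
  also have "\<dots> = (\<integral>\<^sup>+t. (\<integral>\<^sup>+a. ?e t a \<partial>lborel) \<partial>lborel)"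
    by (rule lborel_pair.Fubini'[symmetric]) measurable
  also have "\<dots> = (\<integral>\<^sup>+t. ennreal (unit_ball_vol ?d * p / (p - ?d)) * (ennreal ((p - ?d) * t powr (- (p - ?d) - 1)) * indicator {1..} t) \<partial>lborel)"
  proof (rule nn_integral_cong, goal_cases)
    case (1 t)
    show ?case
    proof (cases "1 \<le> t")
      case True
      have eq: "(\<lambda>a. ?e t a) = (\<lambda>a. ennreal (p * t powr (- p - 1)) * indicator (cball 0 t) a)"
        using True by (auto simp: indicator_def)
      have "(\<integral>\<^sup>+a. ?e t a \<partial>lborel) = ennreal (p * t powr (- p - 1)) * ennreal (unit_ball_vol ?d * t ^ ?d)"
        unfolding eq using True by (subst nn_integral_cmult_indicator) (simp_all add: emeasure_cball)
      also have "\<dots> = ennreal (p * t powr (- p - 1) * (unit_ball_vol ?d * t ^ ?d))"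
        using p0 True by (simp add: ennreal_mult)
      also have "t powr (- p - 1) * t ^ ?d = t powr (- p - 1 + real ?d)"
        using True by (simp add: powr_realpow[symmetric] powr_add)
      then have "t powr (- p - 1) * t ^ ?d = t powr (- (p - ?d) - 1)" by (simp add: algebra_simps)
      then have "p * t powr (- p - 1) * (unit_ball_vol ?d * t ^ ?d) = unit_ball_vol ?d * p / (p - ?d) * ((p - ?d) * t powr (- (p - ?d) - 1))"
        using p by (simp add: ac_simps)
      finally have "(\<integral>\<^sup>+a. ?e t a \<partial>lborel)
        = ennreal (unit_ball_vol ?d * p / (p - ?d) * ((p - ?d) * t powr (- (p - ?d) - 1)))" .
      also have "\<dots> = ennreal (unit_ball_vol ?d * p / (p - ?d)) * ennreal ((p - ?d) * t powr (- (p - ?d) - 1))"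
        using p p0 by (intro ennreal_mult) simp_all
      finally show ?thesis using True by simp
    qed simp
  qed
  also have "\<dots> = ennreal (unit_ball_vol ?d * p / (p - ?d)) * ennreal (1 powr - (p - ?d))"
    using p by (subst nn_integral_cmult, measurable, subst nn_integral_powr_tail) simp_all
  also have "\<dots> < \<infinity>" by (simp add: ennreal_mult_less_top)
  finally show ?thesis .
qed

text \<open>The constant of \<open>nn_integral_radial\<close>: the region \<open>1 < norm a\<close>
  is where \<open>norm a powr - 2\<close> lies in the unit interval. It equals half the surface area
  of the unit sphere.\<close>

definition tail_mass :: "'a::euclidean_space itself \<Rightarrow> real" where
  "tail_mass _ = enn2real (\<integral>\<^sup>+a. ennreal (norm a powr (- real DIM('a) - 2)) * indicator {a. 1 < norm a} (a :: 'a) \<partial>lborel)"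

lemma tail_mass_eq:
  "(\<integral>\<^sup>+a. ennreal (norm a powr (- real DIM('a) - 2)) * indicator {a. 1 < norm a} (a :: 'a::euclidean_space) \<partial>lborel) = ennreal (tail_mass TYPE('a))"
  using radial_tail_finite[where 'a = 'a, of "real DIM('a) + 2"] by (simp add: tail_mass_def)

lemma norm_gt_not_null: "\<not> (AE a :: 'a::euclidean_space in lborel. norm a \<le> r)"
proof
  assume "AE a::'a in lborel. norm a \<le> r"
  then have "AE a::'a in lborel. a \<in> cball 0 r" by simp
  then have "emeasure lborel (UNIV :: 'a set) = emeasure lborel (cball (0::'a) r)"
    by (intro emeasure_eq_AE) auto
  then show False using emeasure_lborel_cball_finite[of "0 :: 'a" r] by simp
qed

lemma tail_mass_pos: "0 < tail_mass TYPE('a::euclidean_space)"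
proof -
  have "(\<integral>\<^sup>+a. ennreal (norm a powr (- real DIM('a) - 2)) * indicator {a. 1 < norm a} (a :: 'a) \<partial>lborel) \<noteq> 0"
  proof
    assume "(\<integral>\<^sup>+a. ennreal (norm a powr (- real DIM('a) - 2)) * indicator {a. 1 < norm a} (a :: 'a) \<partial>lborel) = 0"
    then have "AE a::'a in lborel. ennreal (norm a powr (- real DIM('a) - 2)) * indicator {a. 1 < norm a} a = 0"
      by (subst (asm) nn_integral_0_iff_AE) simp_all
    then have "AE a::'a in lborel. norm a \<le> 1"
    proof eventually_elim
      case (elim a)
      show ?case
      proof (rule ccontr)
        assume "\<not> norm a \<le> 1"
        then have "1 < norm a" "0 < norm a powr (- real DIM('a) - 2)" by auto
        with elim show False by (simp add: ennreal_eq_0_iff)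
      qed
    qed
    then show False using norm_gt_not_null by blast
  qed
  then show ?thesis unfolding tail_mass_eq by (simp add: ennreal_eq_0_iff not_le)
qed

text \<open>Polar coordinates in the variable \<open>w = norm a powr - 2\<close>, obtained from
  dilations instead of a measure on the sphere. The exponent \<open>- d - 2\<close> is the one that
  turns the push-forward into a multiple of Lebesgue measure on \<open>{0<..}\<close>.\<close>

lemma nn_integral_radial:
  fixes \<phi> :: "real \<Rightarrow> ennreal"
  assumes [measurable]: "\<phi> \<in> borel_measurable borel"
  shows "(\<integral>\<^sup>+a. \<phi> (norm a powr - 2) * ennreal (norm (a :: 'a::{real_normed_field,euclidean_space}) powr (- real DIM('a) - 2)) \<partial>lborel)
    = ennreal (tail_mass TYPE('a)) * (\<integral>\<^sup>+w. \<phi> w * indicator {0<..} w \<partial>lborel)"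
proof -
  let ?d = "real DIM('a)" and ?m = "tail_mass TYPE('a)"
  define A where "A = distr (density lborel (\<lambda>a :: 'a. ennreal (norm a powr (- ?d - 2)))) borel (\<lambda>a. norm a powr - 2)"
  define B where "B = density lborel (\<lambda>w :: real. ennreal ?m * indicator {0<..} w)"
  have m: "0 \<le> ?m" using tail_mass_pos[where 'a = 'a] by simp
  have eB: "emeasure B {..<x} = ennreal (?m * max 0 x)" for x
  proof -
    have "emeasure B {..<x} = (\<integral>\<^sup>+w. ennreal ?m * indicator {0<..<x} w \<partial>lborel)"
      unfolding B_def by (subst emeasure_density) (auto intro!: nn_integral_cong simp: indicator_def)
    also have "\<dots> = ennreal ?m * emeasure lborel {0<..<x}" by (rule nn_integral_cmult_indicator) simp
    also have "\<dots> = ennreal (?m * max 0 x)" using m by (cases "0 \<le> x") (simp_all add: ennreal_mult)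
    finally show ?thesis .
  qed
  have eA: "emeasure A {..<x} = ennreal (?m * max 0 x)" for x
  proof -
    have A: "emeasure A {..<x} = (\<integral>\<^sup>+(a::'a). ennreal (norm a powr (- ?d - 2)) * indicator {a. norm a powr - 2 < x} a \<partial>lborel)"
    proof -
      have "emeasure A {..<x} = (\<integral>\<^sup>+w. indicator {..<x} w \<partial>A)" by (simp add: A_def)
      also have "\<dots> = (\<integral>\<^sup>+(a::'a). ennreal (norm a powr (- ?d - 2)) * indicator {..<x} (norm a powr - 2) \<partial>lborel)"
        unfolding A_def by (subst nn_integral_distr, measurable, subst nn_integral_density) simp_all
      finally show ?thesis by (simp add: indicator_def)
    qed
    show ?thesis
    proof (cases "0 < x")
      case False
      have "(\<integral>\<^sup>+(a::'a). ennreal (norm a powr (- ?d - 2)) * indicator {a. norm a powr - 2 < x} a \<partial>lborel) = (\<integral>\<^sup>+(a::'a). 0 \<partial>lborel)"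
      proof (rule nn_integral_cong, goal_cases)
        case (1 a)
        have "0 \<le> norm a powr - 2" by simp
        then have "\<not> norm a powr - 2 < x" using False by linarith
        then show ?case by simp
      qed
      then show ?thesis using False by (simp add: A max_def)
    next
      case True
      \<comment> \<open>Dilation by \<open>sqrt x\<close> carries the region
        \<open>norm a powr - 2 < x\<close> to \<open>1 < norm a\<close>, and the powers of
        \<open>sqrt x\<close> combine to \<open>x\<close>.\<close>
      let ?c = "of_real (sqrt x) :: 'a"
      have c: "?c \<noteq> 0" "norm ?c = sqrt x" using True by simp_all
      have "(\<integral>\<^sup>+(a::'a). ennreal (norm a powr (- ?d - 2)) * indicator {a. norm a powr - 2 < x} a \<partial>lborel)
        = (\<integral>\<^sup>+(a::'a). ennreal (sqrt x powr (?d + 2)) * (ennreal (norm (?c * a) powr (- ?d - 2)) * indicator {a. 1 < norm a} (?c * a)) \<partial>lborel)"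
      proof (rule nn_integral_cong, goal_cases)
        case (1 a)
        show ?case
        proof (cases "a = 0")
          case False
          have s: "0 < sqrt x" using True by simp
          have "sqrt x powr (?d + 2) * norm (?c * a) powr (- ?d - 2) = norm a powr (- ?d - 2)"
          proof -
            have "sqrt x powr (?d + 2) * sqrt x powr (- ?d - 2) = 1" using s by (simp add: powr_add[symmetric])
            then show ?thesis by (simp only: norm_mult c(2) powr_mult mult.assoc[symmetric] mult_1_left)
          qed
          moreover have "norm a powr - 2 < x \<longleftrightarrow> 1 < norm (?c * a)"
          proof -
            have "norm a powr - 2 = 1 / (norm a)\<^sup>2" using False by (simp add: powr_minus divide_inverse)
            then have "norm a powr - 2 < x \<longleftrightarrow> 1 < x * (norm a)\<^sup>2" using False by (simp add: divide_less_eq)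
            also have "x * (norm a)\<^sup>2 = (norm (?c * a))\<^sup>2" using True by (simp add: norm_mult power_mult_distrib)
            also have "1 < (norm (?c * a))\<^sup>2 \<longleftrightarrow> 1 < norm (?c * a)"
              using power_less_imp_less_base[of 1 2 "norm (?c * a)"] one_less_power[of "norm (?c * a)" 2] by (metis norm_ge_zero one_power2 zero_less_numeral)
            finally show ?thesis .
          qed
          ultimately show ?thesis
            by (simp add: indicator_def ennreal_mult[symmetric] mult.assoc[symmetric] del: mult_eq_0_iff)
        qed simp
      qed
      also have "\<dots> = ennreal (sqrt x powr (?d + 2)) * (\<integral>\<^sup>+(a::'a). ennreal (norm (?c * a) powr (- ?d - 2)) * indicator {a. 1 < norm a} (?c * a) \<partial>lborel)"
        by (rule nn_integral_cmult) measurable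
      also have "(\<integral>\<^sup>+(a::'a). ennreal (norm (?c * a) powr (- ?d - 2)) * indicator {a. 1 < norm a} (?c * a) \<partial>lborel)
        = ennreal (norm ?c powr - ?d) * (\<integral>\<^sup>+(a::'a). ennreal (norm a powr (- ?d - 2)) * indicator {a. 1 < norm a} a \<partial>lborel)"
        by (rule nn_integral_lborel_mult[OF _ c(1)]) measurable
      also have "\<dots> = ennreal (sqrt x powr - ?d) * ennreal ?m" by (simp only: tail_mass_eq c(2))
      also have "ennreal (sqrt x powr (?d + 2)) * (ennreal (sqrt x powr - ?d) * ennreal ?m) = ennreal (sqrt x powr (?d + 2) * sqrt x powr - ?d * ?m)"
        using m by (simp add: ennreal_mult mult.assoc)
      also have "sqrt x powr (?d + 2) * sqrt x powr - ?d = x"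
        using True by (simp add: powr_add[symmetric])
      finally show ?thesis using True by (simp add: A mult.commute)
    qed
  qed
  have "A = B"
  proof (rule measure_eqI_generator_eq[where E = "range lessThan" and \<Omega> = UNIV and A = "\<lambda>n. {..<real n}"])
    show "Int_stable (range lessThan :: real set set)"
    proof -
      have "{..<a} \<inter> {..<b} = {..<min a b}" for a b :: real by auto
      then show ?thesis by (auto simp: Int_stable_def)
    qed
    show "emeasure A X = emeasure B X" if "X \<in> range lessThan" for X using that by (auto simp: eA eB)
    show "sets A = sigma_sets UNIV (range lessThan)" "sets B = sigma_sets UNIV (range lessThan)"
      by (simp_all add: A_def B_def borel_Iio)
    show "(\<Union>n. {..<real n}) = UNIV" by (auto intro: reals_Archimedean2)
  qed (auto simp: eA)
  then have "(\<integral>\<^sup>+w. \<phi> w \<partial>A) = (\<integral>\<^sup>+w. \<phi> w \<partial>B)" by simp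
  moreover have "(\<integral>\<^sup>+w. \<phi> w \<partial>A) = (\<integral>\<^sup>+a. \<phi> (norm a powr - 2) * ennreal (norm (a :: 'a) powr (- ?d - 2)) \<partial>lborel)"
    unfolding A_def by (subst nn_integral_distr, measurable, subst nn_integral_density) (simp_all add: mult.commute)
  moreover have "(\<integral>\<^sup>+w. \<phi> w \<partial>B) = ennreal ?m * (\<integral>\<^sup>+w. \<phi> w * indicator {0<..} w \<partial>lborel)"
    unfolding B_def by (subst nn_integral_density, measurable, subst nn_integral_cmult[symmetric])
      (measurable, auto intro!: nn_integral_cong simp: ac_simps)
  ultimately show ?thesis by simp
qed

section \<open>Strict comparison of Gaussian mixtures near the origin\<close>

lemma nn_integral_strict_mono:
  assumes [measurable]: "f \<in> borel_measurable M" "g \<in> borel_measurable M"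
    and fin: "(\<integral>\<^sup>+x. g x \<partial>M) < \<infinity>" and le: "\<And>x. f x \<le> g x"
    and less: "\<And>x. x \<in> S \<Longrightarrow> f x < g x" and S: "\<not> (AE x in M. x \<notin> S)"
  shows "(\<integral>\<^sup>+x. f x \<partial>M) < (\<integral>\<^sup>+x. g x \<partial>M)"
proof (rule nn_integral_less)
  show "(\<integral>\<^sup>+x. f x \<partial>M) \<noteq> \<infinity>"
    using nn_integral_mono[of M f g] le fin by (auto simp: top_unique)
  show "\<not> (AE x in M. g x \<le> f x)"
  proof
    assume "AE x in M. g x \<le> f x"
    then have "AE x in M. x \<notin> S" by eventually_elim (meson less leD)
    with S show False by simp
  qed
qed (use le in auto)

lemma gauss_le:
  fixes b :: "'a::euclidean_space"
  assumes "1 \<le> v"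
  shows "gauss v b \<le> 1 / gauss_mass TYPE('a)"
proof -
  have "v powr (- real DIM('a) / 2) \<le> 1" using powr_mono[of "- real DIM('a) / 2" 0 v] assms by simp
  moreover have "exp (- (norm b)\<^sup>2 / v) \<le> 1" using assms by simp
  ultimately have "v powr (- real DIM('a) / 2) * exp (- (norm b)\<^sup>2 / v) \<le> 1 * 1"
    by (intro mult_mono) auto
  then show ?thesis using assms gauss_mass_pos[where 'a = 'a] by (simp add: gauss_def divide_right_mono)
qed

text \<open>Variances add: \<open>s\<close> and \<open>t\<close> are exponential with rates 1 and
  \<open>w\<close>, and \<open>r\<close> is fixed.\<close>

lemma mix_mix_gauss_convolution:
  fixes b :: "'a::{real_normed_field,euclidean_space}"
  assumes w: "0 < w" and r: "0 < r"
  shows "(\<integral>\<^sup>+\<beta>. (\<integral>\<^sup>+\<gamma>. mix 1 \<gamma> * mix w (\<beta> - \<gamma>) \<partial>lborel) * ennreal (gauss r (b - \<beta>)) \<partial>lborel)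
    = (\<integral>\<^sup>+s. ennreal (exp_density 1 s) * (\<integral>\<^sup>+t. ennreal (exp_density w t) * ennreal (gauss (s + (t + r)) b) \<partial>lborel) \<partial>lborel)"
proof -
  let ?e = "\<lambda>t \<gamma>. ennreal (exp_density w t) * ennreal (gauss (t + r) (b - \<gamma>))"
  let ?I = "\<lambda>\<gamma>. (\<integral>\<^sup>+t. ?e t \<gamma> \<partial>lborel)"
  have "(\<integral>\<^sup>+\<beta>. (\<integral>\<^sup>+\<gamma>. mix 1 \<gamma> * mix w (\<beta> - \<gamma>) \<partial>lborel) * ennreal (gauss r (b - \<beta>)) \<partial>lborel)
    = (\<integral>\<^sup>+\<beta>. (\<integral>\<^sup>+\<gamma>. mix 1 \<gamma> * mix w (\<beta> - \<gamma>) * ennreal (gauss r (b - \<beta>)) \<partial>lborel) \<partial>lborel)"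
    by (intro nn_integral_cong nn_integral_multc[symmetric]) measurable
  also have "\<dots> = (\<integral>\<^sup>+\<gamma>. (\<integral>\<^sup>+\<beta>. mix 1 \<gamma> * mix w (\<beta> - \<gamma>) * ennreal (gauss r (b - \<beta>)) \<partial>lborel) \<partial>lborel)"
    by (rule lborel_pair.Fubini'[symmetric]) measurable
  also have "\<dots> = (\<integral>\<^sup>+\<gamma>. mix 1 \<gamma> * ?I \<gamma> \<partial>lborel)"
  proof (rule nn_integral_cong, goal_cases)
    case (1 \<gamma>)
    have "(\<integral>\<^sup>+\<beta>. mix 1 \<gamma> * mix w (\<beta> - \<gamma>) * ennreal (gauss r (b - \<beta>)) \<partial>lborel)
      = (\<integral>\<^sup>+\<beta>. mix 1 \<gamma> * mix w (\<gamma> + \<beta> - \<gamma>) * ennreal (gauss r (b - (\<gamma> + \<beta>))) \<partial>lborel)"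
      by (rule nn_integral_lborel_translate[symmetric]) measurable
    also have "\<dots> = (\<integral>\<^sup>+\<beta>. mix 1 \<gamma> * (mix w \<beta> * ennreal (gauss r ((b - \<gamma>) - \<beta>))) \<partial>lborel)"
      by (simp add: mult.assoc diff_diff_eq)
    also have "\<dots> = mix 1 \<gamma> * (\<integral>\<^sup>+\<beta>. mix w \<beta> * ennreal (gauss r ((b - \<gamma>) - \<beta>)) \<partial>lborel)"
      by (rule nn_integral_cmult) measurable
    also have "(\<integral>\<^sup>+\<beta>. mix w \<beta> * ennreal (gauss r ((b - \<gamma>) - \<beta>)) \<partial>lborel) = ?I \<gamma>"
      by (rule mix_gauss_convolution[OF w r])
    finally show ?case .
  qed
  also have "\<dots> = (\<integral>\<^sup>+s. ennreal (exp_density 1 s) * (\<integral>\<^sup>+\<gamma>. ennreal (gauss s \<gamma>) * ?I \<gamma> \<partial>lborel) \<partial>lborel)"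
  proof (rule nn_integral_mix_mult)
    have "(\<lambda>z. ennreal (gauss (snd z + r) (b - fst z))) \<in> borel_measurable (borel \<Otimes>\<^sub>M lborel)"
      by (intro measurable_compose[OF _ measurable_ennreal] gauss_measurable borel_measurable_add borel_measurable_diff) measurable
    then show "(\<lambda>\<gamma>. \<integral>\<^sup>+t. ?e t \<gamma> \<partial>lborel) \<in> borel_measurable borel"
      by measurable
  qed simp
  also have "\<dots> = (\<integral>\<^sup>+s. ennreal (exp_density 1 s) * (\<integral>\<^sup>+t. ennreal (exp_density w t) * ennreal (gauss (s + (t + r)) b) \<partial>lborel) \<partial>lborel)"
  proof (rule nn_integral_cong, goal_cases)
    case (1 s)
    show ?case
    proof (cases "0 < s")
      case True
      have "(\<integral>\<^sup>+\<gamma>. ennreal (gauss s \<gamma>) * ?I \<gamma> \<partial>lborel)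
        = (\<integral>\<^sup>+\<gamma>. (\<integral>\<^sup>+t. ennreal (gauss s \<gamma>) * (?e t \<gamma>) \<partial>lborel) \<partial>lborel)"
        by (intro nn_integral_cong nn_integral_cmult[symmetric]) measurable
      also have "\<dots> = (\<integral>\<^sup>+t. (\<integral>\<^sup>+\<gamma>. ennreal (gauss s \<gamma>) * (?e t \<gamma>) \<partial>lborel) \<partial>lborel)"
        by (rule lborel_pair.Fubini'[symmetric]) (unfold exp_density_def, measurable)
      also have "\<dots> = (\<integral>\<^sup>+t. ennreal (exp_density w t) * ennreal (gauss (s + (t + r)) b) \<partial>lborel)"
      proof (rule nn_integral_cong, goal_cases)
        case (1 t)
        show ?case
        proof (cases "0 < t")
          case t: True
          have "(\<integral>\<^sup>+\<gamma>. ennreal (gauss s \<gamma>) * (?e t \<gamma>) \<partial>lborel)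
            = (\<integral>\<^sup>+\<gamma>. ennreal (exp_density w t) * ennreal (gauss s \<gamma> * gauss (t + r) (b - \<gamma>)) \<partial>lborel)"
            by (intro nn_integral_cong) (simp add: ennreal_mult gauss_nonneg ac_simps)
          also have "\<dots> = ennreal (exp_density w t) * (\<integral>\<^sup>+\<gamma>. ennreal (gauss s \<gamma> * gauss (t + r) (b - \<gamma>)) \<partial>lborel)"
            by (rule nn_integral_cmult) measurable
          finally show ?thesis using gauss_convolution[of s "t + r" b] True t r by simp
        qed (simp add: exp_density_eq_0)
      qed
      finally show ?thesis by simp
    qed (simp add: exp_density_eq_0)
  qed
  finally show ?thesis .
qed

lemma unit_interval_not_null: "\<not> (AE s in lborel. s \<notin> {0<..(1::real)})"
proof
  assume "AE s in lborel. s \<notin> {0<..(1::real)}"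
  then have "{0<..(1::real)} \<in> null_sets lborel" by (subst AE_iff_null_sets) auto
  then show False by (simp add: null_sets_def)
qed

text \<open>The additional variance \<open>t\<close> lowers the density at \<open>b\<close> by
  \<open>gauss_less\<close>, since \<open>s + r\<close> is at least 1. Averaging over
  \<open>t\<close> and then over \<open>s\<close> keeps the inequality strict because the integrals
  are finite and the exponential densities are positive on \<open>{0<..1}\<close>.\<close>

lemma mix_mix_gauss_less:
  fixes b :: "'a::{real_normed_field,euclidean_space}"
  assumes w: "0 < w" and r: "1 \<le> r" and b: "norm b < 1 / 2"
  shows "(\<integral>\<^sup>+s. ennreal (exp_density 1 s) * (\<integral>\<^sup>+t. ennreal (exp_density w t) * ennreal (gauss (s + (t + r)) b) \<partial>lborel) \<partial>lborel)
    < (\<integral>\<^sup>+s. ennreal (exp_density 1 s) * ennreal (gauss (s + r) b) \<partial>lborel)"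
proof -
  define Z where "Z s = (\<integral>\<^sup>+t. ennreal (exp_density w t) * ennreal (gauss (s + (t + r)) b) \<partial>lborel)" for s
  have [measurable]: "Z \<in> borel_measurable borel" unfolding Z_def by measurable
  have Z: "Z s < ennreal (gauss (s + r) b)" if s: "0 < s" for s
  proof -
    have "Z s < (\<integral>\<^sup>+t. ennreal (exp_density w t) * ennreal (gauss (s + r) b) \<partial>lborel)"
      unfolding Z_def
    proof (rule nn_integral_strict_mono[where S = "{0<..1}"])
      have less: "gauss (s + (t + r)) b < gauss (s + r) b" if "0 < t" for t
        using s r that by (intro gauss_less[OF b]) auto
      show "ennreal (exp_density w t) * ennreal (gauss (s + (t + r)) b) \<le> ennreal (exp_density w t) * ennreal (gauss (s + r) b)" for t
        using less[of t] by (cases "0 < t") (auto simp: exp_density_eq_0 intro!: mult_left_mono ennreal_leI)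
      show "ennreal (exp_density w t) * ennreal (gauss (s + (t + r)) b) < ennreal (exp_density w t) * ennreal (gauss (s + r) b)" if "t \<in> {0<..1}" for t
        using less[of t] that w gauss_nonneg[of "s + r" b] gauss_nonneg[of "s + (t + r)" b]
        by (simp add: ennreal_mult[symmetric] ennreal_less_iff exp_density_def)
      show "(\<integral>\<^sup>+t. ennreal (exp_density w t) * ennreal (gauss (s + r) b) \<partial>lborel) < \<infinity>"
        using w by (simp add: nn_integral_multc nn_integral_exp_density)
    qed (use unit_interval_not_null in simp_all)
    then show ?thesis using w by (simp add: nn_integral_multc nn_integral_exp_density)
  qed
  have "(\<integral>\<^sup>+s. ennreal (exp_density 1 s) * Z s \<partial>lborel) < (\<integral>\<^sup>+s. ennreal (exp_density 1 s) * ennreal (gauss (s + r) b) \<partial>lborel)"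
  proof (rule nn_integral_strict_mono[where S = "{0<..1}"])
    show "ennreal (exp_density 1 s) * Z s \<le> ennreal (exp_density 1 s) * ennreal (gauss (s + r) b)" for s
      using Z[of s] by (cases "0 < s") (auto simp: exp_density_eq_0 intro!: mult_left_mono)
    show "ennreal (exp_density 1 s) * Z s < ennreal (exp_density 1 s) * ennreal (gauss (s + r) b)" if "s \<in> {0<..1}" for s
      using Z[of s] that by (intro ennreal_mult_strict_left_mono) (auto simp: exp_density_def)
    have "(\<integral>\<^sup>+s. ennreal (exp_density 1 s) * ennreal (gauss (s + r) b) \<partial>lborel) \<le> (\<integral>\<^sup>+s. ennreal (exp_density 1 s) * ennreal (1 / gauss_mass TYPE('a)) \<partial>lborel)"
    proof (rule nn_integral_mono, goal_cases)
      case (1 s)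
      show ?case
        using gauss_le[of "s + r" b] r by (cases "0 < s") (auto simp: exp_density_eq_0 intro!: mult_left_mono ennreal_leI)
    qed
    also have "\<dots> < \<infinity>" by (simp add: nn_integral_multc nn_integral_exp_density)
    finally show "(\<integral>\<^sup>+s. ennreal (exp_density 1 s) * ennreal (gauss (s + r) b) \<partial>lborel) < \<infinity>" .
  qed (use unit_interval_not_null in simp_all)
  then show ?thesis by (simp only: Z_def)
qed

section \<open>Convolution in coordinates\<close>

definition lift :: "('a::euclidean_space \<Rightarrow> 'a \<Rightarrow> real) \<Rightarrow> 'a ^ 2 ^ 2 \<Rightarrow> complex" where
  "lift F x = complex_of_real (F (x $ 1 $ 2) (x $ 1 $ 1))"

locale affine_haar =
  fixes \<mu> :: "('a::{real_normed_field,euclidean_space} ^ 2 ^ 2) measure" and C :: real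
  assumes haar: "left_haar_measure affine_group \<mu>" and C: "0 < C"
    and haar_formula: "F \<in> borel_measurable borel \<Longrightarrow> (\<integral>\<^sup>+x. F x \<partial>\<mu>) = ennreal C * aff_integral F"
begin

sublocale haar_group affine_group \<mu>
  by (rule affine_haar_group) (rule haar)

lemma borel_imp_haar: "F \<in> borel_measurable borel \<Longrightarrow> F \<in> borel_measurable \<mu>"
  by (rule measurable_compose[OF haar_measurable_id[OF haar], of F])

lemma haar_AE_I:
  assumes P: "{x. P x} \<in> sets borel" and ae: "\<And>a. a \<noteq> 0 \<Longrightarrow> AE b in lborel. P (aff b a)"
  shows "AE x in \<mu>. P x"
proof -
  let ?I = "indicator (- {x. P x}) :: 'a ^ 2 ^ 2 \<Rightarrow> ennreal"
  have m: "?I \<in> borel_measurable borel" using P by (intro borel_measurable_indicator) (simp add: borel_comp)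
  have "aff_integral ?I = (\<integral>\<^sup>+(a::'a). 0 \<partial>lborel)"
    unfolding aff_integral_def
  proof (rule nn_integral_cong, goal_cases)
    case (1 a)
    show ?case
    proof (cases "a = 0")
      case False
      have "(\<integral>\<^sup>+b. ?I (aff b a) \<partial>lborel) = (\<integral>\<^sup>+(b::'a). 0 \<partial>lborel)"
        by (rule nn_integral_cong_AE, use ae[OF False] in eventually_elim) simp
      then show ?thesis by simp
    qed simp
  qed
  then have "(\<integral>\<^sup>+x. ?I x \<partial>\<mu>) = 0" using haar_formula[OF m] by simp
  then have "AE x in \<mu>. ?I x = 0"
    by (subst (asm) nn_integral_0_iff_AE) (rule borel_imp_haar[OF m])
  then show ?thesis by eventually_elim (simp add: indicator_def split: if_splits)
qed

lemma haar_AE_D: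
  assumes P: "{x. P x} \<in> sets borel" and ae: "AE x in \<mu>. P x"
  shows "AE a in lborel. a = 0 \<or> (AE b in lborel. P (aff b a))"
proof -
  let ?I = "indicator (- {x. P x}) :: 'a ^ 2 ^ 2 \<Rightarrow> ennreal"
  have m [measurable]: "?I \<in> borel_measurable borel" using P by (intro borel_measurable_indicator) (simp add: borel_comp)
  have "(\<integral>\<^sup>+x. ?I x \<partial>\<mu>) = (\<integral>\<^sup>+x. 0 \<partial>\<mu>)"
    by (rule nn_integral_cong_AE, use ae in eventually_elim) simp
  then have "aff_integral ?I = 0" using haar_formula[OF m] C by (simp add: ennreal_eq_0_iff)
  then have "AE a::'a in lborel. (\<integral>\<^sup>+b. ?I (aff b a) \<partial>lborel) * ennreal (norm a powr (- 2 * real DIM('a))) = 0"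
    unfolding aff_integral_def by (subst (asm) nn_integral_0_iff_AE) measurable
  then show ?thesis
  proof eventually_elim
    case (elim a)
    show ?case
    proof (cases "a = 0")
      case False
      then have "0 < norm a powr (- 2 * real DIM('a))" by simp
      then have "(\<integral>\<^sup>+b. ?I (aff b a) \<partial>lborel) = 0" using elim by (simp add: ennreal_eq_0_iff)
      then have "AE b in lborel. ?I (aff b a) = 0"
        by (subst (asm) nn_integral_0_iff_AE) measurable
      then have "AE b in lborel. P (aff b a)" by eventually_elim (simp add: indicator_def split: if_splits)
      then show ?thesis ..
    qed simp
  qed
qed

lemma lift_measurable_borel:
  assumes [measurable]: "case_prod F \<in> borel_measurable (borel \<Otimes>\<^sub>M borel)"
  shows "lift F \<in> borel_measurable borel"
  unfolding lift_def by measurable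

lemma lift_measurable:
  assumes "case_prod F \<in> borel_measurable (borel \<Otimes>\<^sub>M borel)"
  shows "lift F \<in> borel_measurable \<mu>"
  by (rule borel_imp_haar[OF lift_measurable_borel[OF assms]])

lemma lift_integrable:
  assumes [measurable]: "case_prod F \<in> borel_measurable (borel \<Otimes>\<^sub>M borel)" and F0: "\<And>b a. 0 \<le> F b a"
    and fin: "(\<integral>\<^sup>+a. (\<integral>\<^sup>+b. ennreal (F b a) \<partial>lborel) * ennreal (norm a powr (- 2 * real DIM('a))) \<partial>lborel) < \<infinity>"
  shows "integrable \<mu> (lift F)"
proof (rule integrableI_bounded)
  have "(\<integral>\<^sup>+x. ennreal (norm (lift F x)) \<partial>\<mu>) = (\<integral>\<^sup>+x. ennreal (F (x $ 1 $ 2) (x $ 1 $ 1)) \<partial>\<mu>)"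
    by (simp add: lift_def F0)
  also have "\<dots> = ennreal C * aff_integral (\<lambda>x. ennreal (F (x $ 1 $ 2) (x $ 1 $ 1)))"
    by (rule haar_formula) measurable
  also have "\<dots> < \<infinity>" using fin by (simp add: aff_integral_def ennreal_mult_less_top)
  finally show "(\<integral>\<^sup>+x. ennreal (norm (lift F x)) \<partial>\<mu>) < \<infinity>" .
qed (rule lift_measurable, measurable)

text \<open>For nonnegative kernels the Bochner integral is \<open>enn2real\<close> of the
  \<open>ennreal\<close> one at every point of the group; where the latter diverges, both sides are
  0.\<close>

lemma convolution_lift:
  assumes Fm [measurable]: "case_prod F \<in> borel_measurable (borel \<Otimes>\<^sub>M borel)"
    and Hm [measurable]: "case_prod H \<in> borel_measurable (borel \<Otimes>\<^sub>M borel)"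
    and F0: "\<And>b a. 0 \<le> F b a" and H0: "\<And>b a. 0 \<le> H b a" and a: "a \<noteq> 0"
  shows "convolution affine_group \<mu> (lift F) (lift H) (aff b a)
    = complex_of_real (enn2real (ennreal C * (\<integral>\<^sup>+\<alpha>. (\<integral>\<^sup>+\<beta>. ennreal (F \<beta> \<alpha> * H ((b - \<beta>) / \<alpha>) (a / \<alpha>)) \<partial>lborel)
        * ennreal (norm \<alpha> powr (- 2 * real DIM('a))) \<partial>lborel)))"
proof -
  define P where "P y = F (y $ 1 $ 2) (y $ 1 $ 1) * H ((b - y $ 1 $ 2) / y $ 1 $ 1) (a / y $ 1 $ 1)" for y :: "'a ^ 2 ^ 2"
  have Pm [measurable]: "P \<in> borel_measurable borel" unfolding P_def by measurable
  have P0: "0 \<le> P y" for y using F0 H0 by (simp add: P_def)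
  have "convolution affine_group \<mu> (lift F) (lift H) (aff b a) = (\<integral>y. complex_of_real (P y) \<partial>\<mu>)"
    unfolding convolution_def
  proof (rule Bochner_Integration.integral_cong[OF refl])
    fix y assume "y \<in> space \<mu>"
    then obtain \<beta> \<alpha> where y: "y = aff \<beta> \<alpha>" "\<alpha> \<noteq> 0" unfolding space_eq by (rule carrier_affE)
    have "- (\<beta> / \<alpha>) + 1 / \<alpha> * b = (b - \<beta>) / \<alpha>" by (simp add: diff_divide_distrib)
    then show "lift F y * lift H (inv\<^bsub>affine_group\<^esub> y \<otimes>\<^bsub>affine_group\<^esub> aff b a) = complex_of_real (P y)"
      using y by (simp add: aff_inv aff_mult' lift_def P_def)
  qed
  also have "\<dots> = complex_of_real (\<integral>y. P y \<partial>\<mu>)" by (rule integral_complex_of_real)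
  also have "(\<integral>y. P y \<partial>\<mu>) = enn2real (\<integral>\<^sup>+y. ennreal (P y) \<partial>\<mu>)"
    by (rule integral_eq_nn_integral) (use borel_imp_haar[OF Pm] P0 in auto)
  also have "(\<integral>\<^sup>+y. ennreal (P y) \<partial>\<mu>) = ennreal C * aff_integral (\<lambda>y. ennreal (P y))"
    by (rule haar_formula) measurable
  finally show ?thesis by (simp add: aff_integral_def P_def)
qed

end

text \<open>Identities between powers of norms are proved for finite factors; this lemma and its
  companions carry them past a factor that may be infinite.\<close>

lemma ennreal_rearrange4: "k * (d * (u * m)) * t = p * (m * q)" if "k * d * u * t = p * q" for k d u m t p q :: ennreal
proof -
  have "k * (d * (u * m)) * t = (k * d * u * t) * m" by (simp only: ac_simps)
  also have "\<dots> = p * (m * q)" unfolding that by (simp only: ac_simps)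
  finally show ?thesis .
qed

lemma ennreal_rearrange3: "k * (d * m) * t = p * m * q" if "k * d * t = p * q" for k d m t p q :: ennreal
proof -
  have "k * (d * m) * t = (k * d * t) * m" by (simp only: ac_simps)
  also have "\<dots> = p * m * q" unfolding that by (simp only: ac_simps)
  finally show ?thesis .
qed

lemma powr_minus_two_less_iff:
  assumes "0 < x" "0 < (y::real)"
  shows "y powr - 2 < x powr - 2 \<longleftrightarrow> x < y"
  using assms powr_less_mono2_neg[of "-2" x y] powr_less_mono2_neg[of "-2" y x]
  by (cases x y rule: linorder_cases) auto

text \<open>In dimension at least two \<open>mix w\<close> is infinite at the origin, since small
  variances dominate there. Elements of \<open>L^1\<close> need finite values, and
  \<open>enn2real\<close> changes at most that one point when \<open>w\<close> is positive.\<close>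

definition psi :: "real \<Rightarrow> 'a::euclidean_space \<Rightarrow> real" where
  "psi w b = enn2real (mix w b)"

lemma psi_nonneg: "0 \<le> psi w b"
  by (simp add: psi_def)

lemma psi_measurable [measurable (raw)]:
  fixes g :: "_ \<Rightarrow> 'a::euclidean_space"
  assumes [measurable]: "f \<in> borel_measurable M" "g \<in> borel_measurable M"
  shows "(\<lambda>x. psi (f x) (g x)) \<in> borel_measurable M"
  unfolding psi_def by measurable

lemma psi_eq_mix: "b \<noteq> 0 \<Longrightarrow> 0 < w \<Longrightarrow> ennreal (psi w b) = mix w b"
  using mix_finite[of b w] by (simp add: psi_def)

lemma nn_integral_psi_mult:
  fixes \<phi> :: "'a::euclidean_space \<Rightarrow> ennreal"
  assumes "0 < w"
  shows "(\<integral>\<^sup>+b. ennreal (psi w b) * \<phi> b \<partial>lborel) = (\<integral>\<^sup>+b. mix w b * \<phi> b \<partial>lborel)"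
  by (rule nn_integral_cong_AE, use AE_lborel_singleton[of 0] in eventually_elim) (simp add: psi_eq_mix assms)

lemma psi_convolution:
  fixes b \<alpha> :: "'a::{real_normed_field,euclidean_space}"
  assumes \<alpha>: "\<alpha> \<noteq> 0" and w: "0 < w" "0 < w'"
  shows "(\<integral>\<^sup>+\<beta>. ennreal (psi w \<beta> * psi w' ((b - \<beta>) / \<alpha>)) \<partial>lborel)
    = ennreal (norm \<alpha> powr real DIM('a)) * (\<integral>\<^sup>+\<beta>. mix w \<beta> * mix (w' * norm \<alpha> powr - 2) (b - \<beta>) \<partial>lborel)"
proof -
  have "(\<integral>\<^sup>+\<beta>. ennreal (psi w \<beta> * psi w' ((b - \<beta>) / \<alpha>)) \<partial>lborel)
    = (\<integral>\<^sup>+\<beta>. ennreal (norm \<alpha> powr real DIM('a)) * (mix w \<beta> * mix (w' * norm \<alpha> powr - 2) (b - \<beta>)) \<partial>lborel)"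
  proof (rule nn_integral_cong_AE, use AE_lborel_singleton[of 0] AE_lborel_singleton[of b] in eventually_elim)
    case (elim \<beta>)
    have "w' / (norm \<alpha>)\<^sup>2 = w' * norm \<alpha> powr - 2" using \<alpha> by (simp add: powr_minus divide_inverse)
    then have "ennreal (psi w' ((b - \<beta>) / \<alpha>)) = ennreal (norm \<alpha> powr real DIM('a)) * mix (w' * norm \<alpha> powr - 2) (b - \<beta>)"
      using elim \<alpha> w mix_divide[OF \<alpha> w(2), of "b - \<beta>"] by (simp add: psi_eq_mix)
    then show ?case using elim w by (simp add: ennreal_mult psi_nonneg psi_eq_mix ac_simps)
  qed
  also have "\<dots> = ennreal (norm \<alpha> powr real DIM('a)) * (\<integral>\<^sup>+\<beta>. mix w \<beta> * mix (w' * norm \<alpha> powr - 2) (b - \<beta>) \<partial>lborel)"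
    by (rule nn_integral_cmult) measurable
  finally show ?thesis .
qed

text \<open>The elementary integration behind \<open>B A = A + B\<close>: integrating
  \<open>v * exp (- w * v)\<close> over \<open>w > c\<close> gives \<open>exp (- c * v)\<close>, the
  counterpart of integrating \<open>1 / (w + s)^2\<close> to \<open>1 / (c + s)\<close>. The premise
  on \<open>S\<close> leaves its endpoint open, as that depends on which support condition is active
  in the application.\<close>

lemma nn_integral_laplace_mix:
  fixes b :: "'a::euclidean_space"
  assumes c: "0 < c" and S: "\<And>w. w \<noteq> c \<Longrightarrow> w \<in> S \<longleftrightarrow> c < w" and [measurable]: "S \<in> sets borel"
  shows "(\<integral>\<^sup>+w. indicator S w * (\<integral>\<^sup>+v. ennreal (v * exp (- w * v)) * ennreal (gauss v b) \<partial>lborel) \<partial>lborel) = ennreal (1 / c) * mix c b"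
proof -
  have "(\<integral>\<^sup>+w. indicator S w * (\<integral>\<^sup>+v. ennreal (v * exp (- w * v)) * ennreal (gauss v b) \<partial>lborel) \<partial>lborel)
    = (\<integral>\<^sup>+w. (\<integral>\<^sup>+v. indicator S w * (ennreal (v * exp (- w * v)) * ennreal (gauss v b)) \<partial>lborel) \<partial>lborel)"
    by (intro nn_integral_cong nn_integral_cmult[symmetric]) measurable
  also have "\<dots> = (\<integral>\<^sup>+v. (\<integral>\<^sup>+w. indicator S w * (ennreal (v * exp (- w * v)) * ennreal (gauss v b)) \<partial>lborel) \<partial>lborel)"
    by (rule lborel_pair.Fubini'[symmetric]) measurable
  also have "\<dots> = (\<integral>\<^sup>+v. ennreal (1 / c) * ennreal (exp_density c v * gauss v b) \<partial>lborel)"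
  proof (rule nn_integral_cong, goal_cases)
    case (1 v)
    show ?case
    proof (cases "0 < v")
      case True
      have "(\<integral>\<^sup>+w. indicator S w * (ennreal (v * exp (- w * v)) * ennreal (gauss v b)) \<partial>lborel)
        = (\<integral>\<^sup>+w. ennreal (v * gauss v b) * (ennreal (exp (- v * w)) * indicator {c..} w) \<partial>lborel)"
      proof (rule nn_integral_cong_AE, use AE_lborel_singleton[of c] in eventually_elim)
        case (elim w)
        have "ennreal (v * exp (- w * v)) * ennreal (gauss v b) = ennreal (v * gauss v b) * ennreal (exp (- v * w))"
          using True by (simp add: ennreal_mult[symmetric] gauss_nonneg ac_simps)
        then show ?case using S[OF elim] elim by (auto simp: indicator_def)
      qed
      also have "\<dots> = ennreal (v * gauss v b) * ennreal (exp (- v * c) / v)"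
        using nn_integral_exp_tail[OF True, of c] by (subst nn_integral_cmult) simp_all
      also have "\<dots> = ennreal (v * gauss v b * (exp (- v * c) / v))"
        using True by (intro ennreal_mult[symmetric]) (simp_all add: gauss_nonneg)
      also have "v * gauss v b * (exp (- v * c) / v) = 1 / c * (exp_density c v * gauss v b)"
        using True c by (simp add: exp_density_def ac_simps)
      also have "ennreal \<dots> = ennreal (1 / c) * ennreal (exp_density c v * gauss v b)"
        using c by (intro ennreal_mult) (simp_all add: gauss_nonneg exp_density_nonneg)
      finally show ?thesis .
    qed (simp add: gauss_def)
  qed
  also have "\<dots> = ennreal (1 / c) * mix c b"
    unfolding mix_def by (rule nn_integral_cmult) measurable
  finally show ?thesis .
qed

section \<open>The two functions and their products in both orders\<close>

context affine_haar
begin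

text \<open>Products of two such functions are quadratic in \<open>kappa\<close>, whereas
  \<open>f + h\<close> is linear. This value absorbs the constant of the Haar measure and that of
  the radial integral.\<close>

definition kappa :: real where
  "kappa = 1 / (C * tail_mass TYPE('a))"

lemma kappa_pos: "0 < kappa"
  using C tail_mass_pos[where 'a = 'a] by (simp add: kappa_def)

lemma kappa_eq: "C * kappa * tail_mass TYPE('a) = 1"
  using C tail_mass_pos[where 'a = 'a] by (simp add: kappa_def)

text \<open>The function behind the kernel of \<open>A\<close>: \<open>norm a\<close> stands for
  \<open>(r / s)^(1/2)\<close>, so the support is \<open>s < r\<close>, and \<open>psi 1\<close> has
  a transform proportional to \<open>1 / (1 + s)\<close>. After unitary normalisation the operator
  has the transform of \<open>f\<close> times \<open>norm a powr - d\<close> as kernel for the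
  dilation invariant measure, so the exponent \<open>d - 1\<close> leaves the factor
  \<open>(s / r)^(1/2)\<close>.\<close>

definition ffun :: "'a \<Rightarrow> 'a \<Rightarrow> real" where
  "ffun b a = (if 1 < norm a then kappa * norm a powr (real DIM('a) - 1) * psi 1 b else 0)"

text \<open>The involution of \<open>ffun\<close>, matching the transpose \<open>B\<close>:
  \<open>psi 1 (b / a)\<close> becomes a multiple of \<open>psi (norm a powr - 2) b\<close> by
  \<open>mix_divide\<close>, and the modular function supplies a further
  \<open>norm a powr d\<close>. The null set \<open>norm a = 1\<close> is assigned to
  \<open>hfun\<close>.\<close>

definition hfun :: "'a \<Rightarrow> 'a \<Rightarrow> real" where
  "hfun b a = (if norm a \<le> 1 then kappa * norm a powr (real DIM('a) + 1) * psi (norm a powr - 2) b else 0)"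

lemma ffun_measurable [measurable]: "case_prod ffun \<in> borel_measurable (borel \<Otimes>\<^sub>M borel)"
  unfolding ffun_def by measurable

lemma hfun_measurable [measurable]: "case_prod hfun \<in> borel_measurable (borel \<Otimes>\<^sub>M borel)"
  unfolding hfun_def by measurable

lemma ffun_nonneg: "0 \<le> ffun b a"
  using kappa_pos by (simp add: ffun_def psi_nonneg)

lemma hfun_nonneg: "0 \<le> hfun b a"
  using kappa_pos by (simp add: hfun_def psi_nonneg)

text \<open>After the dilation by \<open>\<alpha>\<close> both factors have the same rate
  \<open>w = norm \<alpha> powr - 2\<close>, so the convolution in \<open>b\<close> is
  \<open>mix_convolution_self\<close>. The supports require \<open>1 \<le> w\<close> and
  \<open>norm a powr - 2 < w\<close>, which explains the maximum \<open>c\<close>, and the radial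
  formula leaves the integral of \<open>nn_integral_laplace_mix\<close>.\<close>

lemma hfun_ffun_value:
  assumes a: "a \<noteq> 0"
  defines "c \<equiv> max 1 (norm a powr - 2)"
  shows "ennreal C * (\<integral>\<^sup>+\<alpha>. (\<integral>\<^sup>+\<beta>. ennreal (hfun \<beta> \<alpha> * ffun ((b - \<beta>) / \<alpha>) (a / \<alpha>)) \<partial>lborel)
        * ennreal (norm \<alpha> powr (- 2 * real DIM('a))) \<partial>lborel)
    = ennreal (kappa * norm a powr (real DIM('a) - 1) / c) * mix c b"
proof -
  let ?d = "real DIM('a)" and ?c0 = "norm a powr - 2"
  let ?P = "\<lambda>\<alpha> \<beta>. hfun \<beta> \<alpha> * ffun ((b - \<beta>) / \<alpha>) (a / \<alpha>)"
  let ?J = "\<lambda>\<alpha>. (\<integral>\<^sup>+\<beta>. ennreal (?P \<alpha> \<beta>) \<partial>lborel)"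
  let ?k = "\<lambda>x y. kappa\<^sup>2 * x powr (?d + 1) * (y / x) powr (?d - 1)"
  define M where "M w = (\<integral>\<^sup>+v. ennreal (v * exp (- w * v)) * ennreal (gauss v b) \<partial>lborel)" for w
  have [measurable]: "M \<in> borel_measurable borel" unfolding M_def by measurable
  define S where "S = {w. 1 \<le> w \<and> ?c0 < w}"
  have Sm [measurable]: "S \<in> sets borel" unfolding S_def by measurable
  have c0: "0 < ?c0" and c: "0 < c" using a by (simp_all add: c_def)
  have point: "?J \<alpha> * ennreal (norm \<alpha> powr (- 2 * ?d))
    = ennreal (kappa\<^sup>2 * norm a powr (?d - 1)) * ((indicator S (norm \<alpha> powr - 2) * M (norm \<alpha> powr - 2)) * ennreal (norm \<alpha> powr (- ?d - 2)))" for \<alpha>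
  proof (cases "\<alpha> = 0")
    case False
    define x where "x = norm \<alpha>"
    define y where "y = norm a"
    have x: "0 < x" and y: "0 < y" using False a by (simp_all add: x_def y_def)
    let ?W = "x powr - 2"
    have W: "0 < ?W" using x by simp
    have c1: "1 \<le> ?W \<longleftrightarrow> x \<le> 1" using powr_minus_two_less_iff[of 1 x] x by auto
    have c2: "y powr - 2 < ?W \<longleftrightarrow> 1 < y / x" using powr_minus_two_less_iff[OF x y] x by auto
    have na: "norm (a / \<alpha>) = y / x" by (simp add: norm_divide x_def y_def)
    show ?thesis
    proof (cases "x \<le> 1 \<and> 1 < y / x")
      case True
      then have SW: "?W \<in> S" using c1 c2 by (simp add: S_def y_def)
      have "?J \<alpha>
        = (\<integral>\<^sup>+\<beta>. ennreal (?k x y) * ennreal (psi ?W \<beta> * psi 1 ((b - \<beta>) / \<alpha>)) \<partial>lborel)"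
      proof (rule nn_integral_cong, goal_cases)
        case (1 \<beta>)
        have "?P \<alpha> \<beta>
          = (?k x y) * (psi ?W \<beta> * psi 1 ((b - \<beta>) / \<alpha>))"
          using True by (simp add: hfun_def ffun_def na x_def[symmetric] power2_eq_square ac_simps)
        then show ?case
          by (simp only: ennreal_mult'' mult_nonneg_nonneg psi_nonneg)
      qed
      also have "\<dots> = ennreal (?k x y) * (\<integral>\<^sup>+\<beta>. ennreal (psi ?W \<beta> * psi 1 ((b - \<beta>) / \<alpha>)) \<partial>lborel)"
        by (rule nn_integral_cmult) measurable
      also have "(\<integral>\<^sup>+\<beta>. ennreal (psi ?W \<beta> * psi 1 ((b - \<beta>) / \<alpha>)) \<partial>lborel) = ennreal (x powr ?d) * (\<integral>\<^sup>+\<beta>. mix ?W \<beta> * mix ?W (b - \<beta>) \<partial>lborel)"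
        using psi_convolution[OF False W, of 1 b] by (simp add: x_def)
      also have "(\<integral>\<^sup>+\<beta>. mix ?W \<beta> * mix ?W (b - \<beta>) \<partial>lborel) = (\<integral>\<^sup>+v. ennreal (?W\<^sup>2 * v * exp (- ?W * v)) * ennreal (gauss v b) \<partial>lborel)"
        by (rule mix_convolution_self[OF W])
      also have "\<dots> = (\<integral>\<^sup>+v. ennreal (?W\<^sup>2) * (ennreal (v * exp (- ?W * v)) * ennreal (gauss v b)) \<partial>lborel)"
        by (intro nn_integral_cong) (simp add: mult.assoc ennreal_mult'[of "?W\<^sup>2"])
      also have "\<dots> = ennreal (?W\<^sup>2) * M ?W"
        unfolding M_def by (rule nn_integral_cmult) measurable
      finally have I: "?J \<alpha>
        = ennreal (?k x y) * (ennreal (x powr ?d) * (ennreal (?W\<^sup>2) * M ?W))" .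
      have "?k x y * x powr ?d * ?W\<^sup>2 * x powr (- 2 * ?d) = kappa\<^sup>2 * y powr (?d - 1) * x powr (- ?d - 2)"
      proof -
        have "x powr (?d + 1) * (y / x) powr (?d - 1) * x powr ?d * ?W\<^sup>2 * x powr (- 2 * ?d) = y powr (?d - 1) * x powr (- ?d - 2)"
          using x y by (simp add: powr_def ln_div power2_eq_square exp_add[symmetric] algebra_simps)
        then show ?thesis by (simp only: mult.assoc)
      qed
      then have "ennreal (?k x y) * ennreal (x powr ?d) * ennreal (?W\<^sup>2) * ennreal (x powr (- 2 * ?d))
        = ennreal (kappa\<^sup>2 * y powr (?d - 1)) * ennreal (x powr (- ?d - 2))"
        by (simp add: ennreal_mult[symmetric])
      then have "ennreal (?k x y) * (ennreal (x powr ?d) * (ennreal (?W\<^sup>2) * M ?W)) * ennreal (x powr (- 2 * ?d))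
        = ennreal (kappa\<^sup>2 * y powr (?d - 1)) * (M ?W * ennreal (x powr (- ?d - 2)))"
        by (rule ennreal_rearrange4)
      then show ?thesis using I SW by (simp only: x_def[symmetric] y_def[symmetric] indicator_simps mult_1_left)
    next
      case no: False
      then have "?W \<notin> S" using c1 c2 by (auto simp: S_def y_def)
      moreover have "?J \<alpha> = (\<integral>\<^sup>+(\<beta> :: 'a). 0 \<partial>lborel)"
      proof (rule nn_integral_cong, goal_cases)
        case (1 \<beta>)
        show ?case
          using no by (auto simp: hfun_def ffun_def na x_def[symmetric])
      qed
      ultimately show ?thesis by (simp add: x_def)
    qed
  qed simp
  have "(\<integral>\<^sup>+\<alpha>. ?J \<alpha> * ennreal (norm \<alpha> powr (- 2 * ?d)) \<partial>lborel)
    = ennreal (kappa\<^sup>2 * norm a powr (?d - 1)) * (\<integral>\<^sup>+\<alpha>. (indicator S (norm \<alpha> powr - 2) * M (norm \<alpha> powr - 2)) * ennreal (norm (\<alpha>::'a) powr (- ?d - 2)) \<partial>lborel)"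
    unfolding point by (rule nn_integral_cmult) measurable
  also have "(\<integral>\<^sup>+\<alpha>. (indicator S (norm \<alpha> powr - 2) * M (norm \<alpha> powr - 2)) * ennreal (norm (\<alpha>::'a) powr (- ?d - 2)) \<partial>lborel)
    = ennreal (tail_mass TYPE('a)) * (\<integral>\<^sup>+w. indicator S w * M w * indicator {0<..} w \<partial>lborel)"
    by (rule nn_integral_radial[of "\<lambda>w. indicator S w * M w"]) measurable
  also have "(\<integral>\<^sup>+w. indicator S w * M w * indicator {0<..} w \<partial>lborel) = (\<integral>\<^sup>+w. indicator S w * M w \<partial>lborel)"
    by (intro nn_integral_cong) (auto simp: S_def indicator_def)
  also have "\<dots> = ennreal (1 / c) * mix c b"
    unfolding M_def by (rule nn_integral_laplace_mix[OF c _ Sm]) (auto simp: S_def c_def max_def)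
  finally have "ennreal C * (\<integral>\<^sup>+\<alpha>. ?J \<alpha> * ennreal (norm \<alpha> powr (- 2 * ?d)) \<partial>lborel)
    = (ennreal C * ennreal (kappa\<^sup>2 * norm a powr (?d - 1)) * ennreal (tail_mass TYPE('a)) * ennreal (1 / c)) * mix c b"
    by (simp only: mult.assoc)
  also have "ennreal C * ennreal (kappa\<^sup>2 * norm a powr (?d - 1)) * ennreal (tail_mass TYPE('a)) * ennreal (1 / c)
    = ennreal (C * (kappa\<^sup>2 * norm a powr (?d - 1)) * tail_mass TYPE('a) * (1 / c))"
    using C tail_mass_pos[where 'a = 'a] c by (simp add: ennreal_mult[symmetric])
  also have "C * (kappa\<^sup>2 * norm a powr (?d - 1)) * tail_mass TYPE('a) * (1 / c) = (C * kappa * tail_mass TYPE('a)) * (kappa * norm a powr (?d - 1) / c)"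
    by (simp add: power2_eq_square ac_simps)
  finally show ?thesis by (simp only: kappa_eq mult_1_left)
qed

text \<open>In this order the rates are 1 and \<open>(norm a / norm \<alpha>) powr - 2 * norm
  \<alpha> powr - 2 = norm a powr - 2\<close>, both independent of \<open>\<alpha>\<close>. The
  convolution \<open>X\<close> in \<open>b\<close> therefore leaves the integral, and what remains
  is a radial tail over \<open>norm a \<le> norm \<alpha>\<close>; for \<open>1 < norm a\<close>
  this already implies the support condition of \<open>ffun\<close>.\<close>

lemma ffun_hfun_value:
  assumes a: "1 < norm a"
  shows "ennreal C * (\<integral>\<^sup>+\<alpha>. (\<integral>\<^sup>+\<beta>. ennreal (ffun \<beta> \<alpha> * hfun ((b - \<beta>) / \<alpha>) (a / \<alpha>)) \<partial>lborel)
        * ennreal (norm \<alpha> powr (- 2 * real DIM('a))) \<partial>lborel)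
    = ennreal (kappa * norm a powr (real DIM('a) - 1)) * (\<integral>\<^sup>+\<gamma>. mix 1 \<gamma> * mix (norm a powr - 2) (b - \<gamma>) \<partial>lborel)"
proof -
  let ?d = "real DIM('a)" and ?c0 = "norm a powr - 2"
  let ?P = "\<lambda>\<alpha> \<beta>. ffun \<beta> \<alpha> * hfun ((b - \<beta>) / \<alpha>) (a / \<alpha>)"
  let ?J = "\<lambda>\<alpha>. (\<integral>\<^sup>+\<beta>. ennreal (?P \<alpha> \<beta>) \<partial>lborel)"
  let ?k = "\<lambda>x y. kappa\<^sup>2 * x powr (?d - 1) * (y / x) powr (?d + 1)"
  define X where "X = (\<integral>\<^sup>+\<gamma>. mix 1 \<gamma> * mix ?c0 (b - \<gamma>) \<partial>lborel)"
  have point: "?J \<alpha> * ennreal (norm \<alpha> powr (- 2 * ?d))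
    = (ennreal (kappa\<^sup>2 * norm a powr (?d + 1)) * X) * (indicator {..?c0} (norm \<alpha> powr - 2) * ennreal (norm \<alpha> powr (- ?d - 2)))" for \<alpha>
  proof (cases "\<alpha> = 0")
    case False
    define x where "x = norm \<alpha>"
    define y where "y = norm a"
    have x: "0 < x" and y: "0 < y" "1 < y" using False a by (auto simp: x_def y_def)
    have W: "0 < (y / x) powr - 2" using x y by simp
    have c2: "x powr - 2 \<le> y powr - 2 \<longleftrightarrow> y \<le> x" using powr_minus_two_less_iff[OF x y(1)] by (auto simp: not_less[symmetric])
    have na: "norm (a / \<alpha>) = y / x" by (simp add: norm_divide x_def y_def)
    show ?thesis
    proof (cases "y \<le> x")
      case True
      have SW: "x powr - 2 \<in> {..?c0}" using True c2 by (simp add: y_def)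
      have "?J \<alpha>
        = (\<integral>\<^sup>+\<beta>. ennreal (?k x y) * ennreal (psi 1 \<beta> * psi ((y / x) powr - 2) ((b - \<beta>) / \<alpha>)) \<partial>lborel)"
      proof (rule nn_integral_cong, goal_cases)
        case (1 \<beta>)
        have "?P \<alpha> \<beta>
          = (?k x y) * (psi 1 \<beta> * psi ((y / x) powr - 2) ((b - \<beta>) / \<alpha>))"
          using True x y by (simp add: hfun_def ffun_def na x_def[symmetric] power2_eq_square ac_simps)
        then show ?case
          by (simp only: ennreal_mult'' mult_nonneg_nonneg psi_nonneg)
      qed
      also have "\<dots> = ennreal (?k x y) * (\<integral>\<^sup>+\<beta>. ennreal (psi 1 \<beta> * psi ((y / x) powr - 2) ((b - \<beta>) / \<alpha>)) \<partial>lborel)"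
        by (rule nn_integral_cmult) measurable
      also have "(\<integral>\<^sup>+\<beta>. ennreal (psi 1 \<beta> * psi ((y / x) powr - 2) ((b - \<beta>) / \<alpha>)) \<partial>lborel) = ennreal (x powr ?d) * (\<integral>\<^sup>+\<beta>. mix 1 \<beta> * mix ((y / x) powr - 2 * x powr - 2) (b - \<beta>) \<partial>lborel)"
        using psi_convolution[OF False _ W, of 1 b] by (simp add: x_def)
      also have "(y / x) powr - 2 * x powr - 2 = ?c0"
        using x y by (simp add: powr_mult[symmetric] y_def)
      finally have I: "?J \<alpha>
        = ennreal (?k x y) * (ennreal (x powr ?d) * X)" by (simp only: X_def)
      have "?k x y * x powr ?d * x powr (- 2 * ?d) = kappa\<^sup>2 * y powr (?d + 1) * x powr (- ?d - 2)"
      proof -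
        have "x powr (?d - 1) * (y / x) powr (?d + 1) * x powr ?d * x powr (- 2 * ?d) = y powr (?d + 1) * x powr (- ?d - 2)"
          using x y by (simp add: powr_def ln_div exp_add[symmetric] algebra_simps)
        then show ?thesis by (simp only: mult.assoc)
      qed
      then have "ennreal (?k x y) * ennreal (x powr ?d) * ennreal (x powr (- 2 * ?d))
        = ennreal (kappa\<^sup>2 * y powr (?d + 1)) * ennreal (x powr (- ?d - 2))"
        by (simp add: ennreal_mult[symmetric])
      then have "ennreal (?k x y) * (ennreal (x powr ?d) * X) * ennreal (x powr (- 2 * ?d))
        = ennreal (kappa\<^sup>2 * y powr (?d + 1)) * X * ennreal (x powr (- ?d - 2))"
        by (rule ennreal_rearrange3)
      then show ?thesis using I SW by (simp only: x_def[symmetric] y_def[symmetric] indicator_simps mult_1_left)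
    next
      case no: False
      then have "x powr - 2 \<notin> {..?c0}" using c2 by (simp add: y_def)
      moreover have "?J \<alpha> = (\<integral>\<^sup>+(\<beta> :: 'a). 0 \<partial>lborel)"
      proof (rule nn_integral_cong, goal_cases)
        case (1 \<beta>)
        show ?case
          using no x by (auto simp: hfun_def na)
      qed
      ultimately show ?thesis by (simp add: x_def)
    qed
  qed simp
  have "(\<integral>\<^sup>+\<alpha>. ?J \<alpha> * ennreal (norm \<alpha> powr (- 2 * ?d)) \<partial>lborel)
    = (ennreal (kappa\<^sup>2 * norm a powr (?d + 1)) * X) * (\<integral>\<^sup>+\<alpha>. indicator {..?c0} (norm \<alpha> powr - 2) * ennreal (norm (\<alpha>::'a) powr (- ?d - 2)) \<partial>lborel)"
    unfolding point by (rule nn_integral_cmult) measurable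
  also have "(\<integral>\<^sup>+\<alpha>. indicator {..?c0} (norm \<alpha> powr - 2) * ennreal (norm (\<alpha>::'a) powr (- ?d - 2)) \<partial>lborel)
    = ennreal (tail_mass TYPE('a)) * (\<integral>\<^sup>+w. indicator {..?c0} w * indicator {0<..} w \<partial>lborel)"
    by (rule nn_integral_radial[of "indicator {..?c0}"]) measurable
  also have "(\<integral>\<^sup>+w. indicator {..?c0} w * indicator {0<..} w \<partial>lborel) = (\<integral>\<^sup>+w. indicator {0<..?c0} w \<partial>lborel)"
    by (intro nn_integral_cong) (auto simp: indicator_def)
  also have "\<dots> = ennreal ?c0" by simp
  finally have "ennreal C * (\<integral>\<^sup>+\<alpha>. ?J \<alpha> * ennreal (norm \<alpha> powr (- 2 * ?d)) \<partial>lborel)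
    = (ennreal C * ennreal (kappa\<^sup>2 * norm a powr (?d + 1)) * ennreal (tail_mass TYPE('a)) * ennreal ?c0) * X"
    by (simp only: ac_simps)
  also have "ennreal C * ennreal (kappa\<^sup>2 * norm a powr (?d + 1)) * ennreal (tail_mass TYPE('a)) * ennreal ?c0
    = ennreal (C * (kappa\<^sup>2 * norm a powr (?d + 1)) * tail_mass TYPE('a) * ?c0)"
    using C tail_mass_pos[where 'a = 'a] by (simp add: ennreal_mult[symmetric])
  also have "C * (kappa\<^sup>2 * norm a powr (?d + 1)) * tail_mass TYPE('a) * ?c0 = (C * kappa * tail_mass TYPE('a)) * (kappa * (norm a powr (?d + 1) * ?c0))"
    by (simp add: power2_eq_square ac_simps)
  also have "norm a powr (?d + 1) * ?c0 = norm a powr (?d - 1)" by (simp add: powr_add[symmetric])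
  finally show ?thesis by (simp only: kappa_eq mult_1_left X_def)
qed

end

lemma ennreal_rearrange3': "c * (k * z * w) = q * z" if "c * k * w = q" for c k z w q :: ennreal
  unfolding that[symmetric] by (simp only: ac_simps)

lemma ball_not_null: "0 < r \<Longrightarrow> \<not> (AE x in lborel. x \<notin> ball (c :: 'a::euclidean_space) r)"
proof
  assume r: "0 < r" and "AE x in lborel. x \<notin> ball c r"
  then have "ball c r \<in> null_sets lborel" by (subst AE_iff_null_sets) auto
  then have "emeasure lborel (ball c r) = 0" by (simp add: null_sets_def)
  moreover have "emeasure lborel (ball c r) = ennreal (unit_ball_vol (real DIM('a)) * r ^ DIM('a))"
    using r by (simp add: emeasure_ball)
  moreover have "0 < unit_ball_vol (real DIM('a)) * r ^ DIM('a)" using r by simp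
  ultimately show False by (metis ennreal_eq_0_iff not_le)
qed

section \<open>A test function separating \<open>f + h\<close> from \<open>f * h\<close>\<close>

context affine_haar
begin

text \<open>The annulus is chosen so that, at points with \<open>2 < norm a\<close>, only factors
  with \<open>norm a / 2 < norm \<alpha> < norm a\<close> contribute. These satisfy
  \<open>1 < norm \<alpha>\<close>, so \<open>hfun\<close> drops out. The Gaussian in
  \<open>b\<close> merely adds its variance to those of the mixtures.\<close>

definition test_fun :: "'a \<Rightarrow> 'a \<Rightarrow> real" where
  "test_fun b a = (if 1 < norm a \<and> norm a < 2 then gauss 1 b else 0)"

lemma test_fun_measurable [measurable]: "case_prod test_fun \<in> borel_measurable (borel \<Otimes>\<^sub>M borel)"
  unfolding test_fun_def by measurable

lemma test_fun_nonneg: "0 \<le> test_fun b a"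
  by (simp add: test_fun_def gauss_nonneg)

lemma integrable_lift_test_fun: "integrable \<mu> (lift test_fun)"
proof (rule lift_integrable)
  have "(\<integral>\<^sup>+a. (\<integral>\<^sup>+b. ennreal (test_fun b a) \<partial>lborel) * ennreal (norm a powr (- 2 * real DIM('a))) \<partial>lborel)
    \<le> (\<integral>\<^sup>+(a::'a). indicator (ball 0 2) a \<partial>lborel)"
  proof (rule nn_integral_mono, goal_cases)
    case (1 a)
    show ?case
    proof (cases "1 < norm a \<and> norm a < 2")
      case True
      have "norm a powr (- 2 * real DIM('a)) \<le> norm a powr 0" using True by (intro powr_mono) auto
      also have "norm a powr 0 \<le> 1" by simp
      finally show ?thesis using True by (simp add: test_fun_def nn_integral_gauss)
    next
      case False
      then have "test_fun b a = 0" for b by (auto simp: test_fun_def)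
      then show ?thesis by simp
    qed
  qed
  also have "(\<integral>\<^sup>+(a::'a). indicator (ball 0 2) a \<partial>lborel) < \<infinity>" using emeasure_lborel_ball_finite[of "0::'a" 2] by simp
  finally show "(\<integral>\<^sup>+a. (\<integral>\<^sup>+b. ennreal (test_fun b a) \<partial>lborel) * ennreal (norm a powr (- 2 * real DIM('a))) \<partial>lborel) < \<infinity>" .
qed (measurable, rule test_fun_nonneg)

text \<open>A bounded integrable function: with bound \<open>?B\<close>, its p-th power is at most
  \<open>?B powr (p - 1)\<close> times its norm.\<close>

lemma in_Lp_lift_test_fun:
  assumes p: "1 \<le> p"
  shows "in_Lp p \<mu> (lift test_fun)"
proof -
  let ?B = "1 / gauss_mass TYPE('a)"
  have m [measurable]: "lift test_fun \<in> borel_measurable \<mu>" by (rule lift_measurable) measurable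
  have B0: "0 \<le> ?B" using gauss_mass_pos[where 'a = 'a] by simp
  have le: "norm (lift test_fun x) \<le> ?B" for x
    using gauss_le[of 1 "x $ 1 $ 2"] B0 by (simp add: lift_def test_fun_def gauss_nonneg)
  have "integrable \<mu> (\<lambda>x. norm (lift test_fun x) powr p)"
  proof (rule Bochner_Integration.integrable_bound)
    show "integrable \<mu> (\<lambda>x. ?B powr (p - 1) * norm (lift test_fun x))"
      using integrable_lift_test_fun by simp
    show "AE x in \<mu>. norm (norm (lift test_fun x) powr p) \<le> norm (?B powr (p - 1) * norm (lift test_fun x))"
    proof (rule AE_I2)
      fix x
      let ?t = "norm (lift test_fun x)"
      have "?t powr p = ?t powr (p - 1) * ?t"
        by (cases "?t = 0") (simp_all add: powr_diff)
      also have "\<dots> \<le> ?B powr (p - 1) * ?t"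
        using le[of x] p by (intro mult_right_mono powr_mono2) auto
      finally show "norm (?t powr p) \<le> norm (?B powr (p - 1) * ?t)" by simp
    qed
  qed measurable
  then show ?thesis by (simp add: in_Lp_def)
qed

text \<open>\<open>psi 1\<close> has total mass 1, so the exponent left over is
  \<open>(d - 1) - 2 * d = - (d + 1)\<close>, just beyond the threshold of
  \<open>radial_tail_finite\<close>.\<close>

lemma integrable_lift_ffun: "integrable \<mu> (lift ffun)"
proof (rule lift_integrable)
  let ?d = "real DIM('a)"
  have "(\<integral>\<^sup>+a. (\<integral>\<^sup>+b. ennreal (ffun b a) \<partial>lborel) * ennreal (norm a powr (- 2 * ?d)) \<partial>lborel)
    = (\<integral>\<^sup>+(a::'a). ennreal kappa * (ennreal (norm a powr - (?d + 1)) * indicator {a. 1 < norm a} a) \<partial>lborel)"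
  proof (rule nn_integral_cong, goal_cases)
    case (1 a)
    show ?case
    proof (cases "1 < norm a")
      case True
      have "(\<integral>\<^sup>+b. ennreal (ffun b a) \<partial>lborel) = (\<integral>\<^sup>+b. ennreal (psi 1 (b :: 'a)) * ennreal (kappa * norm a powr (?d - 1)) \<partial>lborel)"
        using True kappa_pos by (intro nn_integral_cong) (simp add: ffun_def ennreal_mult[symmetric] psi_nonneg ac_simps)
      also have "\<dots> = ennreal (kappa * norm a powr (?d - 1))"
        using nn_integral_psi_mult[of 1 "\<lambda>_::'a. 1"] nn_integral_mix[of 1, where 'a = 'a]
        by (subst nn_integral_multc) simp_all
      finally have "(\<integral>\<^sup>+b. ennreal (ffun b a) \<partial>lborel) * ennreal (norm a powr (- 2 * ?d)) = ennreal (kappa * (norm a powr (?d - 1) * norm a powr (- 2 * ?d)))"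
        using kappa_pos by (simp add: ennreal_mult[symmetric] mult.assoc)
      also have "norm a powr (?d - 1) * norm a powr (- 2 * ?d) = norm a powr - (?d + 1)"
        by (simp add: powr_add[symmetric])
      finally show ?thesis using True kappa_pos by (simp add: ennreal_mult)
    qed (simp add: ffun_def)
  qed
  also have "\<dots> = ennreal kappa * (\<integral>\<^sup>+(a::'a). ennreal (norm a powr - (?d + 1)) * indicator {a. 1 < norm a} a \<partial>lborel)"
    by (rule nn_integral_cmult) measurable
  also have "\<dots> < \<infinity>" using radial_tail_finite[where 'a = 'a, of "?d + 1"] by (simp add: ennreal_mult_less_top)
  finally show "(\<integral>\<^sup>+a. (\<integral>\<^sup>+b. ennreal (ffun b a) \<partial>lborel) * ennreal (norm a powr (- 2 * ?d)) \<partial>lborel) < \<infinity>" .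
qed (measurable, rule ffun_nonneg)

text \<open>In the radial variable \<open>w = norm a powr - 2\<close> the support becomes
  \<open>1 \<le> w\<close> and the integrand a multiple of \<open>w powr (- 3 / 2)\<close>.\<close>

lemma integrable_lift_hfun: "integrable \<mu> (lift hfun)"
proof (rule lift_integrable)
  let ?d = "real DIM('a)"
  have "(\<integral>\<^sup>+a. (\<integral>\<^sup>+b. ennreal (hfun b a) \<partial>lborel) * ennreal (norm a powr (- 2 * ?d)) \<partial>lborel)
    = (\<integral>\<^sup>+(a::'a). (ennreal kappa * (ennreal ((norm a powr - 2) powr (- 1 / 2 - 1)) * indicator {1..} (norm a powr - 2))) * ennreal (norm a powr (- ?d - 2)) \<partial>lborel)"
  proof (rule nn_integral_cong, goal_cases)
    case (1 a)
    show ?case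
    proof (cases "a = 0")
      case False
      then have a: "0 < norm a" by simp
      then have iff: "1 \<le> norm a powr - 2 \<longleftrightarrow> norm a \<le> 1" using powr_minus_two_less_iff[of 1 "norm a"] by auto
      show ?thesis
      proof (cases "norm a \<le> 1")
        case True
        have "(\<integral>\<^sup>+b. ennreal (hfun b a) \<partial>lborel) = (\<integral>\<^sup>+b. ennreal (psi (norm a powr - 2) (b :: 'a)) * ennreal (kappa * norm a powr (?d + 1)) \<partial>lborel)"
          using True kappa_pos by (intro nn_integral_cong) (simp add: hfun_def ennreal_mult[symmetric] psi_nonneg ac_simps)
        also have "\<dots> = ennreal (kappa * norm a powr (?d + 1))"
          using nn_integral_psi_mult[of "norm a powr - 2" "\<lambda>_::'a. 1"] nn_integral_mix[of "norm a powr - 2", where 'a = 'a] a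
          by (subst nn_integral_multc) simp_all
        finally have "(\<integral>\<^sup>+b. ennreal (hfun b a) \<partial>lborel) * ennreal (norm a powr (- 2 * ?d)) = ennreal (kappa * (norm a powr (?d + 1) * norm a powr (- 2 * ?d)))"
          using kappa_pos by (simp add: ennreal_mult[symmetric] mult.assoc)
        also have "norm a powr (?d + 1) * norm a powr (- 2 * ?d) = (norm a powr - 2) powr (- 1 / 2 - 1) * norm a powr (- ?d - 2)"
        proof -
          have "?d + 1 + - 2 * ?d = - 2 * (- 1 / 2 - 1) + (- ?d - 2)" by simp
          then show ?thesis by (simp only: powr_powr powr_add[symmetric])
        qed
        finally show ?thesis using True iff kappa_pos by (simp add: ennreal_mult mult.assoc)
      next
        case no: False
        then have "hfun b a = 0" for b by (simp add: hfun_def)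
        then show ?thesis using no iff by simp
      qed
    qed simp
  qed
  also have "\<dots> = ennreal (tail_mass TYPE('a)) * (\<integral>\<^sup>+w. (ennreal kappa * (ennreal (w powr (- 1 / 2 - 1)) * indicator {1..} w)) * indicator {0<..} w \<partial>lborel)"
    by (rule nn_integral_radial[of "\<lambda>w. ennreal kappa * (ennreal (w powr (- 1 / 2 - 1)) * indicator {1..} w)"]) measurable
  also have "(\<integral>\<^sup>+w. (ennreal kappa * (ennreal (w powr (- 1 / 2 - 1)) * indicator {1..} w)) * indicator {0<..} w \<partial>lborel)
    = (\<integral>\<^sup>+w. ennreal (2 * kappa) * (ennreal (1 / 2 * w powr (- (1 / 2) - 1)) * indicator {1..} w) \<partial>lborel)"
    using kappa_pos by (intro nn_integral_cong) (auto simp: indicator_def ennreal_mult[symmetric])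
  also have "\<dots> = ennreal (2 * kappa) * ennreal (1 powr - (1 / 2))"
    by (subst nn_integral_cmult, measurable, subst nn_integral_powr_tail) simp_all
  also have "ennreal (tail_mass TYPE('a)) * (ennreal (2 * kappa) * ennreal (1 powr - (1 / 2))) < \<infinity>"
    by (simp add: ennreal_mult_less_top)
  finally show "(\<integral>\<^sup>+a. (\<integral>\<^sup>+b. ennreal (hfun b a) \<partial>lborel) * ennreal (norm a powr (- 2 * ?d)) \<partial>lborel) < \<infinity>" .
qed (measurable, rule hfun_nonneg)

text \<open>The maximum \<open>c\<close> is 1 on the support of \<open>f\<close> and
  \<open>norm a powr - 2\<close> on that of \<open>h\<close>. Dividing by it raises the exponent
  \<open>d - 1\<close> to \<open>d + 1\<close> in the second case.\<close>

lemma convolution_hfun_ffun: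
  "AE x in \<mu>. convolution affine_group \<mu> (lift hfun) (lift ffun) x = lift hfun x + lift ffun x"
proof -
  have "{x :: 'a ^ 2 ^ 2. x $ 1 $ 2 \<noteq> 0} \<in> sets borel"
    by (intro borel_open open_Collect_neq continuous_intros)
  then have "AE x in \<mu>. x $ 1 $ 2 \<noteq> 0"
    by (rule haar_AE_I) (simp add: AE_lborel_singleton)
  then show ?thesis using AE_space
  proof eventually_elim
    fix x assume b: "x $ 1 $ 2 \<noteq> 0" and "x \<in> space \<mu>"
    then obtain b a where x: "x = aff b a" "a \<noteq> 0" unfolding space_eq by (elim carrier_affE)
    with b have b: "b \<noteq> 0" by simp
    let ?d = "real DIM('a)"
    define c where "c = max 1 (norm a powr - 2)"
    have c: "0 < c" by (simp add: c_def)
    have "convolution affine_group \<mu> (lift hfun) (lift ffun) x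
      = complex_of_real (enn2real (ennreal (kappa * norm a powr (?d - 1) / c) * mix c b))"
      unfolding x(1) c_def
      by (subst convolution_lift[OF hfun_measurable ffun_measurable hfun_nonneg ffun_nonneg x(2)])
        (simp only: hfun_ffun_value[OF x(2)])
    also have "enn2real (ennreal (kappa * norm a powr (?d - 1) / c) * mix c b) = kappa * norm a powr (?d - 1) / c * psi c b"
      using kappa_pos c by (simp add: enn2real_mult psi_def)
    also have "\<dots> = hfun b a + ffun b a"
    proof (cases "1 < norm a")
      case True
      moreover have "0 < norm a" using True by linarith
      ultimately have "norm a powr - 2 < 1" using powr_minus_two_less_iff[of 1 "norm a"] by simp
      then show ?thesis using True by (simp add: ffun_def hfun_def c_def)
    next
      case False
      then have a: "0 < norm a" "norm a \<le> 1" using x by auto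
      then have c': "c = norm a powr - 2" using powr_minus_two_less_iff[of 1 "norm a"] by (auto simp: c_def max_def not_less)
      have "?d - 1 - - 2 = ?d + 1" by simp
      then have "norm a powr (?d - 1) / c = norm a powr (?d + 1)"
        unfolding c' by (simp only: powr_diff[symmetric])
      then have "kappa * norm a powr (?d - 1) / c = kappa * norm a powr (?d + 1)"
        by (simp only: times_divide_eq_right[symmetric])
      then show ?thesis using False by (simp add: ffun_def hfun_def c')
    qed
    finally have "convolution affine_group \<mu> (lift hfun) (lift ffun) x = complex_of_real (hfun b a + ffun b a)" .
    moreover have "lift hfun x + lift ffun x = complex_of_real (hfun b a + ffun b a)"
      by (simp add: x lift_def)
    ultimately show "convolution affine_group \<mu> (lift hfun) (lift ffun) x = lift hfun x + lift ffun x"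
      by simp
  qed
qed

text \<open>On \<open>1 < norm a\<close> both \<open>f\<close> and \<open>f * h\<close> have the
  shape of \<open>g\<close>, with different profiles \<open>q\<close>; a common formula makes their
  values comparable under the integral over \<open>\<alpha>\<close>. Dilation by
  \<open>\<alpha>\<close> gives the test Gaussian the variance parameter
  \<open>(norm \<alpha>)\<^sup>2\<close>.\<close>

lemma convolution_test_value:
  fixes q :: "'a \<Rightarrow> 'a \<Rightarrow> real"
  assumes [measurable]: "case_prod q \<in> borel_measurable (borel \<Otimes>\<^sub>M borel)" and q0: "\<And>b a. 0 \<le> q b a" and a: "2 < norm a"
  defines "g \<equiv> \<lambda>b a. if 1 < norm a then kappa * norm a powr (real DIM('a) - 1) * q b a else 0"
  shows "convolution affine_group \<mu> (lift g) (lift test_fun) (aff b a)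
    = complex_of_real (enn2real (\<integral>\<^sup>+\<alpha>. ennreal (if norm a / 2 < norm \<alpha> \<and> norm \<alpha> < norm a then C * kappa * norm \<alpha> powr - 1 else 0)
        * (\<integral>\<^sup>+\<beta>. ennreal (q \<beta> \<alpha>) * ennreal (gauss ((norm \<alpha>)\<^sup>2) (b - \<beta>)) \<partial>lborel) \<partial>lborel))"
proof -
  let ?d = "real DIM('a)"
  let ?P = "\<lambda>\<alpha> \<beta>. g \<beta> \<alpha> * test_fun ((b - \<beta>) / \<alpha>) (a / \<alpha>)"
  let ?J = "\<lambda>\<alpha>. (\<integral>\<^sup>+\<beta>. ennreal (?P \<alpha> \<beta>) \<partial>lborel)"
  have gm [measurable]: "case_prod g \<in> borel_measurable (borel \<Otimes>\<^sub>M borel)" unfolding g_def by measurable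
  have g0: "0 \<le> g b a" for b a using kappa_pos q0 by (simp add: g_def)
  have a0: "a \<noteq> 0" using a by auto
  have point: "ennreal C * (?J \<alpha> * ennreal (norm \<alpha> powr (- 2 * ?d)))
    = ennreal (if norm a / 2 < norm \<alpha> \<and> norm \<alpha> < norm a then C * kappa * norm \<alpha> powr - 1 else 0)
        * (\<integral>\<^sup>+\<beta>. ennreal (q \<beta> \<alpha>) * ennreal (gauss ((norm \<alpha>)\<^sup>2) (b - \<beta>)) \<partial>lborel)" for \<alpha>
  proof (cases "norm a / 2 < norm \<alpha> \<and> norm \<alpha> < norm a")
    case True
    then have x: "1 < norm \<alpha>" "\<alpha> \<noteq> 0" "0 < norm \<alpha>" using a by auto
    have r: "1 < norm a / norm \<alpha>" "norm a / norm \<alpha> < 2" using True x by (simp_all add: field_simps)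
    have "?J \<alpha>
      = (\<integral>\<^sup>+\<beta>. ennreal (kappa * norm \<alpha> powr (?d - 1) * norm \<alpha> powr ?d) * (ennreal (q \<beta> \<alpha>) * ennreal (gauss ((norm \<alpha>)\<^sup>2) (b - \<beta>))) \<partial>lborel)"
    proof (rule nn_integral_cong, goal_cases)
      case (1 \<beta>)
      have "?P \<alpha> \<beta>
        = (kappa * norm \<alpha> powr (?d - 1) * norm \<alpha> powr ?d) * (q \<beta> \<alpha> * gauss ((norm \<alpha>)\<^sup>2) (b - \<beta>))"
        using x r gauss_divide[OF x(2), of 1 "b - \<beta>"] by (simp add: g_def test_fun_def norm_divide ac_simps)
      then show ?case
        using q0 by (simp only: ennreal_mult'' mult_nonneg_nonneg gauss_nonneg)
    qed
    also have "\<dots> = ennreal (kappa * norm \<alpha> powr (?d - 1) * norm \<alpha> powr ?d) * (\<integral>\<^sup>+\<beta>. ennreal (q \<beta> \<alpha>) * ennreal (gauss ((norm \<alpha>)\<^sup>2) (b - \<beta>)) \<partial>lborel)"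
      by (rule nn_integral_cmult) measurable
    finally have I: "?J \<alpha>
      = ennreal (kappa * norm \<alpha> powr (?d - 1) * norm \<alpha> powr ?d) * (\<integral>\<^sup>+\<beta>. ennreal (q \<beta> \<alpha>) * ennreal (gauss ((norm \<alpha>)\<^sup>2) (b - \<beta>)) \<partial>lborel)" .
    have "C * (kappa * norm \<alpha> powr (?d - 1) * norm \<alpha> powr ?d) * norm \<alpha> powr (- 2 * ?d) = C * kappa * (norm \<alpha> powr (?d - 1) * norm \<alpha> powr ?d * norm \<alpha> powr (- 2 * ?d))"
      by (simp only: ac_simps)
    also have "norm \<alpha> powr (?d - 1) * norm \<alpha> powr ?d * norm \<alpha> powr (- 2 * ?d) = norm \<alpha> powr - 1"
      by (simp only: powr_add[symmetric]) simp
    finally have "ennreal C * ennreal (kappa * norm \<alpha> powr (?d - 1) * norm \<alpha> powr ?d) * ennreal (norm \<alpha> powr (- 2 * ?d)) = ennreal (C * kappa * norm \<alpha> powr - 1)"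
      using C kappa_pos by (simp add: ennreal_mult[symmetric])
    from ennreal_rearrange3'[OF this] show ?thesis unfolding I if_P[OF True] .
  next
    case False
    have "?J \<alpha> = (\<integral>\<^sup>+(\<beta>::'a). 0 \<partial>lborel)"
    proof (rule nn_integral_cong, goal_cases)
      case (1 \<beta>)
      have "test_fun ((b - \<beta>) / \<alpha>) (a / \<alpha>) = 0"
      proof (cases "\<alpha> = 0")
        case no: False
        then have "\<not> (1 < norm a / norm \<alpha> \<and> norm a / norm \<alpha> < 2)" using False by (auto simp: field_simps)
        then show ?thesis by (auto simp: test_fun_def norm_divide)
      qed (simp add: test_fun_def)
      then show ?case by simp
    qed
    then show ?thesis using False by auto
  qed
  have "convolution affine_group \<mu> (lift g) (lift test_fun) (aff b a)
    = complex_of_real (enn2real (ennreal C * (\<integral>\<^sup>+\<alpha>. ?J \<alpha>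
        * ennreal (norm \<alpha> powr (- 2 * ?d)) \<partial>lborel)))"
    by (rule convolution_lift[OF gm test_fun_measurable g0 test_fun_nonneg a0])
  also have "ennreal C * (\<integral>\<^sup>+\<alpha>. ?J \<alpha>
        * ennreal (norm \<alpha> powr (- 2 * ?d)) \<partial>lborel)
    = (\<integral>\<^sup>+\<alpha>. ennreal C * (?J \<alpha>
        * ennreal (norm \<alpha> powr (- 2 * ?d))) \<partial>lborel)"
    by (rule nn_integral_cmult[symmetric]) measurable
  finally show ?thesis by (simp only: point)
qed

lemma convolution_hfun_test_fun:
  assumes a: "2 < norm a"
  shows "convolution affine_group \<mu> (lift hfun) (lift test_fun) (aff b a) = 0"
proof -
  have a0: "a \<noteq> 0" using a by auto
  have z: "hfun \<beta> \<alpha> * test_fun ((b - \<beta>) / \<alpha>) (a / \<alpha>) = 0" for \<beta> \<alpha>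
  proof (cases "norm \<alpha> \<le> 1 \<and> \<alpha> \<noteq> 0")
    case True
    then have "2 * norm \<alpha> < norm a" using a by auto
    then have "2 < norm a / norm \<alpha>" using True by (simp add: less_divide_eq)
    then show ?thesis by (simp add: test_fun_def norm_divide)
  qed (auto simp: hfun_def)
  show ?thesis
    by (subst convolution_lift[OF hfun_measurable test_fun_measurable hfun_nonneg test_fun_nonneg a0]) (simp add: z)
qed

text \<open>The profile of \<open>f * h\<close> on \<open>1 < norm a\<close>, in the place of
  \<open>psi 1\<close> for \<open>f\<close>.\<close>

definition fhfun :: "'a \<Rightarrow> 'a \<Rightarrow> real" where
  "fhfun b a = enn2real (\<integral>\<^sup>+\<gamma>. mix 1 \<gamma> * mix (norm a powr - 2) (b - \<gamma>) \<partial>lborel)"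

lemma fhfun_measurable [measurable]: "case_prod fhfun \<in> borel_measurable (borel \<Otimes>\<^sub>M borel)"
  unfolding fhfun_def by measurable

lemma convolution_ffun_hfun:
  assumes "1 < norm a"
  shows "convolution affine_group \<mu> (lift ffun) (lift hfun) (aff b a)
    = lift (\<lambda>b a. if 1 < norm a then kappa * norm a powr (real DIM('a) - 1) * fhfun b a else 0) (aff b a)"
proof -
  have a0: "a \<noteq> 0" using assms by auto
  show ?thesis
    using assms kappa_pos
    by (subst convolution_lift[OF ffun_measurable hfun_measurable ffun_nonneg hfun_nonneg a0], subst ffun_hfun_value[OF assms])
      (simp add: lift_def fhfun_def enn2real_mult)
qed

text \<open>Both sides average Gaussian mixtures at \<open>b\<close> over the same
  \<open>\<alpha>\<close> with the same weight \<open>k\<close>. The mixture for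
  \<open>f * h\<close> carries one more exponential variance, of rate
  \<open>norm \<alpha> powr - 2\<close>, and is smaller by
  \<open>mix_mix_gauss_less\<close>.\<close>

lemma test_value_neq:
  assumes a: "2 < norm a" and b: "norm b < 1 / 2"
  shows "convolution affine_group \<mu> (lift ffun) (lift test_fun) (aff b a) + convolution affine_group \<mu> (lift hfun) (lift test_fun) (aff b a)
    \<noteq> convolution affine_group \<mu> (convolution affine_group \<mu> (lift ffun) (lift hfun)) (lift test_fun) (aff b a)"
proof -
  let ?d = "real DIM('a)" and ?G = "affine_group :: ('a ^ 2 ^ 2) monoid"
  let ?g = "\<lambda>b a. if 1 < norm a then kappa * norm a powr (?d - 1) * fhfun b a else 0"
  let ?R = "{\<alpha> :: 'a. norm a / 2 < norm \<alpha> \<and> norm \<alpha> < norm a}"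
  define k where "k \<alpha> = ennreal (if norm a / 2 < norm \<alpha> \<and> norm \<alpha> < norm a then C * kappa * norm \<alpha> powr - 1 else 0)" for \<alpha> :: 'a
  have [measurable]: "k \<in> borel_measurable borel" unfolding k_def by measurable
  define Y1 where "Y1 \<alpha> = (\<integral>\<^sup>+s. ennreal (exp_density 1 s) * ennreal (gauss (s + (norm \<alpha>)\<^sup>2) b) \<partial>lborel)" for \<alpha> :: 'a
  define Y2 where "Y2 \<alpha> = (\<integral>\<^sup>+s. ennreal (exp_density 1 s) * (\<integral>\<^sup>+t. ennreal (exp_density (norm \<alpha> powr - 2) t) * ennreal (gauss (s + (t + (norm \<alpha>)\<^sup>2)) b) \<partial>lborel) \<partial>lborel)" for \<alpha> :: 'a
  have [measurable]: "Y1 \<in> borel_measurable borel" "Y2 \<in> borel_measurable borel"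
    unfolding Y1_def Y2_def exp_density_def by measurable
  have a0: "a \<noteq> 0" using a by auto
  have R: "1 < norm \<alpha>" "\<alpha> \<noteq> 0" "1 \<le> (norm \<alpha>)\<^sup>2" "0 < norm \<alpha> powr - 2" if "\<alpha> \<in> ?R" for \<alpha>
    using that a one_less_power[of "norm \<alpha>" 2] by auto
  have kpos: "0 < k \<alpha>" "k \<alpha> < \<infinity>" "k \<alpha> \<le> ennreal (C * kappa)" if "\<alpha> \<in> ?R" for \<alpha>
  proof -
    have "norm \<alpha> powr - 1 \<le> norm \<alpha> powr 0" using R(1)[OF that] by (intro powr_mono) auto
    also have "norm \<alpha> powr 0 = 1" using R(2)[OF that] by simp
    finally have "C * kappa * norm \<alpha> powr - 1 \<le> C * kappa * 1" using C kappa_pos by (intro mult_left_mono) auto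
    then show "k \<alpha> \<le> ennreal (C * kappa)" using that by (simp add: k_def ennreal_leI)
    show "0 < k \<alpha>" "k \<alpha> < \<infinity>" using that R(2)[OF that] C kappa_pos by (simp_all add: k_def)
  qed
  have k0: "k \<alpha> = 0" if "\<alpha> \<notin> ?R" for \<alpha> using that by (auto simp: k_def)
  define T1 where "T1 = (\<integral>\<^sup>+\<alpha>. k \<alpha> * Y1 \<alpha> \<partial>lborel)"
  define T2 where "T2 = (\<integral>\<^sup>+\<alpha>. k \<alpha> * (\<integral>\<^sup>+\<beta>. ennreal (fhfun \<beta> \<alpha>) * ennreal (gauss ((norm \<alpha>)\<^sup>2) (b - \<beta>)) \<partial>lborel) \<partial>lborel)"
  have v1: "convolution ?G \<mu> (lift ffun) (lift test_fun) (aff b a) = complex_of_real (enn2real T1)"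
  proof -
    have "(\<lambda>b a. if 1 < norm a then kappa * norm a powr (?d - 1) * psi 1 b else 0) = ffun"
      by (simp add: fun_eq_iff ffun_def)
    then have "convolution ?G \<mu> (lift ffun) (lift test_fun) (aff b a)
      = complex_of_real (enn2real (\<integral>\<^sup>+\<alpha>. k \<alpha> * (\<integral>\<^sup>+\<beta>. ennreal (psi 1 \<beta>) * ennreal (gauss ((norm \<alpha>)\<^sup>2) (b - \<beta>)) \<partial>lborel) \<partial>lborel))"
      using convolution_test_value[of "\<lambda>b a. psi 1 b" a b] a by (simp add: psi_nonneg k_def)
    also have "(\<integral>\<^sup>+\<alpha>. k \<alpha> * (\<integral>\<^sup>+\<beta>. ennreal (psi 1 \<beta>) * ennreal (gauss ((norm \<alpha>)\<^sup>2) (b - \<beta>)) \<partial>lborel) \<partial>lborel) = T1"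
      unfolding T1_def
    proof (rule nn_integral_cong, goal_cases)
      case (1 \<alpha>)
      show ?case
      proof (cases "\<alpha> \<in> ?R")
        case True
        then have "0 < (norm \<alpha>)\<^sup>2" using R by simp
        then show ?thesis by (simp add: nn_integral_psi_mult mix_gauss_convolution Y1_def)
      qed (simp add: k0)
    qed
    finally show ?thesis .
  qed
  have v2: "convolution ?G \<mu> (convolution ?G \<mu> (lift ffun) (lift hfun)) (lift test_fun) (aff b a) = complex_of_real (enn2real T2)"
  proof -
    \<comment> \<open>The product \<open>f * h\<close> is known explicitly for
      \<open>1 < norm \<alpha>\<close> only; for all other \<open>\<alpha>\<close> the test function
      vanishes at the translated point.\<close>
    have "convolution ?G \<mu> (convolution ?G \<mu> (lift ffun) (lift hfun)) (lift test_fun) (aff b a) = convolution ?G \<mu> (lift ?g) (lift test_fun) (aff b a)"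
      unfolding convolution_def[of ?G \<mu> _ "lift test_fun"]
    proof (rule Bochner_Integration.integral_cong[OF refl])
      fix y assume "y \<in> space \<mu>"
      then obtain \<beta> \<alpha> where y: "y = aff \<beta> \<alpha>" "\<alpha> \<noteq> 0" unfolding space_eq by (rule carrier_affE)
      show "convolution ?G \<mu> (lift ffun) (lift hfun) y * lift test_fun (inv\<^bsub>?G\<^esub> y \<otimes>\<^bsub>?G\<^esub> aff b a) = lift ?g y * lift test_fun (inv\<^bsub>?G\<^esub> y \<otimes>\<^bsub>?G\<^esub> aff b a)"
      proof (cases "1 < norm \<alpha>")
        case True
        then show ?thesis using convolution_ffun_hfun[OF True, of \<beta>] by (simp add: y)
      next
        case False
        then have "2 * norm \<alpha> < norm a" using a by auto
        then have "2 < norm a / norm \<alpha>" using y by (simp add: less_divide_eq)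
        then have "lift test_fun (inv\<^bsub>?G\<^esub> y \<otimes>\<^bsub>?G\<^esub> aff b a) = 0"
          using y by (simp add: aff_inv aff_mult' lift_def test_fun_def norm_divide)
        then show ?thesis by simp
      qed
    qed
    also have "\<dots> = complex_of_real (enn2real T2)"
      unfolding T2_def k_def by (rule convolution_test_value[OF fhfun_measurable _ a]) (simp add: fhfun_def)
    finally show ?thesis .
  qed
  have T1fin: "T1 < \<infinity>"
  proof -
    have "(\<integral>\<^sup>+\<alpha>. k \<alpha> * Y1 \<alpha> \<partial>lborel) \<le> (\<integral>\<^sup>+\<alpha>. ennreal (C * kappa) * ennreal (1 / gauss_mass TYPE('a)) * indicator (ball (0 :: 'a) (norm a)) \<alpha> \<partial>lborel)"
    proof (rule nn_integral_mono, goal_cases)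
      case (1 \<alpha>)
      show ?case
      proof (cases "\<alpha> \<in> ?R")
        case True
        have "Y1 \<alpha> \<le> (\<integral>\<^sup>+s. ennreal (exp_density 1 s) * ennreal (1 / gauss_mass TYPE('a)) \<partial>lborel)"
          unfolding Y1_def
        proof (rule nn_integral_mono, goal_cases)
          case (1 s)
          show ?case
            using gauss_le[of "s + (norm \<alpha>)\<^sup>2" b] R[OF True] by (cases "0 < s") (auto simp: exp_density_eq_0 intro!: mult_left_mono ennreal_leI)
        qed
        also have "\<dots> = ennreal (1 / gauss_mass TYPE('a))" by (simp add: nn_integral_multc nn_integral_exp_density)
        finally have "k \<alpha> * Y1 \<alpha> \<le> ennreal (C * kappa) * ennreal (1 / gauss_mass TYPE('a))"
          using kpos[OF True] by (intro mult_mono) auto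
        then show ?thesis using True by simp
      qed (simp add: k0)
    qed
    also have "\<dots> = ennreal (C * kappa) * ennreal (1 / gauss_mass TYPE('a)) * emeasure lborel (ball (0 :: 'a) (norm a))"
      by (rule nn_integral_cmult_indicator) simp
    also have "\<dots> < \<infinity>"
      using emeasure_lborel_ball_finite[of "0 :: 'a" "norm a"] by (simp add: ennreal_mult_less_top)
    finally show ?thesis unfolding T1_def .
  qed
  \<comment> \<open>Since \<open>enn2real\<close> sends infinity to 0, passing from
    \<open>fhfun\<close> back to the \<open>ennreal\<close> convolution can only increase the
    integral, and an upper bound for \<open>T2\<close> is what the comparison needs.\<close>
  have "T2 \<le> (\<integral>\<^sup>+\<alpha>. k \<alpha> * Y2 \<alpha> \<partial>lborel)"
    unfolding T2_def
  proof (rule nn_integral_mono, goal_cases)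
    case (1 \<alpha>)
    show ?case
    proof (cases "\<alpha> \<in> ?R")
      case True
      have "(\<integral>\<^sup>+\<beta>. ennreal (fhfun \<beta> \<alpha>) * ennreal (gauss ((norm \<alpha>)\<^sup>2) (b - \<beta>)) \<partial>lborel)
        \<le> (\<integral>\<^sup>+\<beta>. (\<integral>\<^sup>+\<gamma>. mix 1 \<gamma> * mix (norm \<alpha> powr - 2) (\<beta> - \<gamma>) \<partial>lborel) * ennreal (gauss ((norm \<alpha>)\<^sup>2) (b - \<beta>)) \<partial>lborel)"
        by (intro nn_integral_mono mult_right_mono) (simp_all add: fhfun_def ennreal_enn2real_if)
      also have "\<dots> = Y2 \<alpha>" unfolding Y2_def
        by (rule mix_mix_gauss_convolution) (use R[OF True] in auto)
      finally show ?thesis by (rule mult_left_mono) simp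
    qed (simp add: k0)
  qed
  also have "(\<integral>\<^sup>+\<alpha>. k \<alpha> * Y2 \<alpha> \<partial>lborel) < T1"
    unfolding T1_def
  proof (rule nn_integral_strict_mono[where S = ?R])
    have less: "Y2 \<alpha> < Y1 \<alpha>" if "\<alpha> \<in> ?R" for \<alpha>
      unfolding Y1_def Y2_def by (rule mix_mix_gauss_less[OF R(4,3)[OF that] b])
    show "k \<alpha> * Y2 \<alpha> \<le> k \<alpha> * Y1 \<alpha>" for \<alpha>
    proof (cases "\<alpha> \<in> ?R")
      case True
      then show ?thesis by (intro mult_left_mono less_imp_le[OF less]) simp_all
    qed (simp add: k0)
    show "k \<alpha> * Y2 \<alpha> < k \<alpha> * Y1 \<alpha>" if "\<alpha> \<in> ?R" for \<alpha>
      using kpos[OF that] less[OF that] by (intro ennreal_mult_strict_left_mono) auto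
    show "(\<integral>\<^sup>+\<alpha>. k \<alpha> * Y1 \<alpha> \<partial>lborel) < \<infinity>" using T1fin by (simp only: T1_def)
    show "\<not> (AE \<alpha> in lborel. \<alpha> \<notin> ?R)"
    proof
      assume "AE \<alpha> in lborel. \<alpha> \<notin> ?R"
      \<comment> \<open>A ball inside the annulus: its centre has norm
        \<open>3 / 4 * norm a\<close>, so within the radius \<open>norm a / 8\<close> all norms stay
        between 5/8 and 7/8 of \<open>norm a\<close>.\<close>
      then have "AE \<alpha> in lborel. \<alpha> \<notin> ball ((3 / 4) *\<^sub>R a) (norm a / 8)"
      proof eventually_elim
        case (elim \<alpha>)
        show ?case
        proof
          assume "\<alpha> \<in> ball ((3 / 4) *\<^sub>R a) (norm a / 8)"
          then have "norm ((3 / 4) *\<^sub>R a - \<alpha>) < norm a / 8" by (simp add: dist_norm)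
          moreover have "\<bar>norm ((3 / 4) *\<^sub>R a) - norm \<alpha>\<bar> \<le> norm ((3 / 4) *\<^sub>R a - \<alpha>)" by (rule norm_triangle_ineq3)
          moreover have "norm ((3 / 4) *\<^sub>R a) = 3 / 4 * norm a" by simp
          ultimately have "norm a / 2 < norm \<alpha> \<and> norm \<alpha> < norm a" using a by linarith
          with elim show False by simp
        qed
      qed
      moreover have "0 < norm a / 8" using a0 by simp
      ultimately show False using ball_not_null by blast
    qed
  qed simp_all
  finally have less: "T2 < T1" .
  then have "enn2real T2 < enn2real T1" using T1fin by (simp add: enn2real_less_iff less_trans)
  then show ?thesis using convolution_hfun_test_fun[OF a, of b] by (auto simp: v1 v2)
qed

theorem affine_not_directly_finite:
  assumes p: "1 \<le> p"
  shows "\<not> directly_finite (L1_algebra affine_group \<mu>)" "\<not> directly_finite (PF_algebra p affine_group \<mu>)"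
proof -
  let ?G = "affine_group :: ('a ^ 2 ^ 2) monoid"
  let ?E = "\<lambda>x. lift ffun x + lift hfun x - convolution ?G \<mu> (lift ffun) (lift hfun) x"
  note f = integrable_lift_ffun and h = integrable_lift_hfun
  have fh: "integrable \<mu> (convolution ?G \<mu> (lift ffun) (lift hfun))" by (rule integrable_convolution[OF f h])
  have sum: "integrable \<mu> (\<lambda>x. lift ffun x + lift hfun x)" using f h by simp
  have H: "in_Lp 1 \<mu> (lift test_fun)" by (rule in_Lp_lift_test_fun) simp
  have nE: "\<not> (AE x in \<mu>. convolution ?G \<mu> ?E (lift test_fun) x = 0)"
  proof
    assume E0: "AE x in \<mu>. convolution ?G \<mu> ?E (lift test_fun) x = 0"
    let ?R = "{x :: 'a ^ 2 ^ 2. \<not> (2 < norm (x $ 1 $ 1) \<and> norm (x $ 1 $ 2) < 1 / 2)}"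
    \<comment> \<open>By \<open>test_value_neq\<close> the test value is nonzero at every group
      element with \<open>2 < norm a\<close> and \<open>norm b < 1 / 2\<close>, so these would form
      a null set. In coordinates that forces \<open>norm a \<le> 2\<close> for almost every
      \<open>a\<close>, because balls in \<open>b\<close> are not null.\<close>
    have "AE x in \<mu>. \<not> (2 < norm (x $ 1 $ 1) \<and> norm (x $ 1 $ 2) < 1 / 2)"
      using E0 convolution_diff_left[OF sum fh H order_refl] convolution_add_left[OF f h H order_refl] AE_space
    proof eventually_elim
      case (elim x)
      then obtain b a where x: "x = aff b a" unfolding space_eq by (elim carrier_affE)
      have "\<not> (2 < norm a \<and> norm b < 1 / 2)" using test_value_neq[of a b] elim x by auto
      then show ?case by (simp add: x)
    qed
    moreover have "?R \<in> sets borel" by measurable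
    ultimately have "AE a::'a in lborel. a = 0 \<or> (AE b::'a in lborel. \<not> (2 < norm a \<and> norm b < 1 / 2))"
      using haar_AE_D[of "\<lambda>x. \<not> (2 < norm (x $ 1 $ 1) \<and> norm (x $ 1 $ 2) < 1 / 2)"] by simp
    then have "AE a::'a in lborel. norm a \<le> 2"
    proof eventually_elim
      case (elim a)
      show ?case
      proof (rule ccontr)
        assume "\<not> norm a \<le> 2"
        then have "AE b::'a in lborel. b \<notin> ball 0 (1 / 2)" using elim by auto
        then show False using ball_not_null[of "1 / 2" "0 :: 'a"] by simp
      qed
    qed
    then show False using norm_gt_not_null by blast
  qed
  show "\<not> directly_finite (L1_algebra affine_group \<mu>)"
    by (rule not_directly_finite(1)[OF f h convolution_hfun_ffun _ nE p]) (rule in_Lp_lift_test_fun)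
  show "\<not> directly_finite (PF_algebra p affine_group \<mu>)"
    by (rule not_directly_finite(2)[OF f h convolution_hfun_ffun _ nE p]) (rule in_Lp_lift_test_fun)
qed

end

lemma affine_group_not_directly_finite:
  fixes \<mu> :: "('a::{real_normed_field,euclidean_space} ^ 2 ^ 2) measure"
  assumes haar: "left_haar_measure affine_group \<mu>" and p: "1 \<le> p"
  shows "\<not> directly_finite (L1_algebra affine_group \<mu>)" "\<not> directly_finite (PF_algebra p affine_group \<mu>)"
proof -
  obtain C :: real where C: "0 < C" "\<And>F. F \<in> borel_measurable borel \<Longrightarrow> (\<integral>\<^sup>+x. F x \<partial>\<mu>) = ennreal C * aff_integral F"
    by (rule haar_eq_aff_integral[OF haar]) blast
  interpret affine_haar \<mu> C using haar C by unfold_locales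
  show "\<not> directly_finite (L1_algebra affine_group \<mu>)" "\<not> directly_finite (PF_algebra p affine_group \<mu>)"
    by (rule affine_not_directly_finite[OF p])+
qed

theorem theorem1p6:
  shows "(\<forall>\<mu> :: (real ^ 2 ^ 2) measure. left_haar_measure affine_group \<mu> \<longrightarrow>
            \<not> directly_finite (L1_algebra affine_group \<mu>) \<and>
            (\<forall>p>1. \<not> directly_finite (PF_algebra p affine_group \<mu>))) \<and>
         (\<forall>\<mu> :: (complex ^ 2 ^ 2) measure. left_haar_measure affine_group \<mu> \<longrightarrow>
            \<not> directly_finite (L1_algebra affine_group \<mu>) \<and>
            (\<forall>p>1. \<not> directly_finite (PF_algebra p affine_group \<mu>)))"
  by (intro conjI allI impI affine_group_not_directly_finite(1)[OF _ order_refl]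
    affine_group_not_directly_finite(2)[OF _ less_imp_le]) assumption+

end
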